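(* Let $\mathbb{K}$ be a field and let $q\in\mathbb{K}$ be a nonzero element having a square root $q^{1/2}$ in $\mathbb{K}$. Then the quantum Grassmannian $\mathbb{K}_{q}[\mathrm{Gr}(3,6)]$ is a quantum cluster algebra of type $D_{4}$.
   Context: Quantum Grassmannian. The quantum matrix algebra $\mathbb{K}_{q}[\mathrm{M}(k,n)]$ is the $\mathbb{K}$-algebra generated by $X_{ij}$ ($1\leq i\leq k$, $1\leq j\leq n$) such that for every $2\times 2$ submatrix $\begin{pmatrix} a & b\\ c& d\end{pmatrix}$ of $(X_{ij})$ one has $ab=qba$, $ac=qca$, $bc=cb$, $bd=qdb$, $cd=qdc$, $ad-da=(q-q^{-1})bc$. For a $k$-subset $I=\{i_1<\dots<i_k\}$ of $\{1,\dots,n\}$, the quantum minor (quantum Plücker coordinate) is $\Delta_q^{I}=\sum_{\sigma\in S_k}(-q)^{l(\sigma)}X_{1 i_{\sigma(1)}}\cdots X_{k i_{\sigma(k)}}$, where $l$ is the length function on $S_k$. $\mathbb{K}_q[\mathrm{Gr}(k,n)]$ is the $\mathbb{K}$-subalgebra of $\mathbb{K}_q[\mathrm{M}(k,n)]$ generated by all the $\Delta_q^I$. It is a noetherian domain. Quantum seeds. Let $\mathcal{F}$ be a skew-field containing $\mathbb{K}$ in its centre. A quantum seed in $\mathcal{F}$ is a triple $(\underline{y},B,L)$ where: $\underline{y}=(X_1,\dots,X_r)$ is a tuple (the quantum cluster) of nonzero elements of $\mathcal{F}$ generating $\mathcal{F}$ as a skew-field, whose Laurent monomials $X_1^{a_1}\cdots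 X_r^{a_r}$ ($a\in\mathbb{Z}^r$) are linearly independent over $\mathbb{K}$; a subset of the positions $\{1,\dots,r\}$ is declared mutable and the elements in the remaining positions are called coefficients; $B=(b_{ij})$ (the exchange matrix) is an integer matrix with rows indexed by all positions and columns indexed by the mutable positions, whose square submatrix on the mutable rows (the principal part) is skew-symmetric; $L=(l_{ij})$ (the quasi-commutation matrix) is an $r\times r$ skew-symmetric integer matrix with $X_iX_j=q^{l_{ij}}X_jX_i$ for all $i,j$; and $B$ and $L$ are compatible: for each mutable $k$, $(B^TL)_{kj}=0$ for $j\neq k$ and $(B^TL)_{kk}$ is a positive integer. Mutation. For $a\in\mathbb{Z}^r$ put $M(a_1,\dots,a_r)=q^{\frac12\sum_{i<j}a_ia_jl_{ji}}X_1^{a_1}\cdots X_r^{a_r}$, and let $\boldsymbol{e}_i$ be the standard basis vectors. The mutation $\mu_k$ at a mutable position $k$ replaces $X_k$ by $X_k'=M(-\boldsymbol{e}_k+\sum_{b_{ik}>0}b_{ik}\boldsymbol{e}_i)+M(-\boldsymbol{e}_k-\sum_{b_{ik}<0}b_{ik}\boldsymbol{e}_i)$ and leaves the other cluster elements unchanged; replaces $B$ by $\mu_k(B)$ with $(\mu_k(B))_{ij}=-b_{ij}$ if $i=k$ or $j=k$, and $b_{ij}+\frac{|b_{ik}|b_{kj}+b_{ik}|b_{kj}|}{2}$ otherwise; and replaces $L$ by the skew-symmetric matrix $L'$ with $l'_{ij}=l_{ij}$ for $i,j\neq k$ and $l'_{jk}=-l_{jk}+\sum_{b_{ik}>0}b_{ik}l_{ji}$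 for $j\neq k$. The result is again a quantum seed. Quantum cluster algebra. A $\mathbb{K}$-algebra $\mathcal{A}$ that is a noetherian domain with skew-field of fractions $\mathcal{F}$ is a quantum cluster algebra if there is a quantum seed in $\mathcal{F}$ (the initial seed) such that the $\mathbb{K}$-subalgebra of $\mathcal{F}$ generated by all cluster variables (that is, all elements, mutable ones and coefficients, of all quantum clusters obtained from the initial seed by finite sequences of mutations; coefficients are not inverted) is equal to $\mathcal{A}$. It is of (finite) type $X_m$, for a Dynkin diagram $X_m$, if the quiver of the principal part of the exchange matrix (with $b_{ij}$ arrows $i\to j$ whenever $b_{ij}>0$) is mutation-equivalent to an orientation of $X_m$. *)

theory Defs
  imports
    "HOL-Library.Poly_Mapping"
    "HOL-Combinatorics.Permutations"
    "HOL-Algebra.QuotRing"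
    "HOL-Algebra.Generated_Rings"
begin

section \<open>Rings and algebras\<close>

definition type_ring :: "'a::ring_1 ring" where
  "type_ring = \<lparr>carrier = UNIV, mult = (*), one = 1, zero = 0, add = (+)\<rparr>"

text \<open>A \<open>K\<close>-algebra is given by a (not necessarily commutative) ring together with its
  structure map from the field \<open>K\<close>, whose image is central.\<close>

definition is_algebra :: "'a ring \<Rightarrow> ('k::field \<Rightarrow> 'a) \<Rightarrow> bool" where
  "is_algebra A \<eta> \<longleftrightarrow> ring A \<and> \<eta> \<in> ring_hom type_ring A \<and>
     (\<forall>c. \<forall>x\<in>carrier A. \<eta> c \<otimes>\<^bsub>A\<^esub> x = x \<otimes>\<^bsub>A\<^esub> \<eta> c)"

definition subalgebra_generated :: "'a ring \<Rightarrow> ('k::field \<Rightarrow> 'a) \<Rightarrow> 'a set \<Rightarrow> 'a set" where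
  "subalgebra_generated A \<eta> S = generate_ring A (range \<eta> \<union> S)"

text \<open>The library's \<open>domain\<close> and \<open>noetherian_ring\<close> are about commutative rings and two-sided
  ideals, respectively, hence the following versions. Noetherian means left and right noetherian.\<close>

definition left_ideal :: "'a set \<Rightarrow> 'a ring \<Rightarrow> bool" where
  "left_ideal I A \<longleftrightarrow> additive_subgroup I A \<and> (\<forall>a\<in>I. \<forall>x\<in>carrier A. x \<otimes>\<^bsub>A\<^esub> a \<in> I)"

definition right_ideal :: "'a set \<Rightarrow> 'a ring \<Rightarrow> bool" where
  "right_ideal I A \<longleftrightarrow> additive_subgroup I A \<and> (\<forall>a\<in>I. \<forall>x\<in>carrier A. a \<otimes>\<^bsub>A\<^esub> x \<in> I)"

definition left_noetherian :: "'a ring \<Rightarrow> bool" where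
  "left_noetherian A \<longleftrightarrow> (\<forall>I. left_ideal I A \<longrightarrow>
     (\<exists>S. finite S \<and> S \<subseteq> I \<and> (\<forall>J. left_ideal J A \<and> S \<subseteq> J \<longrightarrow> I \<subseteq> J)))"

definition right_noetherian :: "'a ring \<Rightarrow> bool" where
  "right_noetherian A \<longleftrightarrow> (\<forall>I. right_ideal I A \<longrightarrow>
     (\<exists>S. finite S \<and> S \<subseteq> I \<and> (\<forall>J. right_ideal J A \<and> S \<subseteq> J \<longrightarrow> I \<subseteq> J)))"

definition noncomm_domain :: "'a ring \<Rightarrow> bool" where
  "noncomm_domain A \<longleftrightarrow> ring A \<and> \<one>\<^bsub>A\<^esub> \<noteq> \<zero>\<^bsub>A\<^esub> \<and>
     (\<forall>a\<in>carrier A. \<forall>b\<in>carrier A. a \<otimes>\<^bsub>A\<^esub> b = \<zero>\<^bsub>A\<^esub> \<longrightarrow> a = \<zero>\<^bsub>A\<^esub> \<or> b = \<zero>\<^bsub>A\<^esub>)"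

text \<open>A skew field is a type of class \<open>division_ring\<close>; the skew field of fractions of \<open>A\<close> is given
  by the embedding \<open>\<iota>\<close> of \<open>A\<close> into it. For a (two-sided) noetherian domain, left and right
  fractions give the same skew field, so it suffices to speak of right fractions.\<close>

definition skew_field_of_fractions :: "'a ring \<Rightarrow> ('a \<Rightarrow> 'f::division_ring) \<Rightarrow> bool" where
  "skew_field_of_fractions A \<iota> \<longleftrightarrow> \<iota> \<in> ring_hom A type_ring \<and> inj_on \<iota> (carrier A) \<and>
     (\<forall>z. \<exists>a\<in>carrier A. \<exists>b\<in>carrier A. b \<noteq> \<zero>\<^bsub>A\<^esub> \<and> z = \<iota> a * inverse (\<iota> b))"


section \<open>Free algebras\<close>

datatype 'x word = Word (letters: "'x list")

instantiation word :: (type) monoid_add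
begin

definition zero_word :: "'x word" where
  "zero_word = Word []"

definition plus_word :: "'x word \<Rightarrow> 'x word \<Rightarrow> 'x word" where
  "plus_word u v = Word (letters u @ letters v)"

instance
  by standard (simp_all add: zero_word_def plus_word_def)

end

text \<open>Multiplication on the type below is convolution along concatenation of words, so this is the
  free algebra of noncommutative polynomials with variables in \<open>G\<close>.\<close>

definition free_algebra :: "'x set \<Rightarrow> ('x word \<Rightarrow>\<^sub>0 'k::field) ring" where
  "free_algebra G = type_ring\<lparr>carrier := {p. \<forall>w\<in>Poly_Mapping.keys p. set (letters w) \<subseteq> G}\<rparr>"

definition free_const :: "'k::field \<Rightarrow> ('x word \<Rightarrow>\<^sub>0 'k)" where
  "free_const c = Poly_Mapping.single 0 c"

definition free_var :: "'x \<Rightarrow> ('x word \<Rightarrow>\<^sub>0 'k::field)" where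
  "free_var x = Poly_Mapping.single (Word [x]) 1"


section \<open>The quantum Grassmannian\<close>

type_synonym 'k qpoly = "(nat \<times> nat) word \<Rightarrow>\<^sub>0 'k"

abbreviation qvar :: "nat \<Rightarrow> nat \<Rightarrow> 'k::field qpoly" where
  "qvar i j \<equiv> free_var (i, j)"

definition submatrix_relations :: "'k::field \<Rightarrow> 'k qpoly \<Rightarrow> 'k qpoly \<Rightarrow> 'k qpoly \<Rightarrow> 'k qpoly \<Rightarrow> 'k qpoly set"
  where
  "submatrix_relations q a b c d =
     {a * b - free_const q * b * a,
      a * c - free_const q * c * a,
      b * c - c * b,
      b * d - free_const q * d * b,
      c * d - free_const q * d * c,
      a * d - d * a - free_const (q - inverse q) * b * c}"

definition qmatrix_relations :: "'k::field \<Rightarrow> nat \<Rightarrow> nat \<Rightarrow> 'k qpoly set" where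
  "qmatrix_relations q k n =
     (\<Union>{submatrix_relations q (qvar i j) (qvar i j') (qvar i' j) (qvar i' j') | i i' j j'.
         1 \<le> i \<and> i < i' \<and> i' \<le> k \<and> 1 \<le> j \<and> j < j' \<and> j' \<le> n})"

abbreviation qmatrix_free :: "nat \<Rightarrow> nat \<Rightarrow> ('k::field qpoly) ring" where
  "qmatrix_free k n \<equiv> free_algebra ({1..k} \<times> {1..n})"

definition qmatrix_ideal :: "'k::field \<Rightarrow> nat \<Rightarrow> nat \<Rightarrow> 'k qpoly set" where
  "qmatrix_ideal q k n = Idl\<^bsub>qmatrix_free k n\<^esub> (qmatrix_relations q k n)"

definition qmatrix_algebra :: "'k::field \<Rightarrow> nat \<Rightarrow> nat \<Rightarrow> ('k qpoly set) ring" where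
  "qmatrix_algebra q k n = qmatrix_free k n Quot qmatrix_ideal q k n"

definition qmatrix_class :: "'k::field \<Rightarrow> nat \<Rightarrow> nat \<Rightarrow> 'k qpoly \<Rightarrow> 'k qpoly set" where
  "qmatrix_class q k n p = qmatrix_ideal q k n +>\<^bsub>qmatrix_free k n\<^esub> p"

definition qmatrix_scalar :: "'k::field \<Rightarrow> nat \<Rightarrow> nat \<Rightarrow> 'k \<Rightarrow> 'k qpoly set" where
  "qmatrix_scalar q k n c = qmatrix_class q k n (free_const c)"

definition perm_length :: "nat \<Rightarrow> (nat \<Rightarrow> nat) \<Rightarrow> nat" where
  "perm_length k \<sigma> = card {(a, b). 1 \<le> a \<and> a < b \<and> b \<le> k \<and> \<sigma> b < \<sigma> a}"

text \<open>With \<open>I = {i\<^sub>1 < \<dots> < i\<^sub>k}\<close>, the list element \<open>sorted_list_of_set I ! (m - 1)\<close> is \<open>i\<^sub>m\<close>.\<close>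

definition quantum_minor :: "'k::field \<Rightarrow> nat \<Rightarrow> nat \<Rightarrow> nat set \<Rightarrow> 'k qpoly set" where
  "quantum_minor q k n I = qmatrix_class q k n
     (\<Sum>\<sigma> | \<sigma> permutes {1..k}.
        free_const ((- q) ^ perm_length k \<sigma>) *
        prod_list (map (\<lambda>m. qvar m (sorted_list_of_set I ! (\<sigma> m - 1))) [1..<Suc k]))"

definition quantum_grassmannian :: "'k::field \<Rightarrow> nat \<Rightarrow> nat \<Rightarrow> ('k qpoly set) ring" where
  "quantum_grassmannian q k n = (qmatrix_algebra q k n)
     \<lparr>carrier := subalgebra_generated (qmatrix_algebra q k n) (qmatrix_scalar q k n)
        (quantum_minor q k n ` {I. I \<subseteq> {1..n} \<and> card I = k})\<rparr>"


section \<open>Quantum seeds and mutation\<close>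

text \<open>Throughout, \<open>h\<close> is the chosen square root of \<open>q\<close>, the field \<open>K\<close> sits in the centre of the skew
  field via \<open>\<kappa>\<close>, the positions are \<open>{..<r}\<close>, the mutable ones among them form \<open>N\<close>, and a seed
  is a triple (cluster, exchange matrix, quasi-commutation matrix). Matrices are functions, of which
  only the entries with legitimate indices matter (for the exchange matrix: row in \<open>{..<r}\<close> and
  column in \<open>N\<close>).\<close>

type_synonym 'f qseed = "(nat \<Rightarrow> 'f) \<times> (nat \<Rightarrow> nat \<Rightarrow> int) \<times> (nat \<Rightarrow> nat \<Rightarrow> int)"

definition laurent_monomial :: "nat \<Rightarrow> (nat \<Rightarrow> 'f::division_ring) \<Rightarrow> (nat \<Rightarrow> int) \<Rightarrow> 'f" where
  "laurent_monomial r y a = prod_list (map (\<lambda>i. y i powi a i) [0..<r])"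

definition laurent_independent ::
    "('k::field \<Rightarrow> 'f::division_ring) \<Rightarrow> nat \<Rightarrow> (nat \<Rightarrow> 'f) \<Rightarrow> bool" where
  "laurent_independent \<kappa> r y \<longleftrightarrow>
     (\<forall>S c. finite S \<and> S \<subseteq> {a. \<forall>i\<ge>r. a i = 0} \<and>
        (\<Sum>a\<in>S. \<kappa> (c a) * laurent_monomial r y a) = 0 \<longrightarrow> (\<forall>a\<in>S. c a = 0))"

definition generates_skew_field ::
    "('k::field \<Rightarrow> 'f::division_ring) \<Rightarrow> nat \<Rightarrow> (nat \<Rightarrow> 'f) \<Rightarrow> bool" where
  "generates_skew_field \<kappa> r y \<longleftrightarrow>
     (\<forall>D. subring D (type_ring :: 'f ring) \<and> (\<forall>x\<in>D. inverse x \<in> D) \<and>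
        range \<kappa> \<subseteq> D \<and> y ` {..<r} \<subseteq> D \<longrightarrow> D = UNIV)"

definition quantum_seed ::
    "('k::field \<Rightarrow> 'f::division_ring) \<Rightarrow> 'k \<Rightarrow> nat \<Rightarrow> nat set \<Rightarrow> 'f qseed \<Rightarrow> bool" where
  "quantum_seed \<kappa> h r N = (\<lambda>(y, B, L).
     is_algebra type_ring \<kappa> \<and>
     N \<subseteq> {..<r} \<and>
     (\<forall>i<r. y i \<noteq> 0) \<and>
     generates_skew_field \<kappa> r y \<and>
     laurent_independent \<kappa> r y \<and>
     (\<forall>i\<in>N. \<forall>j\<in>N. B i j = - B j i) \<and>
     (\<forall>i<r. \<forall>j<r. L i j = - L j i) \<and>
     (\<forall>i<r. \<forall>j<r. y i * y j = \<kappa> ((h ^ 2) powi L i j) * y j * y i) \<and>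
     (\<forall>k\<in>N. \<forall>j<r. j \<noteq> k \<longrightarrow> (\<Sum>i<r. B i k * L i j) = 0) \<and>
     (\<forall>k\<in>N. (\<Sum>i<r. B i k * L i k) > 0))"

text \<open>The element \<open>M(a\<^sub>1, \<dots>, a\<^sub>r)\<close>.\<close>

definition normalized_monomial ::
    "('k::field \<Rightarrow> 'f::division_ring) \<Rightarrow> 'k \<Rightarrow> nat \<Rightarrow> (nat \<Rightarrow> 'f) \<Rightarrow> (nat \<Rightarrow> nat \<Rightarrow> int) \<Rightarrow>
      (nat \<Rightarrow> int) \<Rightarrow> 'f" where
  "normalized_monomial \<kappa> h r y L a =
     \<kappa> (h powi (\<Sum>j<r. \<Sum>i<j. a i * a j * L j i)) * laurent_monomial r y a"

definition mutate_cluster ::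
    "('k::field \<Rightarrow> 'f::division_ring) \<Rightarrow> 'k \<Rightarrow> nat \<Rightarrow> nat \<Rightarrow> 'f qseed \<Rightarrow> (nat \<Rightarrow> 'f)" where
  "mutate_cluster \<kappa> h r k = (\<lambda>(y, B, L). y(k :=
     normalized_monomial \<kappa> h r y L
       (\<lambda>i. - (if i = k then 1 else 0) + (if B i k > 0 then B i k else 0)) +
     normalized_monomial \<kappa> h r y L
       (\<lambda>i. - (if i = k then 1 else 0) - (if B i k < 0 then B i k else 0))))"

text \<open>The division is exact: the numerator is \<open>0\<close> or \<open>\<plusminus>2 b\<^sub>i\<^sub>k b\<^sub>k\<^sub>j\<close>.\<close>

definition mutate_exchange :: "nat \<Rightarrow> (nat \<Rightarrow> nat \<Rightarrow> int) \<Rightarrow> (nat \<Rightarrow> nat \<Rightarrow> int)" where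
  "mutate_exchange k B = (\<lambda>i j.
     if i = k \<or> j = k then - B i j
     else B i j + (\<bar>B i k\<bar> * B k j + B i k * \<bar>B k j\<bar>) div 2)"

definition mutate_quasi_commutation ::
    "nat \<Rightarrow> nat \<Rightarrow> (nat \<Rightarrow> nat \<Rightarrow> int) \<Rightarrow> (nat \<Rightarrow> nat \<Rightarrow> int) \<Rightarrow> (nat \<Rightarrow> nat \<Rightarrow> int)" where
  "mutate_quasi_commutation r k B L =
     (let l' = (\<lambda>j. - L j k + (\<Sum>i | i < r \<and> B i k > 0. B i k * L j i))
      in (\<lambda>i j. if i = k \<and> j = k then 0 else if j = k then l' i else if i = k then - l' j else L i j))"

definition mutate_seed ::
    "('k::field \<Rightarrow> 'f::division_ring) \<Rightarrow> 'k \<Rightarrow> nat \<Rightarrow> nat \<Rightarrow> 'f qseed \<Rightarrow> 'f qseed" where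
  "mutate_seed \<kappa> h r k = (\<lambda>(y, B, L).
     (mutate_cluster \<kappa> h r k (y, B, L), mutate_exchange k B, mutate_quasi_commutation r k B L))"

definition cluster_variables ::
    "('k::field \<Rightarrow> 'f::division_ring) \<Rightarrow> 'k \<Rightarrow> nat \<Rightarrow> nat set \<Rightarrow> 'f qseed \<Rightarrow> 'f set" where
  "cluster_variables \<kappa> h r N S\<^sub>0 =
     {y i | y B L i. i < r \<and> (\<lambda>S T. \<exists>k\<in>N. T = mutate_seed \<kappa> h r k S)\<^sup>*\<^sup>* S\<^sub>0 (y, B, L)}"


section \<open>Types and quantum cluster algebras\<close>

text \<open>A quiver is given by its numbers of arrows. Mutation of the quiver of the principal part is
  mutation of the exchange matrix, restricted to mutable rows and columns.\<close>

definition quiver :: "(nat \<Rightarrow> nat \<Rightarrow> int) \<Rightarrow> (nat \<Rightarrow> nat \<Rightarrow> nat)" where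
  "quiver B i j = nat (B i j)"

text \<open>The quiver \<open>Q\<close> on the vertex set \<open>N\<close> is an orientation of the simple graph with vertices \<open>V\<close>
  and edges \<open>E\<close>.\<close>

definition is_orientation_of ::
    "nat set \<Rightarrow> (nat \<Rightarrow> nat \<Rightarrow> nat) \<Rightarrow> 'v set \<Rightarrow> 'v set set \<Rightarrow> bool" where
  "is_orientation_of N Q V E \<longleftrightarrow> (\<exists>\<phi>. bij_betw \<phi> V N \<and>
     (\<forall>u\<in>V. \<forall>v\<in>V. Q (\<phi> u) (\<phi> v) + Q (\<phi> v) (\<phi> u) = (if {u, v} \<in> E then 1 else 0)))"

definition has_mutation_type ::
    "nat set \<Rightarrow> (nat \<Rightarrow> nat \<Rightarrow> int) \<Rightarrow> 'v set \<Rightarrow> 'v set set \<Rightarrow> bool" where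
  "has_mutation_type N B V E \<longleftrightarrow>
     (\<exists>B'. (\<lambda>C C'. \<exists>k\<in>N. C' = mutate_exchange k C)\<^sup>*\<^sup>* B B' \<and> is_orientation_of N (quiver B') V E)"

text \<open>Edges of the Dynkin diagram \<open>D\<^sub>m\<close> (\<open>m \<ge> 4\<close>) on the vertices \<open>{..<m}\<close>: a path through
  \<open>0, \<dots>, m - 2\<close>, and \<open>m - 1\<close> joined to \<open>m - 3\<close>.\<close>

definition dynkin_D :: "nat \<Rightarrow> nat set set" where
  "dynkin_D m = {{i, Suc i} | i. Suc (Suc i) < m} \<union> {{m - 3, m - 1}}"

text \<open>The \<open>K\<close>-algebra \<open>A\<close> with structure map \<open>\<eta>\<close> is a noetherian domain with skew field of fractions
  given by \<open>\<iota>\<close>, and it is a quantum cluster algebra of the type of the graph \<open>(V, E)\<close>.\<close>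

definition quantum_cluster_algebra_of_type ::
    "'k::field \<Rightarrow> 'a ring \<Rightarrow> ('k \<Rightarrow> 'a) \<Rightarrow> ('a \<Rightarrow> 'f::division_ring) \<Rightarrow> 'v set \<Rightarrow> 'v set set \<Rightarrow> bool" where
  "quantum_cluster_algebra_of_type h A \<eta> \<iota> V E \<longleftrightarrow>
     is_algebra A \<eta> \<and> noncomm_domain A \<and> left_noetherian A \<and> right_noetherian A \<and>
     skew_field_of_fractions A \<iota> \<and>
     (\<exists>r N y B L. quantum_seed (\<iota> \<circ> \<eta>) h r N (y, B, L) \<and>
        subalgebra_generated type_ring (\<iota> \<circ> \<eta>) (cluster_variables (\<iota> \<circ> \<eta>) h r N (y, B, L))
          = \<iota> ` carrier A \<and>
        has_mutation_type N B V E)"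

end

(* The algebra of 3 x 6 quantum matrices is represented by operators on a space of finitely supported
   functions, in which ten quantum minors act by weighted shifts; hence these ten minors generate a
   quantum torus inside the skew field. Writing the 20 quantum minors and two quadratic expressions as
   Laurent polynomials in this torus turns all quasi-commutation, exchange and straightening relations into
   identities between finite tables. The 50 clusters form a table closed under mutation, a walk through it
   meets all 22 variables, and the straightening relations make the algebra noetherian by Dickson's lemma. *)

theory Submission imports Defs "HOL-Library.Multiset_Order"
begin

section \<open>Linear combinations as lists\<close>

text \<open>Two obstacles shape the development. \<open>q\<close> may be a root of unity and the
  characteristic is arbitrary, so no argument may rely on a generic parameter. Every computation is
  an identity over the integers with \<open>h\<close> formally invertible: powers of
  \<open>h\<close> are part of the keys of a formal sum, and only integer coefficients are
  collected. Moreover, the skew field is given abstractly and is only known to contain the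
  Grassmannian, not the quantum matrices. Relations among minors are proved for polynomials modulo
  the matrix relations and pushed into the skew field; a linear relation in the skew field is pulled
  back along the same map and refuted by operators. Reducing products of minors is costly, so it is
  confined to the 45 quasi-commutation relations of the initial minors and to ten three-term
  relations. They identify all twenty minors with Laurent polynomials in ten quasi-commuting
  elements; the rest is checked in that torus. Seeds match the table up to a relabelling of
  positions, and the noetherian argument compares leading terms of words without a basis
  theorem.\<close>

definition lincomb :: "('b \<Rightarrow> 'a::ring_1) \<Rightarrow> (int \<times> 'b) list \<Rightarrow> 'a" where
  "lincomb f ts = sum_list (map (\<lambda>(c, k). of_int c * f k) ts)"

lemma lincomb_simps [simp]:
  "lincomb f [] = 0"
  "lincomb f ((c, k) # ts) = of_int c * f k + lincomb f ts"
  "lincomb f (ts @ us) = lincomb f ts + lincomb f us"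
  by (simp_all add: lincomb_def)

lemma lincomb_concat: "lincomb f (concat tss) = sum_list (map (lincomb f) tss)"
  by (induction tss) auto

fun lex_less :: "int list \<Rightarrow> int list \<Rightarrow> bool" where
  "lex_less [] ys = (ys \<noteq> [])"
| "lex_less (x # xs) [] = False"
| "lex_less (x # xs) (y # ys) = (if x < y then True else if x = y then lex_less xs ys else False)"

text \<open>Only the value of the sum has to be preserved. Sortedness is never proved: on unsorted
  input a cancellation could be missed, which would make a check fail but cannot make it succeed
  wrongly.\<close>

fun merge :: "(int \<times> int list) list \<Rightarrow> (int \<times> int list) list \<Rightarrow> (int \<times> int list) list" where
  "merge [] us = us"
| "merge (t # ts) [] = t # ts"
| "merge ((c, x) # ts) ((d, y) # us) =
     (if x = y then (if c + d = 0 then merge ts us else (c + d, x) # merge ts us)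
      else if lex_less x y then (c, x) # merge ts ((d, y) # us)
      else (d, y) # merge ((c, x) # ts) us)"

fun merge_pairs :: "(int \<times> int list) list list \<Rightarrow> (int \<times> int list) list list" where
  "merge_pairs (x # y # zs) = merge x y # merge_pairs zs"
| "merge_pairs zs = zs"

lemma length_merge_pairs: "length (merge_pairs xs) \<le> length xs"
  by (induction xs rule: merge_pairs.induct) auto

function merge_all :: "(int \<times> int list) list list \<Rightarrow> (int \<times> int list) list" where
  "merge_all [] = []"
| "merge_all [x] = x"
| "merge_all (x # y # zs) = merge_all (merge x y # merge_pairs zs)"
  by pat_completeness auto
termination
  by (relation "measure length") (simp_all add: le_imp_less_Suc length_merge_pairs)

text \<open>A merge sort by rounds keeps normalisation fast for large sums. An empty result
  certifies that the sum vanishes under every interpretation of the keys.\<close>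

definition collect :: "(int \<times> int list) list \<Rightarrow> (int \<times> int list) list" where
  "collect ts = merge_all (map (\<lambda>t. [t]) ts)"

lemma lincomb_merge: "lincomb f (merge ts us) = lincomb f ts + lincomb f us"
proof (induction ts us rule: merge.induct)
  case (3 c x ts d y us)
  have "of_int c * f x + of_int d * f x = (0::'a)" if "c + d = 0"
    using that by (metis distrib_right mult_zero_left of_int_0 of_int_add)
  then show ?case
    using 3 by (auto simp: algebra_simps)
qed auto

lemma lincomb_merge_pairs: "sum_list (map (lincomb f) (merge_pairs tss)) = sum_list (map (lincomb f) tss)"
  by (induction tss rule: merge_pairs.induct) (auto simp: lincomb_merge)

lemma lincomb_merge_all: "lincomb f (merge_all tss) = sum_list (map (lincomb f) tss)"
  by (induction tss rule: merge_all.induct) (auto simp: lincomb_merge lincomb_merge_pairs add.assoc)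

lemma lincomb_collect: "lincomb f (collect ts) = lincomb f ts"
proof -
  have "sum_list (map (lincomb f) (map (\<lambda>t. [t]) ts)) = lincomb f ts"
    by (induction ts) auto
  then show ?thesis
    by (simp add: collect_def lincomb_merge_all)
qed

section \<open>Arithmetic of Laurent polynomials in quasi-commuting variables\<close>

section \<open>Quantum tori\<close>

text \<open>Used for three algebras: the skew field and the operators, with the root
  \<open>h\<close>, and the free algebra, with \<open>q\<close> in the role of
  \<open>h\<close>.\<close>

locale central_scalars =
  fixes \<kappa> :: "'k::field \<Rightarrow> 'a::ring_1" and h :: 'k
  assumes scalar_add: "\<kappa> (c + d) = \<kappa> c + \<kappa> d"
    and scalar_mult: "\<kappa> (c * d) = \<kappa> c * \<kappa> d"
    and scalar_one [simp]: "\<kappa> 1 = 1"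
    and scalar_central: "\<kappa> c * x = x * \<kappa> c"
    and h_nonzero [simp]: "h \<noteq> 0"
begin

definition hp :: "int \<Rightarrow> 'a" where
  "hp s = \<kappa> (h powi s)"

lemma hp_0 [simp]: "hp 0 = 1"
  by (simp add: hp_def)

lemma hp_add: "hp (s + t) = hp s * hp t"
  by (simp add: hp_def power_int_add scalar_mult)

lemma hp_central: "x * hp s = hp s * x"
  by (simp add: hp_def scalar_central)

lemma hp_left_commute: "x * (hp s * y) = hp s * (x * y)"
  by (metis hp_central mult.assoc)

lemma hp_mult: "hp s * hp t = hp (s + t)"
  by (simp add: hp_add)

lemma hp_mult_left: "hp s * (hp t * x) = hp (s + t) * x"
  by (simp add: hp_add mult.assoc)



lemma scalar_0 [simp]: "\<kappa> 0 = 0"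
  using scalar_add[of 0 0] by simp

lemma scalar_uminus: "\<kappa> (- c) = - \<kappa> c"
  using scalar_add[of c "- c"] by (simp add: eq_neg_iff_add_eq_0 add.commute)

lemma scalar_left_commute: "x * (\<kappa> c * y) = \<kappa> c * (x * y)"
  by (metis scalar_central mult.assoc)

lemma scalar_inverse: "c \<noteq> 0 \<Longrightarrow> \<kappa> (inverse c) * \<kappa> c = 1"
  by (metis left_inverse scalar_mult scalar_one)

lemma hp_nonzero: "hp s \<noteq> 0"
  by (metis hp_mult hp_0 add.left_inverse mult_zero_right zero_neq_one)

end

fun dot :: "int list \<Rightarrow> int list \<Rightarrow> int" where
  "dot (x # xs) (y # ys) = x * y + dot xs ys"
| "dot xs ys = 0"

fun vec_add :: "int list \<Rightarrow> int list \<Rightarrow> int list" where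
  "vec_add (x # xs) (y # ys) = (x + y) # vec_add xs ys"
| "vec_add xs ys = []"

lemma length_vec_add [simp]: "length (vec_add xs ys) = min (length xs) (length ys)"
  by (induction xs ys rule: vec_add.induct) auto

text \<open>The bilinear form with Gram matrix \<open>\<Omega>\<close>, evaluated at
  \<open>a\<close> and \<open>b\<close>.\<close>

definition form :: "int list list \<Rightarrow> int list \<Rightarrow> int list \<Rightarrow> int" where
  "form \<Omega> a b = dot a (map (dot b) \<Omega>)"

text \<open>A key \<open>s # a\<close> stands for \<open>h\<^sup>s M(a)\<close>. The second argument of \<open>mult_key\<close> is \<open>\<Omega> b\<close>, which is
  computed only once for all left factors.\<close>

fun mult_key :: "int list \<Rightarrow> int list \<Rightarrow> int \<times> int list \<Rightarrow> int \<times> int list \<Rightarrow> int \<times> int list" where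
  "mult_key b w (d, t) (c, s # a) = (c * d, (s + hd t + dot a w) # vec_add a b)"
| "mult_key b w (d, t) (c, []) = (c, [])"

fun mult_by :: "int list list \<Rightarrow> (int \<times> int list) list \<Rightarrow> int \<times> int list \<Rightarrow> (int \<times> int list) list" where
  "mult_by \<Omega> ts (d, t) = map (mult_key (tl t) (map (dot (tl t)) \<Omega>) (d, t)) ts"

definition torus_mult :: "int list list \<Rightarrow> (int \<times> int list) list \<Rightarrow> (int \<times> int list) list \<Rightarrow> (int \<times> int list) list" where
  "torus_mult \<Omega> ts us = concat (map (mult_by \<Omega> ts) us)"

fun torus_shift :: "int \<Rightarrow> int \<Rightarrow> (int \<times> int list) list \<Rightarrow> (int \<times> int list) list" where
  "torus_shift d t [] = []"
| "torus_shift d t ((c, k) # ts) = (c * d, (hd k + t) # tl k) # torus_shift d t ts"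

definition wf_keys :: "nat \<Rightarrow> (int \<times> int list) list \<Rightarrow> bool" where
  "wf_keys n ts \<longleftrightarrow> (\<forall>(c, k)\<in>set ts. length k = Suc n)"

lemma wf_keys_simps [simp]:
  "wf_keys n []"
  "wf_keys n ((c, k) # ts) \<longleftrightarrow> length k = Suc n \<and> wf_keys n ts"
  "wf_keys n (ts @ us) \<longleftrightarrow> wf_keys n ts \<and> wf_keys n us"
  by (auto simp: wf_keys_def)

lemma wf_keys_mult_by: "wf_keys n ts \<Longrightarrow> length t = Suc n \<Longrightarrow> wf_keys n (mult_by \<Omega> ts (d, t))"
proof (induction ts)
  case (Cons u ts)
  then show ?case
    by (cases u; cases "snd u") auto
qed auto

lemma wf_keys_torus_mult: "wf_keys n ts \<Longrightarrow> wf_keys n us \<Longrightarrow> wf_keys n (torus_mult \<Omega> ts us)"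
proof (induction us)
  case (Cons u us)
  then show ?case
    by (cases u) (use wf_keys_mult_by in \<open>auto simp: torus_mult_def\<close>)
qed (simp add: torus_mult_def)

locale quantum_torus = central_scalars \<kappa> h for \<kappa> :: "'k::field \<Rightarrow> 'a::ring_1" and h +
  fixes n :: nat and \<Omega> :: "int list list" and M :: "int list \<Rightarrow> 'a"
  assumes M_mult: "length a = n \<Longrightarrow> length b = n \<Longrightarrow> M a * M b = hp (form \<Omega> a b) * M (vec_add a b)"
begin

definition torus_key :: "int list \<Rightarrow> 'a" where
  "torus_key k = hp (hd k) * M (tl k)"

abbreviation torus_eval :: "(int \<times> int list) list \<Rightarrow> 'a" where
  "torus_eval \<equiv> lincomb torus_key"

lemma of_int_scalar_central: "of_int c * hp s = hp s * (of_int c :: 'a)"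
  by (simp add: hp_central)

lemma torus_eval_mult_by:
  assumes "wf_keys n ts" "length t = Suc n"
  shows "torus_eval (mult_by \<Omega> ts (d, t)) = torus_eval ts * (of_int d * torus_key t)"
  using assms(1)
proof (induction ts)
  case (Cons u ts)
  obtain t0 b where t: "t = t0 # b" "length b = n"
    using assms(2) by (cases t) auto
  obtain c s a where u: "u = (c, s # a)" "length a = n"
    using Cons.prems by (cases u; cases "snd u") auto
  have cd: "x * of_int d = of_int d * x" for x :: 'a
    by (rule mult_of_int_commute[symmetric])
  have "of_int c * torus_key (s # a) * (of_int d * torus_key t) =
      of_int (c * d) * (hp s * M a * (hp t0 * M b))"
    by (simp add: torus_key_def t mult.assoc) (metis cd mult.assoc)
  also have "hp s * M a * (hp t0 * M b) = hp (s + t0) * (M a * M b)"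
    by (simp add: hp_left_commute[of "M a"] hp_mult_left mult.assoc)
  also have "\<dots> = torus_key ((s + t0 + form \<Omega> a b) # vec_add a b)"
    using u t by (simp add: M_mult torus_key_def hp_mult_left)
  finally have "of_int c * torus_key (s # a) * (of_int d * torus_key t) =
    of_int (c * d) * torus_key ((s + t0 + form \<Omega> a b) # vec_add a b)" .
  then show ?case
    using Cons u by (simp add: t form_def distrib_right)
qed simp

lemma torus_eval_mult:
  assumes "wf_keys n ts" "wf_keys n us"
  shows "torus_eval (torus_mult \<Omega> ts us) = torus_eval ts * torus_eval us"
  using assms(2)
proof (induction us)
  case (Cons u us)
  obtain d t where u: "u = (d, t)" by (cases u)
  then show ?case
    using Cons torus_eval_mult_by[OF assms(1), of t d]
    by (simp add: torus_mult_def distrib_left)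
qed (simp add: torus_mult_def)

lemma torus_eval_shift:
  "wf_keys n ts \<Longrightarrow> torus_eval (torus_shift d s ts) = of_int d * hp s * torus_eval ts"
proof (induction ts)
  case (Cons u ts)
  obtain c k where u: "u = (c, k)" by (cases u)
  have "of_int (c * d) * (hp (hd k + s) * M (tl k)) = of_int d * hp s * (of_int c * (hp (hd k) * M (tl k)))"
    by (simp add: mult.commute[of c d] add.commute[of "hd k"] hp_add mult.assoc)
       (metis mult.assoc of_int_scalar_central)
  then show ?case
    using Cons u by (simp add: torus_key_def distrib_left)
qed simp

end

section \<open>Multiplication of normalised monomials\<close>

section \<open>Quasi-commuting families in a skew field\<close>

locale quasi_commuting = central_scalars \<kappa> h
  for \<kappa> :: "'k::field \<Rightarrow> 'f::division_ring" and h +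
  fixes r :: nat and y :: "nat \<Rightarrow> 'f" and L :: "nat \<Rightarrow> nat \<Rightarrow> int"
  assumes y_nonzero: "i < r \<Longrightarrow> y i \<noteq> 0"
    and L_skew: "i < r \<Longrightarrow> j < r \<Longrightarrow> L i j = - L j i"
    and y_commute: "i < r \<Longrightarrow> j < r \<Longrightarrow> y i * y j = \<kappa> ((h ^ 2) powi L i j) * y j * y i"
begin

lemma hp_double: "\<kappa> ((h ^ 2) powi l) = hp (2 * l)"
  by (simp add: hp_def power_int_mult)

lemma commute_power_nat:
  assumes "x * z = hp c * z * x"
  shows "x ^ m * z = hp (c * int m) * z * x ^ m"
proof (induction m)
  case (Suc m)
  have "x ^ Suc m * z = x * (hp (c * int m) * z * x ^ m)"
    using Suc by (simp add: mult.assoc)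
  also have "\<dots> = hp (c * int m) * (x * z) * x ^ m"
    by (simp add: hp_left_commute[of x] mult.assoc)
  also have "\<dots> = hp (c * int m) * (hp c * z * x) * x ^ m"
    by (simp only: assms)
  finally show ?case
    by (simp add: hp_mult_left mult.assoc distrib_left add.commute)
qed simp

lemma commute_power_int:
  assumes "x * z = hp c * z * x" "x \<noteq> 0"
  shows "x powi m * z = hp (c * m) * z * x powi m"
proof (cases "m \<ge> 0")
  case True
  then obtain k where "m = int k" by (metis nonneg_int_cases)
  then show ?thesis
    using commute_power_nat[OF assms(1), of k] by simp
next
  case False
  then obtain k where m: "m = - int k" by (metis linear neg_0_le_iff_le nonneg_int_cases minus_minus)
  let ?X = "x ^ k"
  \<comment> \<open>Conjugating the relation for the positive power by its inverse exchanges the two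
    sides and so inverts the scalar.\<close>
  have "inverse ?X * (hp (c * int k) * z * ?X) * inverse ?X = inverse ?X * (?X * z) * inverse ?X"
    by (simp only: commute_power_nat[OF assms(1), of k])
  then have "inverse ?X * (hp (c * int k) * z) = z * inverse ?X"
    using assms(2) by (simp add: mult.assoc) (simp add: mult.assoc[symmetric])
  then have "hp (c * int k) * (inverse ?X * z) = z * inverse ?X"
    by (simp add: hp_left_commute[of "inverse ?X"])
  then have "hp (- (c * int k)) * (hp (c * int k) * (inverse ?X * z)) = hp (- (c * int k)) * (z * inverse ?X)"
    by simp
  then show ?thesis
    by (simp add: m hp_mult_left mult.assoc power_int_minus)
qed

lemma commute_power_int2:
  assumes "x * z = hp c * z * x" "x \<noteq> 0" "z \<noteq> 0"
  shows "x powi m * z powi n = hp (c * m * n) * z powi n * x powi m"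
proof -
  have "z * x powi m = hp (- (c * m)) * x powi m * z"
    using commute_power_int[OF assms(1,2), of m] by (simp add: mult.assoc hp_mult_left)
  from commute_power_int[OF this assms(3), of n]
  show ?thesis by (simp add: mult.assoc hp_mult_left)
qed

lemma monomial_step:
  assumes "s \<le> t" "t < r"
  shows "y t powi m * laurent_monomial s y b =
    hp (2 * m * (\<Sum>i<s. b i * L t i)) * laurent_monomial s y b * y t powi m"
  using assms(1)
proof (induction s)
  case (Suc s)
  let ?P = "laurent_monomial s y b" and ?Y = "y t powi m" and ?Z = "y s powi b s"
  have q: "?Y * ?Z = hp (2 * L t s * m * b s) * ?Z * ?Y"
    using y_commute[of t s] Suc.prems assms(2) y_nonzero
    by (intro commute_power_int2) (simp_all add: hp_double)
  have "?Y * laurent_monomial (Suc s) y b = (?Y * ?P) * ?Z"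
    by (simp add: laurent_monomial_def mult.assoc)
  also have "\<dots> = hp (2 * m * (\<Sum>i<s. b i * L t i)) * ?P * (?Y * ?Z)"
    using Suc by (simp add: mult.assoc)
  also have "\<dots> = hp (2 * m * (\<Sum>i<s. b i * L t i)) * ?P * (hp (2 * L t s * m * b s) * ?Z * ?Y)"
    by (simp only: q)
  also have "\<dots> = hp (2 * m * (\<Sum>i<Suc s. b i * L t i)) * (?P * ?Z) * ?Y"
    by (simp add: hp_left_commute[of ?P] hp_mult_left mult.assoc algebra_simps)
  finally show ?case by (simp add: laurent_monomial_def)
qed (simp add: laurent_monomial_def)

text \<open>Induction on the number of factors. Moving \<open>y s powi a s\<close> past the monomial
  of \<open>b\<close> costs the exponent \<open>2 * a s * l b\<close>. Adding the normalising
  exponents \<open>a s * l a\<close> and \<open>b s * l b\<close> and subtracting the one of the sum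
  leaves \<open>a s * l b - b s * l a\<close>, which are the new terms of the form.\<close>

lemma normalized_monomial_mult_aux:
  assumes "s \<le> r"
  shows "normalized_monomial \<kappa> h s y L a * normalized_monomial \<kappa> h s y L b =
    hp (\<Sum>i<s. \<Sum>j<s. a i * b j * L i j) * normalized_monomial \<kappa> h s y L (\<lambda>i. a i + b i)"
  using assms
proof (induction s)
  case 0
  then show ?case by (simp add: normalized_monomial_def laurent_monomial_def)
next
  case (Suc s)
  define E where "E a = (\<Sum>j<s. \<Sum>i<j. a i * a j * L j i)" for a
  define l where "l a = (\<Sum>i<s. a i * L s i)" for a
  define W where "W = (\<Sum>i<s. \<Sum>j<s. a i * b j * L i j)"
  let ?P = "\<lambda>a. laurent_monomial s y a"
  let ?Y = "\<lambda>m. y s powi m"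
  let ?c = "\<lambda>i. a i + b i"
  have NM: "normalized_monomial \<kappa> h s y L a = hp (E a) * ?P a" for a
    by (simp add: normalized_monomial_def E_def hp_def)
  have E_Suc: "(\<Sum>j<Suc s. \<Sum>i<j. a i * a j * L j i) = E a + a s * l a" for a :: "nat \<Rightarrow> int"
    by (simp add: E_def l_def sum_distrib_left mult.commute mult.left_commute)
  have NM_Suc: "normalized_monomial \<kappa> h (Suc s) y L a = hp (E a + a s * l a) * (?P a * ?Y (a s))" for a
    unfolding normalized_monomial_def E_Suc by (simp add: hp_def laurent_monomial_def)
  have lc: "l ?c = l a + l b"
    by (simp add: l_def sum.distrib distrib_right)
  have W_Suc: "(\<Sum>i<Suc s. \<Sum>j<Suc s. a i * b j * L i j) = W + a s * l b - b s * l a"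
  proof -
    have skew: "L i s = - L s i" if "i \<in> {..<s}" for i
      using L_skew[of i s] Suc.prems that by simp
    have ss: "L s s = 0" using L_skew[of s s] Suc.prems by simp
    have "(\<Sum>i<s. a i * b s * L i s) = (\<Sum>i<s. - (b s * (a i * L s i)))"
      by (intro sum.cong refl) (simp add: skew mult.commute mult.left_commute)
    also have "\<dots> = - (b s * l a)"
      by (simp add: l_def sum_distrib_left sum_negf)
    finally have 1: "(\<Sum>i<s. a i * b s * L i s) = - (b s * l a)" .
    have 2: "(\<Sum>j<s. a s * b j * L s j) = a s * l b"
      by (simp add: l_def sum_distrib_left mult.assoc)
    show ?thesis
      by (simp add: sum.distrib ss 1 2 W_def)
  qed
  have IH: "hp (E a) * ?P a * (hp (E b) * ?P b) = hp W * (hp (E ?c) * ?P ?c)"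
    using Suc unfolding NM W_def by simp
  have IH': "hp (E a + E b) * (?P a * ?P b) = hp (W + E ?c) * ?P ?c"
    using IH by (simp add: hp_mult_left hp_left_commute[of "?P a"] mult.assoc)
  have step: "?Y (a s) * ?P b = hp (2 * a s * l b) * ?P b * ?Y (a s)"
    unfolding l_def using Suc.prems by (intro monomial_step) auto
  have Y: "?Y (a s) * ?Y (b s) = ?Y (?c s)"
    using y_nonzero[of s] Suc.prems by (simp add: power_int_add)
  have "normalized_monomial \<kappa> h (Suc s) y L a * normalized_monomial \<kappa> h (Suc s) y L b =
      hp (E a + a s * l a + (E b + b s * l b)) * (?P a * (?Y (a s) * ?P b) * ?Y (b s))"
    unfolding NM_Suc
    by (simp add: hp_left_commute[of "?P a"] hp_left_commute[of "?Y (a s)"] hp_mult_left mult.assoc)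
  also have "\<dots> = hp (E a + E b + (a s * l a + b s * l b + 2 * a s * l b)) * (?P a * ?P b * (?Y (a s) * ?Y (b s)))"
    unfolding step by (simp add: hp_left_commute[of "?P a"] hp_mult_left mult.assoc algebra_simps)
  also have "\<dots> = hp (a s * l a + b s * l b + 2 * a s * l b) * (hp (E a + E b) * (?P a * ?P b)) * ?Y (?c s)"
    unfolding Y by (simp add: hp_mult_left mult.assoc add.commute)
  also have "\<dots> = hp (W + a s * l b - b s * l a + (E ?c + ?c s * l ?c)) * (?P ?c * ?Y (?c s))"
    unfolding IH' lc by (simp add: hp_mult_left mult.assoc algebra_simps)
  also have "\<dots> = hp (W + a s * l b - b s * l a) * normalized_monomial \<kappa> h (Suc s) y L ?c"
    unfolding NM_Suc by (simp add: hp_mult_left)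
  finally show ?case unfolding W_Suc .
qed

definition NM :: "(nat \<Rightarrow> int) \<Rightarrow> 'f" where
  "NM a = normalized_monomial \<kappa> h r y L a"

lemma NM_mult: "NM a * NM b = hp (\<Sum>i<r. \<Sum>j<r. a i * b j * L i j) * NM (\<lambda>i. a i + b i)"
  unfolding NM_def by (rule normalized_monomial_mult_aux) simp

lemma NM_cong: "(\<And>i. i < r \<Longrightarrow> a i = b i) \<Longrightarrow> NM a = NM b"
proof -
  assume *: "\<And>i. i < r \<Longrightarrow> a i = b i"
  have "(\<Sum>j<r. \<Sum>i<j. a i * a j * L j i) = (\<Sum>j<r. \<Sum>i<j. b i * b j * L j i)"
    by (intro sum.cong refl) (use * in auto)
  moreover have "laurent_monomial r y a = laurent_monomial r y b"
    unfolding laurent_monomial_def by (intro arg_cong[where f = prod_list] map_cong) (use * in auto)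
  ultimately show ?thesis by (simp add: NM_def normalized_monomial_def)
qed

lemma NM_0: "NM (\<lambda>i. 0) = 1"
proof -
  have "laurent_monomial s y (\<lambda>i. 0) = 1" for s
    by (induction s) (auto simp: laurent_monomial_def)
  then show ?thesis by (simp add: NM_def normalized_monomial_def)
qed

lemma NM_unit:
  assumes "k < r"
  shows "NM (\<lambda>i. if i = k then 1 else 0) = y k"
proof -
  have "laurent_monomial s y (\<lambda>i. if i = k then 1 else 0) = (if k < s then y k else 1)" for s
    by (induction s) (auto simp: laurent_monomial_def less_Suc_eq)
  moreover have "(\<Sum>j<r. \<Sum>i<j. (if i = k then 1 else 0) * (if j = k then 1 else 0) * L j i) = 0"
    by (intro sum.neutral ballI) auto
  ultimately show ?thesis
    using assms by (simp add: NM_def normalized_monomial_def)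
qed

end

section \<open>Dickson's lemma\<close>

section \<open>Algebras with quasi-commuting generators are noetherian\<close>

text \<open>A monotone subsequence always exists; if it decreases, it is constant from a place where
  its minimum is attained.\<close>

lemma nat_seq_monotone_subseq:
  fixes s :: "nat \<Rightarrow> nat"
  shows "\<exists>g::nat \<Rightarrow> nat. strict_mono g \<and> mono (s \<circ> g)"
proof -
  obtain g :: "nat \<Rightarrow> nat" where g: "strict_mono g" "monoseq (\<lambda>n. s (g n))"
    using seq_monosub[of s] by auto
  show ?thesis
  proof (cases "incseq (\<lambda>n. s (g n))")
    case True
    then have "mono (s \<circ> g)" by (simp add: comp_def)
    then show ?thesis using g(1) by blast
  next
    case False
    then have dec: "decseq (\<lambda>n. s (g n))"
      using g(2) by (simp add: monoseq_iff)
    obtain N where N: "\<And>n. s (g N) \<le> s (g n)"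
      using ex_has_least_nat[of "\<lambda>_. True" 0 "\<lambda>n. s (g n)"] by auto
    have "s (g (N + n)) = s (g N)" for n
      using N[of "N + n"] decseqD[OF dec, of N "N + n"] by simp
    then have "mono (s \<circ> (\<lambda>n. g (N + n)))"
      by (simp add: mono_def)
    moreover have "strict_mono (\<lambda>n. g (N + n))"
      using g(1) by (simp add: strict_mono_def)
    ultimately show ?thesis by blast
  qed
qed

lemma nat_vec_seq_monotone_subseq:
  fixes f :: "nat \<Rightarrow> nat \<Rightarrow> nat"
  shows "\<exists>g::nat \<Rightarrow> nat. strict_mono g \<and> (\<forall>k<n. mono (\<lambda>i. f (g i) k))"
proof (induction n)
  case 0
  show ?case by (intro exI[of _ id]) (auto simp: strict_mono_def)
next
  case (Suc n)
  then obtain g :: "nat \<Rightarrow> nat" where g: "strict_mono g" "\<forall>k<n. mono (\<lambda>i. f (g i) k)" by blast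
  obtain g' :: "nat \<Rightarrow> nat" where g': "strict_mono g'" "mono ((\<lambda>i. f (g i) n) \<circ> g')"
    using nat_seq_monotone_subseq by blast
  have "strict_mono (g \<circ> g')"
    using g(1) g'(1) by (simp add: strict_mono_def)
  moreover have "mono (\<lambda>i. f ((g \<circ> g') i) k)" if "k < Suc n" for k
  proof (cases "k = n")
    case True
    then show ?thesis using g'(2) by (simp add: comp_def)
  next
    case False
    then have "mono (\<lambda>i. f (g i) k)" using g(2) that by auto
    moreover have "mono g'" using g'(1) by (rule strict_mono_mono)
    ultimately show ?thesis by (simp add: mono_def)
  qed
  ultimately show ?case by blast
qed

text \<open>Multisets over \<open>n\<close> letters are exponent vectors. If infinitely many of them
  were minimal, some sequence of distinct minimal ones would increase weakly in every coordinate,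
  which makes two of them comparable and hence equal.\<close>

lemma dickson:
  fixes E :: "nat multiset set"
  assumes "\<And>a. a \<in> E \<Longrightarrow> set_mset a \<subseteq> {..<n}"
  shows "\<exists>E0. finite E0 \<and> E0 \<subseteq> E \<and> (\<forall>a\<in>E. \<exists>b\<in>E0. b \<subseteq># a)"
proof -
  define E0 where "E0 = {a\<in>E. \<forall>b\<in>E. b \<subseteq># a \<longrightarrow> b = a}"
  have "\<exists>b\<in>E0. b \<subseteq># a" if "a \<in> E" for a
    using that
  proof (induction "size a" arbitrary: a rule: less_induct)
    case less
    show ?case
    proof (cases "a \<in> E0")
      case False
      then obtain b where b: "b \<in> E" "b \<subseteq># a" "b \<noteq> a"
        using less.prems by (auto simp: E0_def)
      then have "size b < size a"
        by (simp add: mset_subset_size subset_mset.less_le)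
      then show ?thesis
        using less.hyps b by (meson subset_mset.order_trans)
    qed auto
  qed
  moreover have "finite E0"
  proof (rule ccontr)
    assume "infinite E0"
    then obtain f :: "nat \<Rightarrow> nat multiset" where f: "inj f" "range f \<subseteq> E0"
      using infinite_countable_subset by blast
    obtain g :: "nat \<Rightarrow> nat" where g: "strict_mono g" "\<forall>k<n. mono (\<lambda>i. count (f (g i)) k)"
      using nat_vec_seq_monotone_subseq[of n "\<lambda>i. count (f i)"] by blast
    have "count (f (g 0)) k \<le> count (f (g 1)) k" for k
    proof (cases "k < n")
      case True
      then have "mono (\<lambda>i. count (f (g i)) k)" using g(2) by auto
      then show ?thesis by (rule monoD) simp
    next
      case False
      have "f (g 0) \<in> E" using f(2) by (auto simp: E0_def)
      then have "k \<notin># f (g 0)" using assms False by blast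
      then show ?thesis by (simp add: not_in_iff)
    qed
    then have "f (g 0) \<subseteq># f (g 1)"
      by (simp add: subseteq_mset_def)
    moreover have "f (g 1) \<in> E0" "f (g 0) \<in> E"
      using f(2) by (auto simp: E0_def)
    ultimately have "f (g 0) = f (g 1)"
      by (simp add: E0_def)
    then have "g 0 = g 1" using f(1) by (simp add: inj_eq)
    then show False using g(1) by (metis strict_mono_eq zero_neq_one)
  qed
  ultimately show ?thesis by (intro exI[of _ E0]) (auto simp: E0_def)
qed

section \<open>Leading terms of words in the multiset order\<close>

context central_scalars
begin

definition word :: "(nat \<Rightarrow> 'a) \<Rightarrow> nat list \<Rightarrow> 'a" where
  "word u xs = prod_list (map u xs)"

lemma word_simps [simp]:
  "word u [] = 1"
  "word u (x # xs) = u x * word u xs"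
  "word u (xs @ ys) = word u xs * word u ys"
  by (simp_all add: word_def)

text \<open>The order on contents is the total and well-founded multiset extension of the order of
  the letters. It is compatible with sums, so multiplying by a word shifts the bound; that the bound
  is strict is what later drives the induction.\<close>

inductive_set span_below :: "(nat \<Rightarrow> 'a) \<Rightarrow> nat \<Rightarrow> nat multiset \<Rightarrow> 'a set" for u n a where
  zero: "0 \<in> span_below u n a"
| add: "set xs \<subseteq> {..<n} \<Longrightarrow> mset xs < a \<Longrightarrow> x \<in> span_below u n a \<Longrightarrow>
    \<kappa> c * word u xs + x \<in> span_below u n a"

lemma span_below_word: "set xs \<subseteq> {..<n} \<Longrightarrow> mset xs < a \<Longrightarrow> \<kappa> c * word u xs \<in> span_below u n a"
  using span_below.add[OF _ _ span_below.zero, of xs n a c u] by simp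

lemma span_below_add: "x \<in> span_below u n a \<Longrightarrow> z \<in> span_below u n a \<Longrightarrow> x + z \<in> span_below u n a"
  by (induction rule: span_below.induct) (auto simp: add.assoc intro: span_below.intros)

lemma span_below_scalar: "x \<in> span_below u n a \<Longrightarrow> \<kappa> d * x \<in> span_below u n a"
proof (induction rule: span_below.induct)
  case (add xs x c)
  then have "\<kappa> (d * c) * word u xs + \<kappa> d * x \<in> span_below u n a"
    by (intro span_below.add)
  then show ?case by (simp add: distrib_left scalar_mult mult.assoc)
qed (simp add: span_below.zero)

lemma span_below_uminus: "x \<in> span_below u n a \<Longrightarrow> - x \<in> span_below u n a"
  using span_below_scalar[of x u n a "- 1"] by (simp add: scalar_uminus)

lemma span_below_diff: "x \<in> span_below u n a \<Longrightarrow> z \<in> span_below u n a \<Longrightarrow> x - z \<in> span_below u n a"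
  using span_below_add[of x u n a "- z"] span_below_uminus by simp

lemma span_below_mono: "x \<in> span_below u n a \<Longrightarrow> a \<le> b \<Longrightarrow> x \<in> span_below u n b"
  by (induction rule: span_below.induct) (auto intro: span_below.intros)

lemma span_below_mult_left:
  assumes "x \<in> span_below u n a" "set xs \<subseteq> {..<n}"
  shows "word u xs * x \<in> span_below u n (mset xs + a)"
  using assms(1)
proof (induction rule: span_below.induct)
  case (add ys x c)
  then have "\<kappa> c * word u (xs @ ys) + word u xs * x \<in> span_below u n (mset xs + a)"
    using assms(2) by (intro span_below.add) auto
  then show ?case by (simp add: distrib_left scalar_left_commute)
qed (simp add: span_below.zero)

lemma span_below_mult_right:
  assumes "x \<in> span_below u n a" "set xs \<subseteq> {..<n}"
  shows "x * word u xs \<in> span_below u n (a + mset xs)"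
  using assms(1)
proof (induction rule: span_below.induct)
  case (add ys x c)
  then have "\<kappa> c * word u (ys @ xs) + x * word u xs \<in> span_below u n (a + mset xs)"
    using assms(2) by (intro span_below.add) auto
  then show ?case by (simp add: distrib_right mult.assoc)
qed (simp add: span_below.zero)

text \<open>Reordering the letters of a word will change it by a nonzero scalar and lower terms
  only, so leading terms are compared by their content.\<close>

definition similar :: "(nat \<Rightarrow> 'a) \<Rightarrow> nat \<Rightarrow> nat list \<Rightarrow> nat list \<Rightarrow> bool" where
  "similar u n xs ys \<longleftrightarrow> mset xs = mset ys \<and>
     (\<exists>c. c \<noteq> 0 \<and> word u xs - \<kappa> c * word u ys \<in> span_below u n (mset xs))"

lemma similar_refl: "similar u n xs xs"
  unfolding similar_def by (auto intro!: exI[of _ 1] span_below.zero)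

lemma similar_trans:
  assumes "similar u n xs ys" "similar u n ys zs"
  shows "similar u n xs zs"
proof -
  obtain c d where cd: "c \<noteq> 0" "d \<noteq> 0"
    "word u xs - \<kappa> c * word u ys \<in> span_below u n (mset xs)"
    "word u ys - \<kappa> d * word u zs \<in> span_below u n (mset xs)"
    using assms by (auto simp: similar_def)
  have "word u xs - \<kappa> c * word u ys + \<kappa> c * (word u ys - \<kappa> d * word u zs) \<in> span_below u n (mset xs)"
    using cd by (intro span_below_add span_below_scalar)
  then have "word u xs - \<kappa> (c * d) * word u zs \<in> span_below u n (mset xs)"
    by (simp add: algebra_simps scalar_mult)
  then show ?thesis
    using cd assms by (auto simp: similar_def intro!: exI[of _ "c * d"])
qed

lemma similar_Cons:
  assumes "similar u n xs ys" "x < n"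
  shows "similar u n (x # xs) (x # ys)"
proof -
  obtain c where c: "c \<noteq> 0" "word u xs - \<kappa> c * word u ys \<in> span_below u n (mset xs)"
    using assms by (auto simp: similar_def)
  have "word u [x] * (word u xs - \<kappa> c * word u ys) \<in> span_below u n (mset [x] + mset xs)"
    using c assms by (intro span_below_mult_left) auto
  then have "word u (x # xs) - \<kappa> c * word u (x # ys) \<in> span_below u n (mset (x # xs))"
    by (simp add: algebra_simps scalar_left_commute)
  then show ?thesis using c assms by (auto simp: similar_def)
qed

end

text \<open>Up to lower terms the generators behave like coordinates of a quantum affine space,
  which is enough for Hilbert's basis theorem.\<close>

locale quasi_commuting_generators = central_scalars \<kappa> h
  for \<kappa> :: "'k::field \<Rightarrow> 'a::ring_1" and h +
  fixes u :: "nat \<Rightarrow> 'a" and n :: nat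
  assumes straighten: "i < n \<Longrightarrow> j < n \<Longrightarrow> i \<noteq> j \<Longrightarrow>
    \<exists>c. c \<noteq> 0 \<and> u i * u j - \<kappa> c * (u j * u i) \<in> span_below u n {#i, j#}"
begin

lemma similar_swap:
  assumes "x < n" "z < n" "set ys \<subseteq> {..<n}"
  shows "similar u n (x # z # ys) (z # x # ys)"
proof (cases "x = z")
  case False
  then obtain c where c: "c \<noteq> 0" "u x * u z - \<kappa> c * (u z * u x) \<in> span_below u n {#x, z#}"
    using straighten assms by blast
  have "(u x * u z - \<kappa> c * (u z * u x)) * word u ys \<in> span_below u n ({#x, z#} + mset ys)"
    using c assms by (intro span_below_mult_right)
  then have "word u (x # z # ys) - \<kappa> c * word u (z # x # ys) \<in> span_below u n (mset (x # z # ys))"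
    by (simp add: algebra_simps)
  then show ?thesis using c by (auto simp: similar_def)
qed (simp add: similar_refl)

lemma similar_move:
  "x < n \<Longrightarrow> set (ys @ zs) \<subseteq> {..<n} \<Longrightarrow> similar u n (x # ys @ zs) (ys @ x # zs)"
proof (induction ys)
  case (Cons y ys)
  have "similar u n (x # y # ys @ zs) (y # x # ys @ zs)"
    using Cons.prems by (intro similar_swap) auto
  moreover have "similar u n (y # x # ys @ zs) (y # ys @ x # zs)"
    using Cons by (intro similar_Cons) auto
  ultimately show ?case by (auto intro: similar_trans)
qed (simp add: similar_refl)

lemma similar_permuted:
  "mset xs = mset ys \<Longrightarrow> set xs \<subseteq> {..<n} \<Longrightarrow> similar u n xs ys"
proof (induction xs arbitrary: ys)
  case (Cons x xs)
  have "x \<in> set ys"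
    using Cons.prems by (metis list.set_intros(1) mset_eq_setD)
  then obtain y1 y2 where ys: "ys = y1 @ x # y2" by (meson split_list)
  have m: "mset xs = mset (y1 @ y2)"
    using Cons.prems(1) by (simp add: ys)
  have "similar u n (x # xs) (x # y1 @ y2)"
    using Cons m by (intro similar_Cons) auto
  moreover have "similar u n (x # y1 @ y2) ys"
    unfolding ys using Cons.prems m mset_eq_setD[OF m] by (intro similar_move) auto
  ultimately show ?case by (rule similar_trans)
qed (simp add: similar_refl)

text \<open>The leading coefficient \<open>c\<close> may vanish, because terms of equal content can
  cancel; words are not assumed to be linearly independent.\<close>

lemma span_below_leading:
  assumes "x \<in> span_below u n a"
  shows "x = 0 \<or> (\<exists>xs c. mset xs < a \<and> set xs \<subseteq> {..<n} \<and> x - \<kappa> c * word u xs \<in> span_below u n (mset xs))"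
  using assms
proof (induction rule: span_below.induct)
  case (add xs x c)
  show ?case
  proof (cases "x = 0")
    case True
    have "\<kappa> c * word u xs + x - \<kappa> c * word u xs \<in> span_below u n (mset xs)"
      using True by (simp add: span_below.zero)
    then show ?thesis using add by blast
  next
    case False
    then obtain ys d where ys: "mset ys < a" "set ys \<subseteq> {..<n}"
      "x - \<kappa> d * word u ys \<in> span_below u n (mset ys)"
      using add.IH by blast
    consider "mset xs < mset ys" | "mset xs = mset ys" | "mset ys < mset xs"
      using linorder_less_linear[of "mset xs" "mset ys"] by blast
    then show ?thesis
    proof cases
      case 1
      have "\<kappa> c * word u xs + (x - \<kappa> d * word u ys) \<in> span_below u n (mset ys)"
        using add 1 ys by (intro span_below.add)
      then have "\<kappa> c * word u xs + x - \<kappa> d * word u ys \<in> span_below u n (mset ys)"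
        by (simp add: algebra_simps)
      then show ?thesis using ys by blast
    next
      case 2
      then obtain e where e: "word u xs - \<kappa> e * word u ys \<in> span_below u n (mset ys)"
        using similar_permuted[of xs ys] add by (auto simp: similar_def)
      have "\<kappa> c * (word u xs - \<kappa> e * word u ys) + (x - \<kappa> d * word u ys) \<in> span_below u n (mset ys)"
        using e ys by (intro span_below_add span_below_scalar)
      then have "\<kappa> c * word u xs + x - \<kappa> (c * e + d) * word u ys \<in> span_below u n (mset ys)"
        by (simp add: algebra_simps scalar_mult scalar_add)
      then show ?thesis using ys by blast
    next
      case 3
      have "x - \<kappa> d * word u ys + \<kappa> d * word u ys \<in> span_below u n (mset xs)"
        by (rule span_below_add[OF span_below_mono[OF ys(3)] span_below_word]) (use ys 3 in auto)
      then have "\<kappa> c * word u xs + x - \<kappa> c * word u xs \<in> span_below u n (mset xs)"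
        by simp
      then show ?thesis using add by blast
    qed
  qed
qed simp

text \<open>The letters act by \<open>T\<close>, which is left or right multiplication, so that left and right ideals
  are treated simultaneously.\<close>

definition submodule :: "(nat \<Rightarrow> 'a \<Rightarrow> 'a) \<Rightarrow> 'a set \<Rightarrow> bool" where
  "submodule T I \<longleftrightarrow> 0 \<in> I \<and> (\<forall>x\<in>I. \<forall>y\<in>I. x + y \<in> I) \<and> (\<forall>c. \<forall>x\<in>I. \<kappa> c * x \<in> I) \<and>
     (\<forall>i<n. \<forall>x\<in>I. T i x \<in> I)"

text \<open>Recording the content instead of the word makes the notion insensitive to the side on
  which a letter is multiplied.\<close>

definition monic :: "nat multiset \<Rightarrow> 'a \<Rightarrow> bool" where
  "monic a x \<longleftrightarrow> (\<exists>xs. mset xs = a \<and> set xs \<subseteq> {..<n} \<and> x - word u xs \<in> span_below u n a)"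

text \<open>Hilbert's basis argument: one monic element is chosen for each minimal leading content.
  An element of the submodule is reduced by raising such a generator to its content and subtracting
  a multiple; the remainder has smaller content, and the multiset order is well-founded.\<close>

lemma submodule_finitely_generated:
  assumes T: "\<And>i x a. i < n \<Longrightarrow> monic a x \<Longrightarrow> monic (add_mset i a) (T i x)"
    and I: "submodule T I" "I \<subseteq> (\<Union>a. span_below u n a)"
  shows "\<exists>S. finite S \<and> S \<subseteq> I \<and> (\<forall>J. submodule T J \<and> S \<subseteq> J \<longrightarrow> I \<subseteq> J)"
proof -
  define E where "E = {a. \<exists>x\<in>I. monic a x}"
  have "set_mset a \<subseteq> {..<n}" if "a \<in> E" for a
    using that by (auto simp: E_def monic_def)
  then obtain E0 where E0: "finite E0" "E0 \<subseteq> E" "\<forall>a\<in>E. \<exists>b\<in>E0. b \<subseteq># a"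
    using dickson[of E n] by auto
  have "\<forall>a\<in>E0. \<exists>x. x \<in> I \<and> monic a x" using E0(2) by (auto simp: E_def)
  then obtain X where X: "\<And>a. a \<in> E0 \<Longrightarrow> X a \<in> I" "\<And>a. a \<in> E0 \<Longrightarrow> monic a (X a)"
    by metis
  have "I \<subseteq> J" if J: "submodule T J" "X ` E0 \<subseteq> J" for J
  proof -
    have Iadd: "x + z \<in> I" and Iscalar: "\<kappa> e * x \<in> I" if "x \<in> I" "z \<in> I" for x z e
      using I(1) that by (simp_all add: submodule_def)
    have Jadd: "x + z \<in> J" and Jscalar: "\<kappa> e * x \<in> J" if "x \<in> J" "z \<in> J" for x z e
      using J(1) that by (simp_all add: submodule_def)
    have J0: "0 \<in> J"
      using J(1) by (simp add: submodule_def)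
    have IJ: "submodule T (I \<inter> J)" using I J by (auto simp: submodule_def)
    \<comment> \<open>Applying \<open>T\<close> for the letters of \<open>b\<close> one at a time
      raises the content from \<open>a\<close> to \<open>a + b\<close> and stays in both
      submodules.\<close>
    have *: "\<exists>z \<in> I \<inter> J. monic (a + b) z" if "a \<in> E0" "set_mset b \<subseteq> {..<n}" for a b
      using that(2)
    proof (induction b)
      case empty
      then show ?case using X[OF that(1)] J(2) that(1) by auto
    next
      case (add i b)
      then obtain z where "z \<in> I \<inter> J" "monic (a + b) z" by auto
      then have "T i z \<in> I \<inter> J" "monic (add_mset i (a + b)) (T i z)"
        using T[of i "a + b" z] IJ add.prems by (auto simp: submodule_def)
      then show ?case by auto
    qed
    have "x \<in> J" if "x \<in> I" "x \<in> span_below u n a" for x a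
      using that
    proof (induction a arbitrary: x rule: less_induct)
      case (less a)
      show ?case
      proof (cases "x = 0")
        case True
        then show ?thesis using J0 by simp
      next
        case False
        then obtain xs c where xs: "mset xs < a" "set xs \<subseteq> {..<n}"
          "x - \<kappa> c * word u xs \<in> span_below u n (mset xs)"
          using span_below_leading[OF less.prems(2)] by blast
        show ?thesis
        proof (cases "c = 0")
          case True
          then show ?thesis using less xs by simp
        next
          case False
          have "\<kappa> (inverse c) * (x - \<kappa> c * word u xs) \<in> span_below u n (mset xs)"
            by (rule span_below_scalar[OF xs(3)])
          then have "\<kappa> (inverse c) * x - word u xs \<in> span_below u n (mset xs)"
            using scalar_inverse[OF False] by (simp add: right_diff_distrib mult.assoc[symmetric])
          then have "monic (mset xs) (\<kappa> (inverse c) * x)"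
            using xs by (auto simp: monic_def)
          moreover have "\<kappa> (inverse c) * x \<in> I"
            using less.prems(1) Iscalar by blast
          ultimately have "mset xs \<in> E" by (auto simp: E_def)
          then obtain b where b: "b \<in> E0" "b \<subseteq># mset xs" using E0(3) by blast
          have "set_mset (mset xs - b) \<subseteq> {..<n}"
            using xs(2) by (metis in_diffD set_mset_mset subset_iff)
          then obtain z where z: "z \<in> I \<inter> J" "monic (mset xs) z"
            using *[OF b(1), of "mset xs - b"] b(2) by auto
          then obtain ys where ys: "mset ys = mset xs" "z - word u ys \<in> span_below u n (mset xs)"
            by (auto simp: monic_def)
          obtain d where d: "word u xs - \<kappa> d * word u ys \<in> span_below u n (mset xs)"
            using similar_permuted[of xs ys] ys xs by (auto simp: similar_def)
          \<comment> \<open>\<open>z\<close> has the letters of the leading word of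
            \<open>x\<close>, possibly in another order. The scalar \<open>d\<close> is the price of
            reordering, so \<open>x\<close> and \<open>c * d\<close> times \<open>z\<close> have the
            same leading term.\<close>
          have "(x - \<kappa> c * word u xs) + \<kappa> c * (word u xs - \<kappa> d * word u ys) - \<kappa> (c * d) * (z - word u ys)
              \<in> span_below u n (mset xs)"
            by (rule span_below_diff[OF span_below_add[OF xs(3) span_below_scalar[OF d]] span_below_scalar[OF ys(2)]])
          moreover have "(x - \<kappa> c * word u xs) + \<kappa> c * (word u xs - \<kappa> d * word u ys) - \<kappa> (c * d) * (z - word u ys) =
              x + \<kappa> (- (c * d)) * z"
            by (simp add: algebra_simps scalar_mult scalar_uminus)
          ultimately have "x + \<kappa> (- (c * d)) * z \<in> span_below u n (mset xs)" by simp
          moreover have "x + \<kappa> (- (c * d)) * z \<in> I"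
            using less.prems(1) z Iadd Iscalar by blast
          ultimately have "x + \<kappa> (- (c * d)) * z \<in> J"
            using less.IH[OF xs(1)] by simp
          then have "x + \<kappa> (- (c * d)) * z + \<kappa> (c * d) * z \<in> J"
            using z Jadd Jscalar by blast
          then show ?thesis by (simp add: scalar_uminus)
        qed
      qed
    qed
    moreover have "\<exists>a. x \<in> span_below u n a" if "x \<in> I" for x
      using that I(2) by auto
    ultimately show ?thesis by blast
  qed
  moreover have "finite (X ` E0)" "X ` E0 \<subseteq> I" using E0 X by auto
  ultimately show ?thesis by (intro exI[of _ "X ` E0"]) auto
qed

lemma monic_mult_left:
  assumes "i < n" "monic a x"
  shows "monic (add_mset i a) (u i * x)"
proof -
  obtain xs where xs: "mset xs = a" "set xs \<subseteq> {..<n}" "x - word u xs \<in> span_below u n a"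
    using assms by (auto simp: monic_def)
  have "word u [i] * (x - word u xs) \<in> span_below u n (mset [i] + a)"
    using assms xs by (intro span_below_mult_left) auto
  then have "u i * x - word u (i # xs) \<in> span_below u n (add_mset i a)"
    by (simp add: right_diff_distrib)
  moreover have "mset (i # xs) = add_mset i a" "set (i # xs) \<subseteq> {..<n}"
    using xs assms by auto
  ultimately show ?thesis unfolding monic_def by blast
qed

lemma monic_mult_right:
  assumes "i < n" "monic a x"
  shows "monic (add_mset i a) (x * u i)"
proof -
  obtain xs where xs: "mset xs = a" "set xs \<subseteq> {..<n}" "x - word u xs \<in> span_below u n a"
    using assms by (auto simp: monic_def)
  have "(x - word u xs) * word u [i] \<in> span_below u n (a + mset [i])"
    using assms xs by (intro span_below_mult_right) auto
  then have "x * u i - word u (xs @ [i]) \<in> span_below u n (add_mset i a)"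
    by (simp add: left_diff_distrib)
  moreover have "mset (xs @ [i]) = add_mset i a" "set (xs @ [i]) \<subseteq> {..<n}"
    using xs assms by auto
  ultimately show ?thesis unfolding monic_def by blast
qed

end

section \<open>Free algebras and their evaluation homomorphisms\<close>

section \<open>Rings given by types and free algebras\<close>

lemma type_ring_simps [simp]:
  "carrier type_ring = UNIV" "mult type_ring = (*)" "one type_ring = 1"
  "zero type_ring = 0" "add type_ring = (+)"
  by (simp_all add: type_ring_def)

lemma ring_type_ring: "ring (type_ring :: 'a::ring_1 ring)"
proof (rule ringI)
  show "abelian_group (type_ring :: 'a ring)"
  proof (rule abelian_groupI)
    fix x :: 'a assume "x \<in> carrier type_ring"
    show "\<exists>y\<in>carrier type_ring. y \<oplus>\<^bsub>type_ring\<^esub> x = \<zero>\<^bsub>type_ring\<^esub>"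
      by (intro bexI[of _ "- x"]) auto
  qed (auto simp: algebra_simps)
  show "Group.monoid (type_ring :: 'a ring)"
    by (rule monoidI) (auto simp: algebra_simps)
qed (auto simp: algebra_simps)

lemma a_inv_type_ring [simp]: "\<ominus>\<^bsub>type_ring\<^esub> (x :: 'a::ring_1) = - x"
proof -
  interpret ring "type_ring :: 'a ring" by (rule ring_type_ring)
  show ?thesis using minus_equality[of "- x" x] by simp
qed

definition free_carrier :: "'x set \<Rightarrow> ('x word \<Rightarrow>\<^sub>0 'k::field) set" where
  "free_carrier G = {p. \<forall>w\<in>Poly_Mapping.keys p. set (letters w) \<subseteq> G}"

lemma letters_simps [simp]: "letters 0 = []" "letters (v + w) = letters v @ letters w"
  by (simp_all add: zero_word_def plus_word_def)

lemma free_carrier_closed [simp, intro]: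
  "0 \<in> free_carrier G" "1 \<in> free_carrier G" "free_const c \<in> free_carrier G"
  "x \<in> G \<Longrightarrow> free_var x \<in> free_carrier G"
  "p \<in> free_carrier G \<Longrightarrow> r \<in> free_carrier G \<Longrightarrow> p + r \<in> free_carrier G"
  "p \<in> free_carrier G \<Longrightarrow> - p \<in> free_carrier G"
  "p \<in> free_carrier G \<Longrightarrow> r \<in> free_carrier G \<Longrightarrow> p * r \<in> free_carrier G"
proof -
  show "0 \<in> free_carrier G" "1 \<in> free_carrier G"
    by (simp_all add: free_carrier_def)
  show "free_const c \<in> free_carrier G" "x \<in> G \<Longrightarrow> free_var x \<in> free_carrier G"
    by (auto simp: free_carrier_def free_const_def free_var_def split: if_splits)
  show "p \<in> free_carrier G \<Longrightarrow> r \<in> free_carrier G \<Longrightarrow> p + r \<in> free_carrier G"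
    using keys_add[of p r] by (force simp: free_carrier_def)
  show "p \<in> free_carrier G \<Longrightarrow> - p \<in> free_carrier G"
    by (auto simp: free_carrier_def in_keys_iff)
  show "p \<in> free_carrier G \<Longrightarrow> r \<in> free_carrier G \<Longrightarrow> p * r \<in> free_carrier G"
    using keys_mult[of p r] by (fastforce simp: free_carrier_def)
qed

lemma free_carrier_diff [simp, intro]:
  "p \<in> free_carrier G \<Longrightarrow> r \<in> free_carrier G \<Longrightarrow> p - r \<in> free_carrier G"
  using free_carrier_closed(5)[of p G "- r"] by simp

lemma free_carrier_prod_list [intro]:
  "(\<And>x. x \<in> set xs \<Longrightarrow> x \<in> free_carrier G) \<Longrightarrow> prod_list xs \<in> free_carrier G"
  by (induction xs) auto

lemma free_carrier_sum [intro]: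
  "(\<And>x. x \<in> S \<Longrightarrow> f x \<in> free_carrier G) \<Longrightarrow> sum f S \<in> free_carrier G"
  by (induction S rule: infinite_finite_induct) auto

lemma free_algebra_simps [simp]:
  "carrier (free_algebra G) = free_carrier G" "mult (free_algebra G) = (*)" "one (free_algebra G) = 1"
  "zero (free_algebra G) = 0" "add (free_algebra G) = (+)"
  by (simp_all add: free_algebra_def free_carrier_def)

lemma ring_free_algebra: "ring (free_algebra G :: ('x word \<Rightarrow>\<^sub>0 'k::field) ring)"
proof -
  interpret ring "type_ring :: ('x word \<Rightarrow>\<^sub>0 'k) ring" by (rule ring_type_ring)
  have "subring (free_carrier G) (type_ring :: ('x word \<Rightarrow>\<^sub>0 'k) ring)"
    by (rule subringI) auto
  then show ?thesis
    unfolding free_algebra_def free_carrier_def[symmetric] by (rule subring_is_ring)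
qed

lemma a_inv_free_algebra:
  assumes "r \<in> free_carrier G"
  shows "\<ominus>\<^bsub>free_algebra G\<^esub> r = - (r :: 'x word \<Rightarrow>\<^sub>0 'k::field)"
proof -
  interpret ring "free_algebra G :: ('x word \<Rightarrow>\<^sub>0 'k) ring" by (rule ring_free_algebra)
  show ?thesis
    using assms minus_equality[of "- r" r] by simp
qed

lemma a_minus_free_algebra:
  "r \<in> free_carrier G \<Longrightarrow> p \<ominus>\<^bsub>free_algebra G\<^esub> r = p - (r :: 'x word \<Rightarrow>\<^sub>0 'k::field)"
  by (simp add: a_minus_def a_inv_free_algebra)

lemma free_const_simps:
  "free_const (c + d) = free_const c + free_const d"
  "free_const (c * d) = free_const c * free_const d"
  "free_const 1 = 1"
  "free_const 0 = 0"
  by (simp_all add: free_const_def single_add mult_single)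

lemma poly_mapping_sum_monomials:
  "(\<Sum>w\<in>Poly_Mapping.keys p. Poly_Mapping.single w (Poly_Mapping.lookup p w)) = p"
proof (rule poly_mapping_eqI)
  fix v
  have "Poly_Mapping.lookup (\<Sum>w\<in>Poly_Mapping.keys p. Poly_Mapping.single w (Poly_Mapping.lookup p w)) v =
      (\<Sum>w\<in>Poly_Mapping.keys p. if w = v then Poly_Mapping.lookup p v else 0)"
    unfolding lookup_sum by (intro sum.cong) (auto simp: lookup_single when_def)
  also have "\<dots> = Poly_Mapping.lookup p v"
    by (simp add: in_keys_iff)
  finally show "Poly_Mapping.lookup (\<Sum>w\<in>Poly_Mapping.keys p.
      Poly_Mapping.single w (Poly_Mapping.lookup p w)) v = Poly_Mapping.lookup p v" .
qed

lemma free_const_central: "free_const c * p = p * (free_const c :: 'x word \<Rightarrow>\<^sub>0 'k::field)"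
proof -
  have 1: "free_const c * Poly_Mapping.single w d = Poly_Mapping.single w d * free_const c"
    for w :: "'x word" and d :: 'k
    by (simp add: free_const_def mult_single mult.commute)
  have "p = (\<Sum>w\<in>Poly_Mapping.keys p. Poly_Mapping.single w (Poly_Mapping.lookup p w))"
    by (rule poly_mapping_sum_monomials[symmetric])
  then show ?thesis
    by (metis (no_types, lifting) 1 sum.cong sum_distrib_left sum_distrib_right)
qed

text \<open>The homomorphism given by the universal property of the free algebra; it is
  multiplicative because the scalars are central.\<close>

definition free_eval :: "('k::field \<Rightarrow> 'a::ring_1) \<Rightarrow> ('x \<Rightarrow> 'a) \<Rightarrow> ('x word \<Rightarrow>\<^sub>0 'k) \<Rightarrow> 'a" where
  "free_eval \<kappa> X p = (\<Sum>w\<in>Poly_Mapping.keys p. \<kappa> (Poly_Mapping.lookup p w) * prod_list (map X (letters w)))"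

context central_scalars
begin

lemma free_eval_superset:
  assumes "finite S" "Poly_Mapping.keys p \<subseteq> S"
  shows "free_eval \<kappa> X p = (\<Sum>w\<in>S. \<kappa> (Poly_Mapping.lookup p w) * prod_list (map X (letters w)))"
  unfolding free_eval_def
  by (rule sum.mono_neutral_left) (use assms in \<open>auto simp: in_keys_iff\<close>)

lemma free_eval_add: "free_eval \<kappa> X (p + r) = free_eval \<kappa> X p + free_eval \<kappa> X r"
proof -
  let ?S = "Poly_Mapping.keys p \<union> Poly_Mapping.keys r"
  have "Poly_Mapping.keys (p + r) \<subseteq> ?S" by (rule keys_add)
  then show ?thesis
    using free_eval_superset[of ?S p X] free_eval_superset[of ?S r X] free_eval_superset[of ?S "p + r" X]
    by (simp add: lookup_add scalar_add distrib_right sum.distrib)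
qed

lemma free_eval_0 [simp]: "free_eval \<kappa> X 0 = 0"
  by (simp add: free_eval_def)

lemma free_eval_uminus: "free_eval \<kappa> X (- p) = - free_eval \<kappa> X p"
  using free_eval_add[of X p "- p"] by (simp add: eq_neg_iff_add_eq_0 add.commute)

lemma free_eval_diff: "free_eval \<kappa> X (p - r) = free_eval \<kappa> X p - free_eval \<kappa> X r"
  using free_eval_add[of X p "- r"] by (simp add: free_eval_uminus)

lemma free_eval_sum: "free_eval \<kappa> X (sum f S) = (\<Sum>x\<in>S. free_eval \<kappa> X (f x))"
  by (induction S rule: infinite_finite_induct) (auto simp: free_eval_add)

lemma free_eval_single: "free_eval \<kappa> X (Poly_Mapping.single w c) = \<kappa> c * prod_list (map X (letters w))"
  by (simp add: free_eval_def)

lemma free_eval_const: "free_eval \<kappa> X (free_const c) = \<kappa> c"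
  by (simp add: free_const_def free_eval_single)

lemma free_eval_1 [simp]: "free_eval \<kappa> X 1 = 1"
  using free_eval_const[of X 1] by (simp add: free_const_simps)

lemma free_eval_var: "free_eval \<kappa> X (free_var x) = X x"
  by (simp add: free_var_def free_eval_single)

lemma free_eval_mult: "free_eval \<kappa> X (p * r) = free_eval \<kappa> X p * free_eval \<kappa> X r"
proof -
  let ?s = "\<lambda>p w. Poly_Mapping.single w (Poly_Mapping.lookup p w)"
  have "p * r = (\<Sum>v\<in>Poly_Mapping.keys p. ?s p v) * (\<Sum>w\<in>Poly_Mapping.keys r. ?s r w)"
    by (simp only: poly_mapping_sum_monomials)
  also have "\<dots> = (\<Sum>v\<in>Poly_Mapping.keys p. \<Sum>w\<in>Poly_Mapping.keys r. ?s p v * ?s r w)"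
    by (rule sum_product)
  finally have "free_eval \<kappa> X (p * r) =
      (\<Sum>v\<in>Poly_Mapping.keys p. \<Sum>w\<in>Poly_Mapping.keys r. free_eval \<kappa> X (?s p v * ?s r w))"
    by (simp add: free_eval_sum)
  also have "\<dots> = (\<Sum>v\<in>Poly_Mapping.keys p. \<Sum>w\<in>Poly_Mapping.keys r.
      (\<kappa> (Poly_Mapping.lookup p v) * prod_list (map X (letters v))) *
      (\<kappa> (Poly_Mapping.lookup r w) * prod_list (map X (letters w))))"
    by (intro sum.cong refl)
       (simp add: mult_single free_eval_single scalar_mult mult.assoc
          scalar_left_commute[of "prod_list (map X (letters _))"])
  also have "\<dots> = free_eval \<kappa> X p * free_eval \<kappa> X r"
    unfolding free_eval_def by (rule sum_product[symmetric])
  finally show ?thesis .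
qed

end


section \<open>The quotient of the free algebra by the matrix relations\<close>

section \<open>Quantum matrices and the quantum Grassmannian\<close>

locale quantum_matrices =
  fixes q :: "'k::field" and k n :: nat
  assumes q_nonzero [simp]: "q \<noteq> 0"
begin

abbreviation "Fr \<equiv> (qmatrix_free k n :: 'k qpoly ring)"
abbreviation "C \<equiv> (free_carrier ({1..k} \<times> {1..n}) :: 'k qpoly set)"
abbreviation "J \<equiv> qmatrix_ideal q k n"
abbreviation "Q \<equiv> qmatrix_algebra q k n"
abbreviation "cls \<equiv> qmatrix_class q k n"

sublocale Fr: ring Fr by (rule ring_free_algebra)

lemma relations_carrier: "qmatrix_relations q k n \<subseteq> C"
proof
  fix p assume "p \<in> qmatrix_relations q k n"
  then obtain i i' j j' where "1 \<le> i" "i < i'" "i' \<le> k" "1 \<le> j" "j < j'" "j' \<le> n"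
    and p: "p \<in> submatrix_relations q (qvar i j) (qvar i j') (qvar i' j) (qvar i' j')"
    by (auto simp: qmatrix_relations_def)
  then have "qvar i j \<in> C" "qvar i j' \<in> C" "qvar i' j \<in> C" "qvar i' j' \<in> C"
    by (auto intro!: free_carrier_closed)
  then show "p \<in> C"
    using p by (auto simp: submatrix_relations_def)
qed

sublocale J: ideal J Fr
  unfolding qmatrix_ideal_def using relations_carrier by (intro Fr.genideal_ideal) simp

lemma relation_in_ideal:
  assumes "1 \<le> i" "i < i'" "i' \<le> k" "1 \<le> j" "j < j'" "j' \<le> n"
  shows "submatrix_relations q (qvar i j) (qvar i j') (qvar i' j) (qvar i' j') \<subseteq> J"
proof -
  have "qmatrix_relations q k n \<subseteq> J"
    unfolding qmatrix_ideal_def using relations_carrier by (intro Fr.genideal_self) simp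
  then show ?thesis
    using assms unfolding qmatrix_relations_def by blast
qed

lemma J_0: "0 \<in> J"
  using J.zero_closed by simp

lemma J_add: "p \<in> J \<Longrightarrow> r \<in> J \<Longrightarrow> p + r \<in> J"
  using J.a_closed[of p r] by simp

lemma J_mult_left: "p \<in> J \<Longrightarrow> r \<in> C \<Longrightarrow> r * p \<in> J"
  using J.I_l_closed[of p r] by simp

lemma J_mult_right: "p \<in> J \<Longrightarrow> r \<in> C \<Longrightarrow> p * r \<in> J"
  using J.I_r_closed[of p r] by simp

lemma J_uminus: "p \<in> J \<Longrightarrow> - p \<in> J"
  using J_mult_left[of p "- 1"] by simp

lemma Q_ring: "ring Q"
  unfolding qmatrix_algebra_def by (rule J.quotient_is_ring)

lemma cls_hom: "cls \<in> ring_hom Fr Q"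
  using J.rcos_ring_hom by (simp add: qmatrix_class_def[abs_def] qmatrix_algebra_def)

lemma cls_simps:
  "p \<in> C \<Longrightarrow> r \<in> C \<Longrightarrow> cls (p + r) = cls p \<oplus>\<^bsub>Q\<^esub> cls r"
  "p \<in> C \<Longrightarrow> r \<in> C \<Longrightarrow> cls (p * r) = cls p \<otimes>\<^bsub>Q\<^esub> cls r"
  "cls 1 = \<one>\<^bsub>Q\<^esub>"
  "p \<in> C \<Longrightarrow> cls p \<in> carrier Q"
  using cls_hom by (auto simp: ring_hom_def)

lemma cls_eq_iff: "p \<in> C \<Longrightarrow> r \<in> C \<Longrightarrow> cls p = cls r \<longleftrightarrow> p - r \<in> J"
  using Fr.quotient_eq_iff_same_a_r_cos[OF J.ideal_axioms, of p r]
  by (simp add: a_minus_free_algebra qmatrix_class_def)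

lemma cls_0: "cls 0 = \<zero>\<^bsub>Q\<^esub>"
proof -
  interpret Q: ring Q by (rule Q_ring)
  have "cls 0 \<oplus>\<^bsub>Q\<^esub> cls 0 = cls 0"
    using cls_simps(1)[of 0 0] by simp
  then show ?thesis
    using cls_simps(4)[of 0] by (metis Q.add.l_cancel_one' free_carrier_closed(1))
qed

text \<open>The universal property of the quotient, in the form in which it is needed.\<close>

lemma ideal_subset_kernel:
  assumes "central_scalars \<kappa> g"
    and rel: "\<And>i i' j j'. 1 \<le> i \<Longrightarrow> i < i' \<Longrightarrow> i' \<le> k \<Longrightarrow> 1 \<le> j \<Longrightarrow> j < j' \<Longrightarrow> j' \<le> n \<Longrightarrow>
      free_eval \<kappa> X ` submatrix_relations q (qvar i j) (qvar i j') (qvar i' j) (qvar i' j') \<subseteq> {0}"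
    and "p \<in> J"
  shows "free_eval \<kappa> X p = 0"
proof -
  interpret central_scalars \<kappa> g by fact
  let ?K = "{p \<in> C. free_eval \<kappa> X p = 0}"
  have "ideal ?K Fr"
  proof (rule idealI)
    show "ring Fr" by (rule ring_free_algebra)
    show "subgroup ?K (add_monoid Fr)"
    proof (rule group.subgroupI)
      show "group (add_monoid Fr)" by (rule Fr.add.group_axioms)
      fix p assume p: "p \<in> ?K"
      then have "\<ominus>\<^bsub>Fr\<^esub> p = - p"
        by (intro a_inv_free_algebra) simp
      then show "inv\<^bsub>add_monoid Fr\<^esub> p \<in> ?K"
        using p by (simp add: a_inv_def free_eval_uminus)
    qed (auto simp: free_eval_add intro: exI[of _ 0])
  qed (auto simp: free_eval_mult)
  moreover have "qmatrix_relations q k n \<subseteq> ?K"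
  proof
    fix p assume p: "p \<in> qmatrix_relations q k n"
    then have "free_eval \<kappa> X p = 0"
      using rel unfolding qmatrix_relations_def by blast
    then show "p \<in> ?K" using p relations_carrier by auto
  qed
  ultimately have "J \<subseteq> ?K"
    unfolding qmatrix_ideal_def by (rule Fr.genideal_minimal)
  then show ?thesis using assms(3) by auto
qed

end

section \<open>Rewriting products of minors into ordered monomials\<close>

section \<open>Products of quantum minors with three rows\<close>

text \<open>Row numbers occur as the literals 1, 2, 3, and the literal 1 has to survive
  simplification.\<close>

declare One_nat_def [simp del]

text \<open>A row of matrix entries is represented by the reversed list of its columns. The function
  \<open>pass_row j ys\<close> moves an entry in column \<open>j\<close> of a higher row leftwards through the row \<open>ys\<close>; an
  element \<open>(c, e, j', zs)\<close> of the result stands for \<open>c q\<^sup>e\<close> times the entry in column \<open>j'\<close> times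
  the row \<open>zs\<close>.\<close>

fun pass_row :: "int \<Rightarrow> int list \<Rightarrow> (int \<times> int \<times> int \<times> int list) list" where
  "pass_row j [] = [(1, 0, j, [])]"
| "pass_row j (y # ys) =
    (if y = j then map (\<lambda>(c, e, k, zs). (c, e - 1, k, y # zs)) (pass_row j ys)
     else if y < j then map (\<lambda>(c, e, k, zs). (c, e, k, y # zs)) (pass_row j ys)
     else map (\<lambda>(c, e, k, zs). (c, e, k, y # zs)) (pass_row j ys) @
       map (\<lambda>(c, e, k, zs). (- c, e + 1, k, j # zs)) (pass_row y ys) @
       map (\<lambda>(c, e, k, zs). (c, e - 1, k, j # zs)) (pass_row y ys))"

type_synonym row_term = "int \<times> int \<times> int list \<times> int list \<times> int list"

text \<open>The new entry of row one stands behind everything else. It crosses row three first, and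
  what emerges, possibly in another column, crosses row two.\<close>

fun append_row1 :: "int \<Rightarrow> row_term \<Rightarrow> row_term list" where
  "append_row1 x (c, e, l1, l2, l3) =
    concat (map (\<lambda>(c1, e1, x1, m3).
      map (\<lambda>(c2, e2, x2, m2). (c * c1 * c2, e + e1 + e2, x2 # l1, m2, m3)) (pass_row x1 l2))
        (pass_row x l3))"

fun append_row2 :: "int \<Rightarrow> row_term \<Rightarrow> row_term list" where
  "append_row2 x (c, e, l1, l2, l3) =
    map (\<lambda>(c1, e1, x1, m3). (c * c1, e + e1, l1, x1 # l2, m3)) (pass_row x l3)"

fun append_row3 :: "int \<Rightarrow> row_term \<Rightarrow> row_term" where
  "append_row3 x (c, e, l1, l2, l3) = (c, e, l1, l2, x # l3)"

fun insert_col :: "int \<Rightarrow> int list \<Rightarrow> int \<times> int list" where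
  "insert_col x [] = (0, [x])"
| "insert_col x (y # ys) =
    (if x \<le> y then (0, x # y # ys) else map_prod (\<lambda>e. e - 1) ((#) y) (insert_col x ys))"

fun insert_into :: "int \<Rightarrow> int \<times> int list \<Rightarrow> int \<times> int list" where
  "insert_into x (e, ys) = map_prod ((+) e) id (insert_col x ys)"

fun sort_cols :: "int list \<Rightarrow> int \<times> int list" where
  "sort_cols [] = (0, [])"
| "sort_cols (x # xs) = insert_into x (sort_cols xs)"

text \<open>Columns are positive, so 0 can separate the rows inside a key.\<close>

fun join_rows :: "int \<Rightarrow> int \<Rightarrow> int \<times> int list \<Rightarrow> int \<times> int list \<Rightarrow> int \<times> int list \<Rightarrow> int \<times> int list" where
  "join_rows c e (e1, r1) (e2, r2) (e3, r3) = (c, (e + e1 + e2 + e3) # r1 @ 0 # r2 @ 0 # r3)"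

fun row_key :: "row_term \<Rightarrow> int \<times> int list" where
  "row_key (c, e, l1, l2, l3) =
     join_rows c e (sort_cols (rev l1)) (sort_cols (rev l2)) (sort_cols (rev l3))"

text \<open>One entry per permutation: its sign, its length, and the columns chosen in rows one, two
  and three.\<close>

fun minor_terms :: "int \<times> int \<times> int \<Rightarrow> (int \<times> int \<times> int \<times> int \<times> int) list" where
  "minor_terms (a, b, c) =
    [(1, 0, a, b, c), (- 1, 1, a, c, b), (- 1, 1, b, a, c), (1, 2, b, c, a), (1, 2, c, a, b), (- 1, 3, c, b, a)]"

fun append_minor_term :: "row_term \<Rightarrow> int \<times> int \<times> int \<times> int \<times> int \<Rightarrow> row_term list" where
  "append_minor_term (c, e, l) (d, f, x, y, z) =
    map (append_row3 z) (concat (map (append_row2 y) (append_row1 x (c * d, e + f, l))))"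

fun start_minor :: "int \<Rightarrow> int \<Rightarrow> int \<times> int \<times> int \<times> int \<times> int \<Rightarrow> row_term" where
  "start_minor c e (d, f, x, y, z) = (c * d, e + f, [x], [y], [z])"

fun minor_product :: "int \<times> int \<times> (int \<times> int \<times> int) \<times> (int \<times> int \<times> int) \<Rightarrow> (int \<times> int list) list" where
  "minor_product (c, e, I, K) =
    map row_key (concat (map (\<lambda>t. concat (map (append_minor_term (start_minor c e t)) (minor_terms K)))
      (minor_terms I)))"

text \<open>A tuple stands for \<open>c\<close> times the \<open>e\<close>-th power of
  \<open>q\<close> times a product of two minors. Ordering the rows and sorting the columns within
  each row turns the relation into cancellation of equal keys.\<close>

definition minor_relation :: "(int \<times> int \<times> (int \<times> int \<times> int) \<times> (int \<times> int \<times> int)) list \<Rightarrow> bool" where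
  "minor_relation ts \<longleftrightarrow> collect (concat (map minor_product ts)) = []"

lemma in_set_concat_map: "u \<in> set (concat (map g ts)) \<Longrightarrow> \<exists>t\<in>set ts. u \<in> set (g t)"
  by auto

section \<open>Correctness of the rewriting modulo the matrix relations\<close>

locale quantum_matrices3 = quantum_matrices q 3 n for q :: "'k::field" and n +
  assumes n_ge_2: "2 \<le> n"
begin

text \<open>Membership in the carrier is included because the ideal absorbs multiplication only by
  elements of the carrier.\<close>

definition eqv :: "'k qpoly \<Rightarrow> 'k qpoly \<Rightarrow> bool" (infix "\<approx>" 50) where
  "p \<approx> r \<longleftrightarrow> p \<in> C \<and> r \<in> C \<and> p - r \<in> J"

lemma eqv_refl: "p \<in> C \<Longrightarrow> p \<approx> p"
  by (simp add: eqv_def J_0)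

lemma eqv_trans [trans]: "p \<approx> r \<Longrightarrow> r \<approx> s \<Longrightarrow> p \<approx> s"
  using J_add[of "p - r" "r - s"] by (simp add: eqv_def)

lemma eqv_eq_trans [trans]: "p \<approx> r \<Longrightarrow> r = s \<Longrightarrow> p \<approx> s" "p = r \<Longrightarrow> r \<approx> s \<Longrightarrow> p \<approx> s"
  by simp_all

lemma eqv_add: "p \<approx> p' \<Longrightarrow> r \<approx> r' \<Longrightarrow> p + r \<approx> p' + r'"
  using J_add[of "p - p'" "r - r'"] by (simp add: eqv_def add_diff_add)

lemma eqv_mult: "p \<approx> p' \<Longrightarrow> r \<approx> r' \<Longrightarrow> p * r \<approx> p' * r'"
proof -
  assume *: "p \<approx> p'" "r \<approx> r'"
  then have "(p - p') * r \<in> J" "p' * (r - r') \<in> J"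
    using J_mult_right J_mult_left by (simp_all add: eqv_def)
  then have "(p - p') * r + p' * (r - r') \<in> J"
    by (rule J_add)
  then have "p * r - p' * r' \<in> J"
    by (simp add: left_diff_distrib right_diff_distrib)
  then show ?thesis
    using * by (simp add: eqv_def)
qed

lemma eqv_mult_left: "p \<approx> p' \<Longrightarrow> r \<in> C \<Longrightarrow> r * p \<approx> r * p'"
  by (simp add: eqv_mult eqv_refl)

lemma eqv_mult_right: "p \<approx> p' \<Longrightarrow> r \<in> C \<Longrightarrow> p * r \<approx> p' * r"
  by (simp add: eqv_mult eqv_refl)

lemma eqv_sum_list:
  "(\<And>x. x \<in> set xs \<Longrightarrow> f x \<approx> g x) \<Longrightarrow> sum_list (map f xs) \<approx> sum_list (map g xs)"
  by (induction xs) (auto intro: eqv_add eqv_refl)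

text \<open>Here \<open>hp e\<close> is the \<open>e\<close>-th power of \<open>q\<close>, whereas
  in the skew field and among the operators it is the \<open>e\<close>-th power of \<open>h\<close>;
  exponents double on the way.\<close>

sublocale K: central_scalars "free_const :: 'k \<Rightarrow> 'k qpoly" q
  by unfold_locales (auto simp: free_const_simps intro: free_const_central)

lemma hp_carrier [simp]: "K.hp e \<in> C"
  by (simp add: K.hp_def)

lemma of_int_eq_const: "(of_int c :: 'k qpoly) = free_const (of_int c)"
proof -
  have nat: "(of_nat m :: 'k qpoly) = free_const (of_nat m)" for m
    by (induction m) (simp_all add: free_const_simps)
  show ?thesis
    by (cases c rule: int_diff_cases) (simp add: nat free_const_simps K.scalar_uminus
        diff_conv_add_uminus del: add_uminus_conv_diff)
qed

lemma of_int_carrier [simp]: "(of_int c :: 'k qpoly) \<in> C"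
  by (simp add: of_int_eq_const)

definition X :: "nat \<Rightarrow> int \<Rightarrow> 'k qpoly" where
  "X i j = qvar i (nat j)"

definition valid_cols :: "int list \<Rightarrow> bool" where
  "valid_cols ys \<longleftrightarrow> (\<forall>y\<in>set ys. 1 \<le> y \<and> y \<le> int n)"

lemma valid_cols_simps [simp]:
  "valid_cols []" "valid_cols (y # ys) \<longleftrightarrow> 1 \<le> y \<and> y \<le> int n \<and> valid_cols ys"
  "valid_cols (rev ys) = valid_cols ys"
  by (auto simp: valid_cols_def)

lemma X_carrier: "1 \<le> i \<Longrightarrow> i \<le> 3 \<Longrightarrow> 1 \<le> j \<Longrightarrow> j \<le> int n \<Longrightarrow> X i j \<in> C"
  unfolding X_def by (rule free_carrier_closed) auto

text \<open>The defining relations solved for the products in the wrong order, which is the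
  direction of rewriting.\<close>

lemma X_relations:
  assumes "1 \<le> i" "i < i'" "i' \<le> 3" "1 \<le> j" "j < j'" "j' \<le> int n"
  shows "X i j' * X i j \<approx> K.hp (- 1) * (X i j * X i j')"
    and "X i' j' * X i' j \<approx> K.hp (- 1) * (X i' j * X i' j')"
    and "X i' j * X i j \<approx> K.hp (- 1) * (X i j * X i' j)"
    and "X i' j' * X i j' \<approx> K.hp (- 1) * (X i j' * X i' j')"
    and "X i' j * X i j' \<approx> X i j' * X i' j"
    and "X i' j' * X i j \<approx> X i j * X i' j' + (- K.hp 1 + K.hp (- 1)) * (X i j' * X i' j)"
proof -
  let ?a = "X i j" and ?b = "X i j'" and ?c = "X i' j" and ?d = "X i' j'"
  have C: "?a \<in> C" "?b \<in> C" "?c \<in> C" "?d \<in> C"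
    using assms by (auto intro!: X_carrier)
  have hp1: "free_const q = K.hp 1" "free_const (q - inverse q) = K.hp 1 - K.hp (- 1)"
  proof -
    show "free_const q = K.hp 1" by (simp add: K.hp_def)
    have "free_const (q - inverse q) + free_const (inverse q) = (free_const q :: 'k qpoly)"
      by (simp flip: free_const_simps(1))
    then show "free_const (q - inverse q) = K.hp 1 - K.hp (- 1)"
      unfolding eq_diff_eq by (simp add: K.hp_def power_int_minus)
  qed
  have J: "submatrix_relations q ?a ?b ?c ?d \<subseteq> J"
    unfolding X_def using assms by (intro relation_in_ideal) auto
  have swap: "y * x \<approx> K.hp (- 1) * (x * y)" if "x \<in> C" "y \<in> C" "x * y - free_const q * y * x \<in> J" for x y
  proof -
    have "- (K.hp (- 1) * (x * y - free_const q * y * x)) \<in> J"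
      using that by (intro J_uminus J_mult_left) auto
    then have "y * x - K.hp (- 1) * (x * y) \<in> J"
      by (simp add: hp1 right_diff_distrib K.hp_mult_left mult.assoc)
    then show ?thesis using that by (simp add: eqv_def)
  qed
  show "?b * ?a \<approx> K.hp (- 1) * (?a * ?b)" "?d * ?c \<approx> K.hp (- 1) * (?c * ?d)"
    "?c * ?a \<approx> K.hp (- 1) * (?a * ?c)" "?d * ?b \<approx> K.hp (- 1) * (?b * ?d)"
    using C J by (auto intro!: swap simp: submatrix_relations_def)
  have "- (?b * ?c - ?c * ?b) \<in> J"
    using J by (intro J_uminus) (simp add: submatrix_relations_def)
  then show "?c * ?b \<approx> ?b * ?c"
    using C by (simp add: eqv_def)
  have "- (?a * ?d - ?d * ?a - free_const (q - inverse q) * ?b * ?c) \<in> J"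
    using J by (intro J_uminus) (simp add: submatrix_relations_def)
  then show "?d * ?a \<approx> ?a * ?d + (- K.hp 1 + K.hp (- 1)) * (?b * ?c)"
    using C by (auto simp: eqv_def hp1 algebra_simps)
qed

definition R :: "nat \<Rightarrow> int list \<Rightarrow> 'k qpoly" where
  "R i ys = prod_list (map (X i) (rev ys))"

lemma R_simps [simp]: "R i [] = 1" "R i (y # ys) = R i ys * X i y"
  by (simp_all add: R_def)

lemma R_carrier: "1 \<le> i \<Longrightarrow> i \<le> 3 \<Longrightarrow> valid_cols ys \<Longrightarrow> R i ys \<in> C"
  by (induction ys) (auto simp: X_carrier)

definition pass_value :: "nat \<Rightarrow> nat \<Rightarrow> int \<times> int \<times> int \<times> int list \<Rightarrow> 'k qpoly" where
  "pass_value i i' = (\<lambda>(c, e, k, zs). of_int c * (K.hp e * (X i k * R i' zs)))"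

lemma of_int_left_commute: "x * (of_int c * y) = of_int c * (x * (y :: 'k qpoly))"
  by (metis mult.assoc mult_of_int_commute)

lemma pass_row_valid:
  assumes "valid_cols (j # ys)" "(c, e, k, zs) \<in> set (pass_row j ys)"
  shows "valid_cols (k # zs)"
proof -
  define V where "V = (\<lambda>p :: int \<times> int \<times> int \<times> int list. valid_cols (fst (snd (snd p)) # snd (snd (snd p))))"
  have V_image: "\<forall>p\<in>(\<lambda>(c, e, k, zs). (f c, g e, k, y # zs)) ` S. V p"
    if "\<forall>p\<in>S. V p" "valid_cols [y]" for S y and f g :: "int \<Rightarrow> int"
    using that by (auto simp: V_def)
  have "\<forall>p\<in>set (pass_row j ys). V p"
    using assms(1)
  proof (induction ys arbitrary: j)
    case (Cons y ys)
    have "\<forall>p\<in>set (pass_row j ys). V p" "\<forall>p\<in>set (pass_row y ys). V p" "valid_cols [y]" "valid_cols [j]"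
      using Cons by auto
    note * = V_image[OF this(1,3)] V_image[OF this(2,4)]
    show ?case
      unfolding pass_row.simps set_append set_map if_distrib[of set]
      using *(1)[of "\<lambda>c. c" "\<lambda>e. e"] *(1)[of "\<lambda>c. c" "\<lambda>e. e - 1"] *(2)[of uminus "\<lambda>e. e + 1"]
        *(2)[of "\<lambda>c. c" "\<lambda>e. e - 1"]
      by (simp add: ball_Un)
  qed (simp add: V_def)
  then show ?thesis
    using assms(2) by (auto simp: V_def)
qed

lemma sum_list_pass_snoc:
  "sum_list (map (pass_value i i') ts) * (of_int d * (K.hp f * X i' y)) =
    sum_list (map (pass_value i i') (map (\<lambda>(c, e, k, zs). (c * d, e + f, k, y # zs)) ts))"
proof (induction ts)
  case (Cons t ts)
  obtain c e k zs where t: "t = (c, e, k, zs)" by (cases t)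
  have "pass_value i i' t * (of_int d * (K.hp f * X i' y)) = pass_value i i' (c * d, e + f, k, y # zs)"
    by (simp add: t pass_value_def of_int_left_commute[of _ d] K.hp_left_commute[of "R i' zs"]
        K.hp_left_commute[of "X i k"] K.hp_mult_left mult.assoc)
  then show ?case using Cons by (simp add: distrib_right t)
qed simp

text \<open>The moving entry meets the last entry of the row first. In the same column it picks up
  an inverse factor \<open>q\<close>; an entry in a smaller column commutes with it. Past a larger
  column, the relation for \<open>ad - da\<close> adds two terms in which the columns are exchanged:
  \<open>y\<close> moves on and \<open>j\<close> stays in the row.\<close>

lemma pass_row:
  assumes "1 \<le> i" "i < i'" "i' \<le> 3" "valid_cols (j # ys)"
  shows "R i' ys * X i j \<approx> sum_list (map (pass_value i i') (pass_row j ys))"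
  using assms(4)
proof (induction ys arbitrary: j)
  case Nil
  then show ?case
    using assms X_carrier[of i j] by (simp add: pass_value_def eqv_refl)
next
  case (Cons y ys)
  note IH = Cons.IH
  have v: "valid_cols (j # ys)" "valid_cols (y # ys)" and yj: "1 \<le> y" "y \<le> int n" "1 \<le> j" "j \<le> int n"
    using Cons.prems by auto
  have C: "R i' ys \<in> C" "X i j \<in> C" "X i y \<in> C" "X i' y \<in> C" "X i' j \<in> C"
    using assms v by (auto intro!: X_carrier R_carrier)
  let ?S = "\<lambda>ts. sum_list (map (pass_value i i') ts)"
  have main: "R i' ys * (X i j' * (of_int d * (K.hp f * X i' y'))) \<approx>
      ?S (map (\<lambda>(c, e, k, zs). (c * d, e + f, k, y' # zs)) (pass_row j' ys))"
    if "valid_cols (j' # ys)" "1 \<le> y'" "y' \<le> int n" for j' y' d f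
  proof -
    have "R i' ys * X i j' * (of_int d * (K.hp f * X i' y')) \<approx>
        ?S (pass_row j' ys) * (of_int d * (K.hp f * X i' y'))"
      using that assms by (intro eqv_mult_right IH) (auto intro!: free_carrier_closed X_carrier)
    then show ?thesis by (simp only: sum_list_pass_snoc mult.assoc)
  qed
  have start: "R i' (y # ys) * X i j = R i' ys * (X i' y * X i j)"
    by (simp add: mult.assoc)
  consider "y = j" | "y < j" | "y > j" by linarith
  then show ?case
  proof cases
    case 1
    \<comment> \<open>The relation within one column comes from a 2 x 2 submatrix, so a second
      column is needed: the last one, or the first one if \<open>j\<close> itself is last.\<close>
    have "X i' y * X i j \<approx> K.hp (- 1) * (X i j * X i' y)"
      unfolding 1
    proof (cases "j < int n")
      case True
      then show "X i' j * X i j \<approx> K.hp (- 1) * (X i j * X i' j)"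
        using X_relations(3)[of i i' j "int n"] assms yj by simp
    next
      case False
      then show "X i' j * X i j \<approx> K.hp (- 1) * (X i j * X i' j)"
        using X_relations(4)[of i i' 1 j] assms yj n_ge_2 by simp
    qed
    then have "R i' ys * (X i' y * X i j) \<approx> R i' ys * (K.hp (- 1) * (X i j * X i' y))"
      using C by (intro eqv_mult_left)
    also have "\<dots> = R i' ys * (X i j * (of_int 1 * (K.hp (- 1) * X i' y)))"
      by (simp add: K.hp_left_commute[of "X i j"])
    also have "\<dots> \<approx> ?S (map (\<lambda>(c, e, k, zs). (c * 1, e + - 1, k, y # zs)) (pass_row j ys))"
      by (rule main) (use v yj in auto)
    also have "\<dots> = ?S (pass_row j (y # ys))"
      using 1 by (simp add: case_prod_beta')
    finally show ?thesis unfolding start .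
  next
    case 2
    have "X i' y * X i j \<approx> X i j * X i' y"
      using X_relations(5)[of i i' y j] assms yj 2 by simp
    then have "R i' ys * (X i' y * X i j) \<approx> R i' ys * (X i j * X i' y)"
      using C by (intro eqv_mult_left)
    also have "\<dots> = R i' ys * (X i j * (of_int 1 * (K.hp 0 * X i' y)))"
      by simp
    also have "\<dots> \<approx> ?S (map (\<lambda>(c, e, k, zs). (c * 1, e + 0, k, y # zs)) (pass_row j ys))"
      by (rule main) (use v yj in auto)
    also have "\<dots> = ?S (pass_row j (y # ys))"
      using 2 by (simp add: case_prod_beta')
    finally show ?thesis unfolding start .
  next
    case 3
    have "X i' y * X i j \<approx> X i j * X i' y + (- K.hp 1 + K.hp (- 1)) * (X i y * X i' j)"
      using X_relations(6)[of i i' j y] assms yj 3 by simp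
    then have "R i' ys * (X i' y * X i j) \<approx>
        R i' ys * (X i j * X i' y + (- K.hp 1 + K.hp (- 1)) * (X i y * X i' j))"
      using C by (intro eqv_mult_left)
    also have "\<dots> = R i' ys * (X i j * (of_int 1 * (K.hp 0 * X i' y))) +
        (R i' ys * (X i y * (of_int (- 1) * (K.hp 1 * X i' j))) +
         R i' ys * (X i y * (of_int 1 * (K.hp (- 1) * X i' j))))"
      by (simp add: K.hp_left_commute[of "X i y"] distrib_left left_diff_distrib right_diff_distrib)
    also have "\<dots> \<approx> ?S (map (\<lambda>(c, e, k, zs). (c * 1, e + 0, k, y # zs)) (pass_row j ys)) +
        (?S (map (\<lambda>(c, e, k, zs). (c * - 1, e + 1, k, j # zs)) (pass_row y ys)) +
         ?S (map (\<lambda>(c, e, k, zs). (c * 1, e + - 1, k, j # zs)) (pass_row y ys)))"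
      by (intro eqv_add main) (use v yj in auto)
    also have "\<dots> = ?S (pass_row j (y # ys))"
      using 3 by (simp add: case_prod_beta')
    finally show ?thesis unfolding start .
  qed
qed

definition term_value :: "row_term \<Rightarrow> 'k qpoly" where
  "term_value = (\<lambda>(c, e, l1, l2, l3). of_int c * (K.hp e * (R 1 l1 * (R 2 l2 * R 3 l3))))"

definition valid_term :: "row_term \<Rightarrow> bool" where
  "valid_term = (\<lambda>(c, e, l1, l2, l3). valid_cols l1 \<and> valid_cols l2 \<and> valid_cols l3)"

abbreviation terms_value :: "row_term list \<Rightarrow> 'k qpoly" where
  "terms_value ts \<equiv> sum_list (map term_value ts)"

lemma terms_value_concat: "terms_value (concat tss) = sum_list (map terms_value tss)"
  by (induction tss) auto

lemma terms_value_mult: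
  assumes "\<And>t. t \<in> set ts \<Longrightarrow> term_value t * a \<approx> terms_value (g t)"
  shows "terms_value ts * a \<approx> terms_value (concat (map g ts))"
  using assms
proof (induction ts)
  case (Cons t ts)
  then have "term_value t * a + terms_value ts * a \<approx> terms_value (g t) + terms_value (concat (map g ts))"
    by (intro eqv_add) auto
  then show ?case by (simp add: distrib_right)
qed (simp add: eqv_refl)

lemma append_row3_valid: "valid_term t \<Longrightarrow> valid_cols [x] \<Longrightarrow> valid_term (append_row3 x t)"
  by (cases t) (auto simp: valid_term_def)

lemma append_row2_valid:
  assumes "valid_term t" "valid_cols [x]" "u \<in> set (append_row2 x t)"
  shows "valid_term u"
proof (cases t)
  case (fields c e l1 l2 l3)
  obtain p where p: "p \<in> set (pass_row x l3)" "u = (\<lambda>(c1, e1, x1, m3). (c * c1, e + e1, l1, x1 # l2, m3)) p"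
    using assms(3) unfolding fields append_row2.simps set_map by blast
  obtain c1 e1 x1 m3 where p': "p = (c1, e1, x1, m3)" by (cases p)
  have v: "valid_cols l1" "valid_cols l2" "valid_cols (x # l3)"
    using assms fields by (auto simp: valid_term_def)
  have "valid_cols (x1 # m3)"
    using pass_row_valid[OF v(3)] p(1) unfolding p' .
  then show ?thesis
    using v by (simp add: p(2) p' valid_term_def)
qed

lemma append_row1_valid:
  assumes "valid_term t" "valid_cols [x]" "u \<in> set (append_row1 x t)"
  shows "valid_term u"
proof (cases t)
  case (fields c e l1 l2 l3)
  let ?F = "\<lambda>c1 e1 m3 (c2, e2, x2, m2). (c * c1 * c2, e + e1 + e2, x2 # l1, m2, m3)"
  obtain p where p: "p \<in> set (pass_row x l3)"
      "u \<in> set ((\<lambda>(c1, e1, x1, m3). map (?F c1 e1 m3) (pass_row x1 l2)) p)"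
    using assms(3) unfolding fields append_row1.simps set_concat set_map by blast
  obtain c1 e1 x1 m3 where p': "p = (c1, e1, x1, m3)" by (cases p)
  obtain s where s: "s \<in> set (pass_row x1 l2)" "u = ?F c1 e1 m3 s"
    using p(2) unfolding p' prod.case set_map by blast
  obtain c2 e2 x2 m2 where s': "s = (c2, e2, x2, m2)" by (cases s)
  have v: "valid_cols l1" "valid_cols l2" "valid_cols (x # l3)"
    using assms fields by (auto simp: valid_term_def)
  have 1: "valid_cols (x1 # m3)"
    using pass_row_valid[OF v(3)] p(1) unfolding p' .
  have "valid_cols (x1 # l2)"
    using 1 v(2) by simp
  then have "valid_cols (x2 # m2)"
    using pass_row_valid s(1) unfolding s' by blast
  then show ?thesis
    using 1 v(1) by (simp add: s(2) s' valid_term_def)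
qed

lemma append_row3_value: "term_value (append_row3 x t) = term_value t * X 3 x"
  by (cases t) (simp add: term_value_def mult.assoc)

lemma append_row2_value:
  assumes "valid_term t" "valid_cols [x]"
  shows "term_value t * X 2 x \<approx> terms_value (append_row2 x t)"
proof (cases t)
  case (fields c e l1 l2 l3)
  let ?A = "of_int c * (K.hp e * (R 1 l1 * R 2 l2))"
  have A: "?A \<in> C"
    using assms fields by (auto simp: valid_term_def intro!: free_carrier_closed R_carrier)
  have "term_value t * X 2 x = ?A * (R 3 l3 * X 2 x)"
    by (simp add: fields term_value_def mult.assoc)
  also have "\<dots> \<approx> ?A * sum_list (map (pass_value 2 3) (pass_row x l3))"
    using assms fields by (intro eqv_mult_left[OF pass_row A]) (auto simp: valid_term_def)
  also have "\<dots> = terms_value (append_row2 x t)"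
  proof -
    have *: "?A * pass_value 2 3 (c1, e1, x1, m3) = term_value (c * c1, e + e1, l1, x1 # l2, m3)" for c1 e1 x1 m3
      by (simp add: pass_value_def term_value_def of_int_left_commute[of "K.hp e" c for e c] of_int_left_commute[of "R i l" c for i l c]
        K.hp_left_commute[of "R i l" for i l] K.hp_mult_left mult.assoc)
    show ?thesis
      unfolding sum_list_const_mult[symmetric] fields append_row2.simps map_map comp_def
      by (intro arg_cong[where f = sum_list] map_cong refl) (auto simp: *)
  qed
  finally show ?thesis .
qed

lemma append_row1_value:
  assumes "valid_term t" "valid_cols [x]"
  shows "term_value t * X 1 x \<approx> terms_value (append_row1 x t)"
proof (cases t)
  case (fields c e l1 l2 l3)
  let ?A = "of_int c * (K.hp e * (R 1 l1 * R 2 l2))"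
  have v: "valid_cols l1" "valid_cols l2" "valid_cols l3" "valid_cols (x # l3)"
    using assms fields by (auto simp: valid_term_def)
  then have A: "?A \<in> C"
    by (auto intro!: free_carrier_closed R_carrier)
  define g :: "int \<times> int \<times> int \<times> int list \<Rightarrow> row_term list"
    where "g = (\<lambda>(c1, e1, x1, m3). map (\<lambda>(c2, e2, x2, m2). (c * c1 * c2, e + e1 + e2, x2 # l1, m2, m3)) (pass_row x1 l2))"
  have step: "?A * pass_value 1 3 s \<approx> terms_value (g s)" if "s \<in> set (pass_row x l3)" for s
  proof (cases s)
    case s: (fields c1 e1 x1 m3)
    have v1: "valid_cols (x1 # m3)"
      using pass_row_valid v(4) that s by blast
    let ?L = "of_int (c * c1) * (K.hp (e + e1) * R 1 l1)"
    have L: "?L \<in> C" and m: "R 3 m3 \<in> C"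
      using v v1 by (auto intro!: free_carrier_closed R_carrier simp del: of_int_mult)
    have "?A * pass_value 1 3 s = ?L * (R 2 l2 * X 1 x1) * R 3 m3"
      by (simp add: s pass_value_def of_int_left_commute[of "K.hp e" c for e c] of_int_left_commute[of "R i l" c for i l c]
        K.hp_left_commute[of "R i l" for i l] K.hp_mult_left mult.assoc)
    also have "\<dots> \<approx> ?L * sum_list (map (pass_value 1 2) (pass_row x1 l2)) * R 3 m3"
      using v v1 by (intro eqv_mult_right[OF eqv_mult_left[OF pass_row L] m]) auto
    also have "\<dots> = terms_value (g s)"
    proof -
      have *: "?L * pass_value 1 2 (c2, e2, x2, m2) * R 3 m3 =
          term_value (c * c1 * c2, e + e1 + e2, x2 # l1, m2, m3)" for c2 e2 x2 m2
        by (simp add: pass_value_def term_value_def of_int_left_commute[of "K.hp e" c for e c] of_int_left_commute[of "R i l" c for i l c]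
        K.hp_left_commute[of "R i l" for i l] K.hp_mult_left mult.assoc)
      show ?thesis
        unfolding sum_list_const_mult[symmetric] sum_list_mult_const[symmetric] s g_def prod.case map_map comp_def
        by (intro arg_cong[where f = sum_list] map_cong refl) (auto simp: * simp del: of_int_mult)
    qed
    finally show ?thesis .
  qed
  have "term_value t * X 1 x = ?A * (R 3 l3 * X 1 x)"
    by (simp add: fields term_value_def mult.assoc)
  also have "\<dots> \<approx> ?A * sum_list (map (pass_value 1 3) (pass_row x l3))"
    using v by (intro eqv_mult_left[OF pass_row A]) auto
  also have "\<dots> = sum_list (map (\<lambda>s. ?A * pass_value 1 3 s) (pass_row x l3))"
    by (simp only: sum_list_const_mult)
  also have "\<dots> \<approx> sum_list (map (\<lambda>s. terms_value (g s)) (pass_row x l3))"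
    using step by (rule eqv_sum_list)
  also have "\<dots> = terms_value (append_row1 x t)"
    unfolding fields append_row1.simps terms_value_concat by (simp add: g_def comp_def)
  finally show ?thesis .
qed

lemma append_minor_term:
  assumes "valid_term t" "valid_cols [x, y, z]"
  shows "term_value t * (of_int d * (K.hp f * (X 1 x * (X 2 y * X 3 z)))) \<approx>
      terms_value (append_minor_term t (d, f, x, y, z))"
    and "u \<in> set (append_minor_term t (d, f, x, y, z)) \<Longrightarrow> valid_term u"
proof -
  obtain c e l1 l2 l3 where t: "t = (c, e, l1, l2, l3)" by (cases t)
  let ?t = "(c * d, e + f, l1, l2, l3)"
  have v: "valid_term ?t" using assms t by (simp add: valid_term_def)
  have v1: "valid_term s" if "s \<in> set (append_row1 x ?t)" for s
    using append_row1_valid[OF v _ that] assms by simp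
  have v2: "valid_term s" if s: "s \<in> set (concat (map (append_row2 y) (append_row1 x ?t)))" for s
  proof -
    obtain s0 where s0: "s0 \<in> set (append_row1 x ?t)" "s \<in> set (append_row2 y s0)"
      using in_set_concat_map[OF s] by blast
    show ?thesis
      by (rule append_row2_valid[OF v1[OF s0(1)] _ s0(2)]) (use assms in simp)
  qed
  have yz: "X 2 y \<in> C" "X 3 z \<in> C" using assms by (auto intro!: X_carrier)
  have "term_value t * (of_int d * (K.hp f * (X 1 x * (X 2 y * X 3 z)))) =
      term_value ?t * X 1 x * X 2 y * X 3 z"
    by (simp add: t term_value_def of_int_left_commute[of "K.hp e" c for e c] of_int_left_commute[of "R i l" c for i l c]
        K.hp_left_commute[of "R i l" for i l] K.hp_mult_left mult.assoc)
  also have "\<dots> \<approx> terms_value (append_row1 x ?t) * X 2 y * X 3 z"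
    using v assms yz by (intro eqv_mult_right append_row1_value) auto
  also have "\<dots> \<approx> terms_value (concat (map (append_row2 y) (append_row1 x ?t))) * X 3 z"
    using v1 assms yz by (intro eqv_mult_right terms_value_mult append_row2_value) auto
  also have "\<dots> = terms_value (append_minor_term t (d, f, x, y, z))"
    by (simp add: t append_row3_value sum_list_mult_const[symmetric] comp_def)
  finally show "term_value t * (of_int d * (K.hp f * (X 1 x * (X 2 y * X 3 z)))) \<approx>
      terms_value (append_minor_term t (d, f, x, y, z))" .
  show "valid_term u" if u: "u \<in> set (append_minor_term t (d, f, x, y, z))"
  proof -
    obtain s where "s \<in> set (concat (map (append_row2 y) (append_row1 x ?t)))" "u = append_row3 z s"
      using u unfolding t append_minor_term.simps set_map by blast
    then show ?thesis using v2 append_row3_valid assms by simp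
  qed
qed

definition P :: "nat \<Rightarrow> int list \<Rightarrow> 'k qpoly" where
  "P i ys = prod_list (map (X i) ys)"

lemma P_simps [simp]: "P i [] = 1" "P i (y # ys) = X i y * P i ys"
  by (simp_all add: P_def)

lemma P_carrier: "1 \<le> i \<Longrightarrow> i \<le> 3 \<Longrightarrow> valid_cols ys \<Longrightarrow> P i ys \<in> C"
  by (induction ys) (auto simp: X_carrier)

lemma X_same_row:
  assumes "1 \<le> i" "i \<le> 3" "1 \<le> j" "j < j'" "j' \<le> int n"
  shows "X i j' * X i j \<approx> K.hp (- 1) * (X i j * X i j')"
proof (cases "i < 3")
  case True
  then show ?thesis using X_relations(1)[of i 3 j j'] assms by simp
next
  case False
  then show ?thesis using X_relations(2)[of 1 i j j'] assms by simp
qed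

lemma insert_col:
  assumes "1 \<le> i" "i \<le> 3" "valid_cols (x # ys)" "insert_col x ys = (e, zs)"
  shows "X i x * P i ys \<approx> K.hp e * P i zs \<and> valid_cols zs"
  using assms(3,4)
proof (induction ys arbitrary: e zs)
  case Nil
  then show ?case using X_carrier[of i x] assms by (auto intro: eqv_refl)
next
  case (Cons y ys)
  have C: "X i x \<in> C" "X i y \<in> C" "P i ys \<in> C"
    using Cons.prems assms by (auto intro!: X_carrier P_carrier)
  show ?case
  proof (cases "x \<le> y")
    case True
    then show ?thesis using Cons.prems C by (auto intro!: eqv_refl free_carrier_closed)
  next
    case False
    obtain f ws where f: "insert_col x ys = (f, ws)" by (cases "insert_col x ys")
    then have ez: "e = f - 1" "zs = y # ws" using Cons.prems False by auto
    have IH: "X i x * P i ys \<approx> K.hp f * P i ws" "valid_cols ws"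
      using Cons.IH[OF _ f] Cons.prems by auto
    have "X i x * P i (y # ys) = (X i x * X i y) * P i ys"
      by (simp add: mult.assoc)
    also have "\<dots> \<approx> (K.hp (- 1) * (X i y * X i x)) * P i ys"
      using C Cons.prems False assms by (intro eqv_mult_right X_same_row) auto
    also have "\<dots> = (K.hp (- 1) * X i y) * (X i x * P i ys)"
      by (simp add: mult.assoc)
    also have "\<dots> \<approx> (K.hp (- 1) * X i y) * (K.hp f * P i ws)"
      using C IH by (intro eqv_mult_left) auto
    also have "\<dots> = K.hp e * P i zs"
      by (simp add: ez K.hp_left_commute[of "X i y"] K.hp_mult_left mult.assoc)
    finally show ?thesis using IH ez Cons.prems by simp
  qed
qed

lemma sort_cols:
  assumes "1 \<le> i" "i \<le> 3" "valid_cols ys" "sort_cols ys = (e, zs)"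
  shows "P i ys \<approx> K.hp e * P i zs \<and> valid_cols zs"
  using assms(3,4)
proof (induction ys arbitrary: e zs)
  case (Cons y ys)
  obtain f ws where f: "sort_cols ys = (f, ws)" by (cases "sort_cols ys")
  obtain g us where g: "insert_col y ws = (g, us)" by (cases "insert_col y ws")
  have e: "e = f + g" "zs = us" using Cons.prems f g by auto
  have IH: "P i ys \<approx> K.hp f * P i ws" "valid_cols ws"
    using Cons.IH[OF _ f] Cons.prems by auto
  have ins: "X i y * P i ws \<approx> K.hp g * P i us" "valid_cols us"
    using insert_col[OF assms(1,2) _ g] IH Cons.prems by auto
  have "X i y * P i ys \<approx> X i y * (K.hp f * P i ws)"
    using IH Cons.prems assms by (intro eqv_mult_left X_carrier) auto
  also have "\<dots> = K.hp f * (X i y * P i ws)"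
    by (rule K.hp_left_commute)
  also have "\<dots> \<approx> K.hp f * (K.hp g * P i us)"
    using ins by (intro eqv_mult_left) auto
  finally show ?case using ins e by (simp add: K.hp_mult_left)
qed (simp add: eqv_refl)

fun key_rows :: "nat \<Rightarrow> int list \<Rightarrow> 'k qpoly" where
  "key_rows i [] = 1"
| "key_rows i (x # xs) = (if x = 0 then key_rows (i + 1) xs else X i x * key_rows i xs)"

definition key_value :: "int list \<Rightarrow> 'k qpoly" where
  "key_value k = K.hp (hd k) * key_rows 1 (tl k)"

lemma key_rows_append: "valid_cols r \<Longrightarrow> key_rows i (r @ s) = P i r * key_rows i s"
  by (induction r) (auto simp: mult.assoc)

lemma row_key_value:
  assumes "valid_term t"
  shows "term_value t \<approx> (case row_key t of (c, k) \<Rightarrow> of_int c * key_value k)"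
proof -
  obtain c e l1 l2 l3 where t: "t = (c, e, l1, l2, l3)" by (cases t)
  obtain e1 r1 where 1: "sort_cols (rev l1) = (e1, r1)" by (cases "sort_cols (rev l1)")
  obtain e2 r2 where 2: "sort_cols (rev l2) = (e2, r2)" by (cases "sort_cols (rev l2)")
  obtain e3 r3 where 3: "sort_cols (rev l3) = (e3, r3)" by (cases "sort_cols (rev l3)")
  have s: "R 1 l1 \<approx> K.hp e1 * P 1 r1" "R 2 l2 \<approx> K.hp e2 * P 2 r2" "R 3 l3 \<approx> K.hp e3 * P 3 r3"
      "valid_cols r1" "valid_cols r2" "valid_cols r3"
    using sort_cols[OF _ _ _ 1, of 1] sort_cols[OF _ _ _ 2, of 2] sort_cols[OF _ _ _ 3, of 3] assms
    by (auto simp: t valid_term_def R_def P_def)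
  have "term_value t \<approx> of_int c * (K.hp e * ((K.hp e1 * P 1 r1) * ((K.hp e2 * P 2 r2) * (K.hp e3 * P 3 r3))))"
    unfolding t term_value_def prod.case using s by (intro eqv_mult eqv_refl) auto
  also have "\<dots> = of_int c * key_value ((e + e1 + e2 + e3) # r1 @ 0 # r2 @ 0 # r3)"
    using s key_rows_append[of r3 3 "[]"]
    by (simp add: key_value_def key_rows_append K.hp_left_commute[of "P 1 r1"] K.hp_left_commute[of "P 2 r2"]
      K.hp_mult_left mult.assoc add.assoc)
  finally show ?thesis by (simp add: t 1 2 3)
qed

definition minor_poly :: "int \<times> int \<times> int \<Rightarrow> 'k qpoly" where
  "minor_poly I = sum_list (map (\<lambda>(d, f, x, y, z). of_int d * (K.hp f * (X 1 x * (X 2 y * X 3 z)))) (minor_terms I))"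

definition valid_index :: "int \<times> int \<times> int \<Rightarrow> bool" where
  "valid_index = (\<lambda>(a, b, c). valid_cols [a, b, c])"

lemma minor_terms_valid:
  "valid_index I \<Longrightarrow> (d, f, x, y, z) \<in> set (minor_terms I) \<Longrightarrow> valid_cols [x, y, z]"
  by (cases I) (auto simp: valid_index_def)

lemma minor_poly_carrier: "valid_index I \<Longrightarrow> minor_poly I \<in> C"
  by (cases I) (auto simp: minor_poly_def valid_index_def intro!: free_carrier_closed free_carrier_diff X_carrier)

lemma minor_product_value:
  assumes "valid_index I" "valid_index K"
  shows "of_int c * (K.hp e * (minor_poly I * minor_poly K)) \<approx> lincomb key_value (minor_product (c, e, I, K))"
proof -
  let ?ts = "map (start_minor c e) (minor_terms I)"
  let ?w = "\<lambda>(d, f, x, y, z). of_int d * (K.hp f * (X 1 x * (X 2 y * X 3 z)))"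
  let ?g = "\<lambda>t. concat (map (append_minor_term t) (minor_terms K))"
  have vts: "valid_term t" if t: "t \<in> set ?ts" for t
  proof -
    obtain s where s: "s \<in> set (minor_terms I)" "t = start_minor c e s"
      using t unfolding set_map by blast
    obtain d f x y z where s': "s = (d, f, x, y, z)" by (cases s)
    show ?thesis
      using minor_terms_valid[OF assms(1)] s(1) unfolding s(2) s' by (simp add: valid_term_def)
  qed
  have scale: "of_int c * (K.hp e * ?w s) = term_value (start_minor c e s)" for s
    by (cases s) (simp add: term_value_def of_int_left_commute[of "K.hp e"] K.hp_mult_left mult.assoc)
  have "of_int c * (K.hp e * minor_poly I) = sum_list (map (\<lambda>s. of_int c * (K.hp e * ?w s)) (minor_terms I))"
    by (simp only: minor_poly_def sum_list_const_mult)
  also have "\<dots> = terms_value ?ts"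
    unfolding scale by (simp only: map_map comp_def)
  finally have start: "of_int c * (K.hp e * minor_poly I) = terms_value ?ts" .
  have "of_int c * (K.hp e * (minor_poly I * minor_poly K)) = (of_int c * (K.hp e * minor_poly I)) * minor_poly K"
    by (simp only: mult.assoc)
  also have "\<dots> = terms_value ?ts * minor_poly K"
    by (simp only: start)
  also have "\<dots> \<approx> terms_value (concat (map ?g ?ts))"
  proof (rule terms_value_mult)
    fix t assume t: "t \<in> set ?ts"
    have "term_value t * minor_poly K = sum_list (map (\<lambda>s. term_value t * ?w s) (minor_terms K))"
      by (simp only: minor_poly_def sum_list_const_mult)
    also have "\<dots> \<approx> sum_list (map (\<lambda>s. terms_value (append_minor_term t s)) (minor_terms K))"
    proof (rule eqv_sum_list)
      fix s assume s: "s \<in> set (minor_terms K)"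
      obtain d f x y z where s': "s = (d, f, x, y, z)" by (cases s)
      show "term_value t * ?w s \<approx> terms_value (append_minor_term t s)"
        using append_minor_term(1)[OF vts[OF t] minor_terms_valid[OF assms(2) s[unfolded s']], of d f]
        unfolding s' prod.case .
    qed
    also have "\<dots> = terms_value (?g t)"
      by (simp only: terms_value_concat map_map comp_def)
    finally show "term_value t * minor_poly K \<approx> terms_value (?g t)" .
  qed
  also have "\<dots> \<approx> sum_list (map (\<lambda>t. case row_key t of (c, k) \<Rightarrow> of_int c * key_value k) (concat (map ?g ?ts)))"
  proof (intro eqv_sum_list row_key_value)
    fix u assume u: "u \<in> set (concat (map ?g ?ts))"
    obtain t where t: "t \<in> set ?ts" "u \<in> set (?g t)"
      using in_set_concat_map[OF u] by (elim bexE)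
    obtain s where s: "s \<in> set (minor_terms K)" "u \<in> set (append_minor_term t s)"
      using in_set_concat_map[OF t(2)] by (elim bexE)
    obtain d f x y z where s': "s = (d, f, x, y, z)" by (cases s)
    show "valid_term u"
      by (rule append_minor_term(2)[OF vts[OF t(1)] minor_terms_valid[OF assms(2) s(1)[unfolded s']] s(2)[unfolded s']])
  qed
  also have "\<dots> = lincomb key_value (minor_product (c, e, I, K))"
    by (simp only: lincomb_def minor_product.simps map_map comp_def)
  finally show ?thesis .
qed

lemma minor_relation:
  assumes "minor_relation ts" "\<And>c e I K. (c, e, I, K) \<in> set ts \<Longrightarrow> valid_index I \<and> valid_index K"
  shows "sum_list (map (\<lambda>(c, e, I, K). of_int c * (K.hp e * (minor_poly I * minor_poly K))) ts) \<in> J"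
proof -
  have "sum_list (map (\<lambda>(c, e, I, K). of_int c * (K.hp e * (minor_poly I * minor_poly K))) ts) \<approx>
      sum_list (map (\<lambda>t. lincomb key_value (minor_product t)) ts)"
  proof (rule eqv_sum_list)
    fix t assume t: "t \<in> set ts"
    obtain c e I K where t': "t = (c, e, I, K)" by (cases t)
    have "valid_index I" "valid_index K"
      using assms(2)[of c e I K] t unfolding t' by auto
    then show "(\<lambda>(c, e, I, K). of_int c * (K.hp e * (minor_poly I * minor_poly K))) t \<approx>
        lincomb key_value (minor_product t)"
      using minor_product_value[of I K c e] unfolding t' by (simp only: prod.case)
  qed
  also have "\<dots> = lincomb key_value (concat (map minor_product ts))"
    by (simp add: lincomb_concat comp_def)
  also have "\<dots> = 0"
    using assms(1) lincomb_collect[of key_value "concat (map minor_product ts)"] by (simp add: minor_relation_def)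
  finally show ?thesis by (simp add: eqv_def)
qed

end

section \<open>Passage between polynomials, the Grassmannian and the skew field\<close>

section \<open>The quantum Grassmannian inside its skew field of fractions\<close>

lemma perm_length_3:
  "perm_length 3 \<sigma> = (if \<sigma> 2 < \<sigma> 1 then 1 else 0) + (if \<sigma> 3 < \<sigma> 1 then 1 else 0) + (if \<sigma> 3 < \<sigma> 2 then 1 else 0)"
proof -
  have "{(a, b). 1 \<le> a \<and> a < b \<and> b \<le> 3 \<and> \<sigma> b < \<sigma> a} =
      {p \<in> {(1, 2), (1, 3), (2, 3)}. \<sigma> (snd p) < \<sigma> (fst p)}"
  proof (intro equalityI subsetI)
    fix p assume "p \<in> {(a, b). 1 \<le> a \<and> a < b \<and> b \<le> 3 \<and> \<sigma> b < \<sigma> a}"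
    then obtain a b where p: "p = (a, b)" "1 \<le> a" "a < b" "b \<le> 3" "\<sigma> b < \<sigma> a" by blast
    then have "a = 1 \<and> b = 2 \<or> a = 1 \<and> b = 3 \<or> a = 2 \<and> b = 3" by linarith
    then show "p \<in> {p \<in> {(1, 2), (1, 3), (2, 3)}. \<sigma> (snd p) < \<sigma> (fst p)}"
      using p by auto
  qed auto
  then have "perm_length 3 \<sigma> = card {p \<in> {(1, 2), (1, 3), (2, 3)}. \<sigma> (snd p) < \<sigma> (fst p)}"
    by (simp only: perm_length_def)
  also have "\<dots> = (\<Sum>p\<in>{(1, 2), (1, 3), (2, 3)}. if \<sigma> (snd p) < \<sigma> (fst p) then 1 else 0)"
    by (simp only: card_eq_sum sum.inter_filter[symmetric] finite.intros)
  finally show ?thesis by simp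
qed

text \<open>Each permutation of three letters is uniquely
  \<open>transpose 1 a \<circ> transpose 2 b\<close> with \<open>b\<close> equal to 2 or 3.\<close>

lemma sum_permutations_3:
  fixes f :: "(nat \<Rightarrow> nat) \<Rightarrow> 'a::comm_monoid_add"
  shows "(\<Sum>\<sigma> | \<sigma> permutes {1..3}. f \<sigma>) =
    (\<Sum>a\<in>{1, 2, 3}. \<Sum>b\<in>{2, 3}. f (transpose 1 a \<circ> (transpose 2 b \<circ> id)))"
proof -
  have "{1..3::nat} = insert 1 (insert 2 (insert 3 {}))" by auto
  moreover have "{p. p permutes {3::nat}} = {id}"
    by (auto simp: permutes_sing)
  ultimately show ?thesis
    by (simp add: sum_over_permutations_insert)
qed

context quantum_matrices3
begin

lemma quantum_minor_eq:
  assumes "1 \<le> a" "a < b" "b < c" "c \<le> n"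
  shows "quantum_minor q 3 n {a, b, c} = cls (minor_poly (int a, int b, int c))"
proof -
  have sorted: "sorted_list_of_set {a, b, c} = [a, b, c]"
    using sorted_list_of_set.idem_if_sorted_distinct[of "[a, b, c]"] assms by simp
  have upt: "[1..<Suc 3] = [1, 2, 3]" by (simp add: upt_rec)
  have const: "free_const ((- q) ^ m) = of_int ((- 1) ^ m) * K.hp (int m)" for m
    by (cases "even m") (simp_all add: K.hp_def K.scalar_uminus)
  have rearrange: "x1 - x2 + (x3 - x4 + (x5 - x6)) = x1 + (x3 + (x5 - x6) - x4 - x2)"
    for x1 x2 x3 x4 x5 x6 :: "'k qpoly"
    by (simp add: algebra_simps)
  show ?thesis
    unfolding quantum_minor_def sorted upt const sum_permutations_3
    by (simp add: perm_length_3 minor_poly_def X_def transpose_def mult.assoc)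
       (rule arg_cong[where f = cls], rule rearrange)
qed

end

lemma card_three: "x < y \<Longrightarrow> y < z \<Longrightarrow> card {x, y, z :: nat} = 3"
  by auto

lemma three_subsets:
  assumes "I \<subseteq> {1..n::nat}" "card I = 3"
  obtains a b c where "I = {a, b, c}" "1 \<le> a" "a < b" "b < c" "c \<le> n"
proof -
  have fin: "finite I" using assms(1) finite_subset by blast
  define xs where "xs = sorted_list_of_set I"
  have xs: "set xs = I" "sorted xs" "distinct xs" "length xs = 3"
    using fin assms(2) by (simp_all add: xs_def)
  then obtain a b c where abc: "xs = [a, b, c]"
    by (auto simp: numeral_3_eq_3 length_Suc_conv)
  then have "I = {a, b, c}" "a < b" "b < c"
    using xs by auto
  moreover have "1 \<le> a" "c \<le> n"
    using assms(1) calculation by auto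
  ultimately show ?thesis using that by blast
qed

locale grassmannian_fractions =
  fixes q h :: "'k::field" and \<iota> :: "'k qpoly set \<Rightarrow> 'f::division_ring"
  assumes q_nonzero': "q \<noteq> 0" and h_square: "h ^ 2 = q"
    and fractions: "skew_field_of_fractions (quantum_grassmannian q 3 6) \<iota>"
begin

sublocale quantum_matrices3 q 6
  by unfold_locales (simp_all add: q_nonzero')

abbreviation "A \<equiv> quantum_grassmannian q 3 6"
abbreviation "\<eta> \<equiv> qmatrix_scalar q 3 6"

definition \<kappa> :: "'k \<Rightarrow> 'f" where
  "\<kappa> = \<iota> \<circ> \<eta>"

lemma \<eta>_eq: "\<eta> c = cls (free_const c)"
  by (simp add: qmatrix_scalar_def)

lemma A_simps [simp]:
  "mult A = mult Q" "add A = add Q" "one A = one Q" "zero A = zero Q"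
  by (simp_all add: quantum_grassmannian_def)

definition minors :: "'k qpoly set set" where
  "minors = quantum_minor q 3 6 ` {I. I \<subseteq> {1..6} \<and> card I = 3}"

lemma carrier_A: "carrier A = generate_ring Q (range \<eta> \<union> minors)"
  by (simp add: quantum_grassmannian_def subalgebra_generated_def minors_def)

lemma minorsE:
  assumes "x \<in> minors"
  obtains a b c where "1 \<le> a" "a < b" "b < c" "c \<le> 6" "x = cls (minor_poly (a, b, c))"
proof -
  obtain I where I: "x = quantum_minor q 3 6 I" "I \<subseteq> {1..6}" "card I = 3"
    using assms unfolding minors_def by blast
  obtain a b c where abc: "I = {a, b, c}" "1 \<le> a" "a < b" "b < c" "c \<le> 6"
    using I(2,3) by (rule three_subsets)
  have "x = cls (minor_poly (int a, int b, int c))"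
    unfolding I(1) abc(1) using abc(2-) by (rule quantum_minor_eq)
  then show ?thesis using that[of "int a" "int b" "int c"] abc by simp
qed

lemma minors_memI:
  assumes "1 \<le> a" "a < b" "b < c" "c \<le> 6"
  shows "cls (minor_poly (a, b, c)) \<in> minors"
proof -
  have "quantum_minor q 3 6 {nat a, nat b, nat c} = cls (minor_poly (int (nat a), int (nat b), int (nat c)))"
    using assms by (intro quantum_minor_eq) auto
  moreover have "card {nat a, nat b, nat c} = 3"
    using assms by (intro card_three) auto
  moreover have "{nat a, nat b, nat c} \<subseteq> {1..6}"
    using assms by auto
  ultimately show ?thesis
    unfolding minors_def using assms by (intro image_eqI[of _ _ "{nat a, nat b, nat c}"]) auto
qed

lemma generators_in_Q: "range \<eta> \<union> minors \<subseteq> carrier Q"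
proof -
  have "x \<in> carrier Q" if "x \<in> minors" for x
    using that by (elim minorsE) (auto intro!: cls_simps minor_poly_carrier simp: valid_index_def)
  then show ?thesis
    by (auto simp: \<eta>_eq intro!: cls_simps)
qed

lemma A_subring: "subring (carrier A) Q"
  unfolding carrier_A by (rule ring.generate_ring_is_subring[OF Q_ring generators_in_Q])

lemma A_ring: "ring A"
proof -
  have "A = Q\<lparr>carrier := carrier A\<rparr>"
    by (simp add: quantum_grassmannian_def)
  then show ?thesis
    using ring.subring_is_ring[OF Q_ring A_subring] by metis
qed

lemma \<iota>_hom:
  "x \<in> carrier A \<Longrightarrow> y \<in> carrier A \<Longrightarrow> \<iota> (x \<oplus>\<^bsub>Q\<^esub> y) = \<iota> x + \<iota> y"
  "x \<in> carrier A \<Longrightarrow> y \<in> carrier A \<Longrightarrow> \<iota> (x \<otimes>\<^bsub>Q\<^esub> y) = \<iota> x * \<iota> y"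
  "\<iota> \<one>\<^bsub>Q\<^esub> = 1"
  using fractions by (auto simp: skew_field_of_fractions_def ring_hom_def)

lemma \<iota>_inj: "x \<in> carrier A \<Longrightarrow> y \<in> carrier A \<Longrightarrow> \<iota> x = \<iota> y \<longleftrightarrow> x = y"
  using fractions by (auto simp: skew_field_of_fractions_def inj_on_def)

text \<open>\<open>\<iota>\<close> is a homomorphism on the Grassmannian only. The polynomials that
  represent its elements are the common ground for relations among minors, elements of the skew
  field and operators.\<close>

definition lifts :: "'k qpoly set" where
  "lifts = {p \<in> C. cls p \<in> carrier A}"

definition \<theta> :: "'k qpoly \<Rightarrow> 'f" where
  "\<theta> p = \<iota> (cls p)"

lemma lifts_closed [intro]:
  "free_const c \<in> lifts" "1 \<in> lifts" "0 \<in> lifts"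
  "p \<in> lifts \<Longrightarrow> r \<in> lifts \<Longrightarrow> p + r \<in> lifts"
  "p \<in> lifts \<Longrightarrow> r \<in> lifts \<Longrightarrow> p * r \<in> lifts"
proof -
  show const: "free_const c \<in> lifts" for c
    by (auto simp: lifts_def carrier_A \<eta>_eq[symmetric] intro: generate_ring.incl)
  show "1 \<in> lifts" "0 \<in> lifts"
    using const[of 1] const[of 0] by (simp_all add: free_const_simps)
  show "p \<in> lifts \<Longrightarrow> r \<in> lifts \<Longrightarrow> p + r \<in> lifts" "p \<in> lifts \<Longrightarrow> r \<in> lifts \<Longrightarrow> p * r \<in> lifts"
    using subringE(6,7)[OF A_subring] by (auto simp: lifts_def cls_simps)
qed

lemma minor_poly_lifts:
  assumes "1 \<le> a" "a < b" "b < c" "c \<le> 6"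
  shows "minor_poly (a, b, c) \<in> lifts"
  using minors_memI[OF assms] assms
  by (auto simp: lifts_def carrier_A valid_index_def intro!: generate_ring.incl minor_poly_carrier)

lemma \<theta>_simps:
  "p \<in> lifts \<Longrightarrow> r \<in> lifts \<Longrightarrow> \<theta> (p + r) = \<theta> p + \<theta> r"
  "p \<in> lifts \<Longrightarrow> r \<in> lifts \<Longrightarrow> \<theta> (p * r) = \<theta> p * \<theta> r"
  "\<theta> 1 = 1"
  "\<theta> (free_const c) = \<kappa> c"
  by (simp_all add: lifts_def \<theta>_def cls_simps \<iota>_hom \<kappa>_def \<eta>_eq)

lemma \<theta>_0: "\<theta> 0 = 0"
  using \<theta>_simps(1)[of 0 0] lifts_closed(3) by simp

text \<open>Injectivity of \<open>\<iota>\<close> gives both directions: relations modulo the ideal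
  hold in the skew field, and a relation in the skew field comes from the ideal, where operators can
  refute it.\<close>

lemma \<theta>_eq_0_iff:
  assumes "p \<in> lifts"
  shows "\<theta> p = 0 \<longleftrightarrow> p \<in> J"
proof -
  have "\<theta> p = 0 \<longleftrightarrow> \<iota> (cls p) = \<iota> (cls 0)"
    using \<theta>_0 by (simp add: \<theta>_def)
  also have "\<dots> \<longleftrightarrow> cls p = cls 0"
    using assms lifts_closed(3) by (intro \<iota>_inj) (auto simp: lifts_def)
  also have "\<dots> \<longleftrightarrow> p \<in> J"
    using assms by (simp add: cls_eq_iff lifts_def)
  finally show ?thesis .
qed

lemma \<iota>_in_image_iff: "z \<in> \<iota> ` carrier A \<longleftrightarrow> (\<exists>p\<in>lifts. z = \<theta> p)"
proof
  assume "z \<in> \<iota> ` carrier A"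
  then obtain x where x: "x \<in> carrier A" "z = \<iota> x" by blast
  then have "x \<in> carrier Q" using subringE(1)[OF A_subring] by blast
  then obtain p where "p \<in> C" "x = cls p"
    by (auto simp: qmatrix_algebra_def FactRing_def A_RCOSETS_def' qmatrix_class_def)
  then show "\<exists>p\<in>lifts. z = \<theta> p" using x by (auto simp: lifts_def \<theta>_def)
qed (auto simp: lifts_def \<theta>_def)

lemma \<kappa>_commute_image:
  assumes "p \<in> lifts"
  shows "\<kappa> c * \<theta> p = \<theta> p * \<kappa> c"
proof -
  have "\<kappa> c * \<theta> p = \<theta> (free_const c * p)"
    using assms by (simp add: \<theta>_simps lifts_closed)
  also have "\<dots> = \<theta> p * \<kappa> c"
    using assms by (simp add: free_const_central \<theta>_simps(2)[OF _ lifts_closed(1)] \<theta>_simps(4))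
  finally show ?thesis .
qed

lemma fraction:
  obtains p r where "p \<in> lifts" "r \<in> lifts" "\<theta> r \<noteq> 0" "z = \<theta> p * inverse (\<theta> r)"
proof -
  obtain a b where ab: "a \<in> carrier A" "b \<in> carrier A" "b \<noteq> \<zero>\<^bsub>Q\<^esub>" "z = \<iota> a * inverse (\<iota> b)"
  proof -
    have "\<exists>a\<in>carrier A. \<exists>b\<in>carrier A. b \<noteq> \<zero>\<^bsub>Q\<^esub> \<and> z = \<iota> a * inverse (\<iota> b)"
      using fractions by (simp add: skew_field_of_fractions_def)
    then show ?thesis using that by blast
  qed
  obtain p r where pr: "p \<in> lifts" "\<iota> a = \<theta> p" "r \<in> lifts" "\<iota> b = \<theta> r"
    using \<iota>_in_image_iff ab by (metis imageI)
  have "\<zero>\<^bsub>Q\<^esub> \<in> carrier A" using subringE(2)[OF A_subring] .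
  then have "\<iota> b \<noteq> \<iota> \<zero>\<^bsub>Q\<^esub>" using \<iota>_inj ab by simp
  moreover have "\<iota> \<zero>\<^bsub>Q\<^esub> = 0" using \<theta>_0 by (simp add: \<theta>_def cls_0)
  ultimately show ?thesis using that pr ab by metis
qed

text \<open>Scalars commute with the image of the Grassmannian, hence with inverses of its elements,
  hence with all fractions.\<close>

sublocale S: central_scalars \<kappa> h
proof
  show "\<kappa> (c + d) = \<kappa> c + \<kappa> d" "\<kappa> (c * d) = \<kappa> c * \<kappa> d" "\<kappa> 1 = 1" for c d
    using \<theta>_simps(1)[of "free_const c" "free_const d"] \<theta>_simps(2)[of "free_const c" "free_const d"]
      \<theta>_simps(4)[of 1] \<theta>_simps(3) lifts_closed(1)
    by (simp_all add: free_const_simps(1-3) flip: \<theta>_simps(4))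
  show "h \<noteq> 0" using q_nonzero' h_square by auto
  show "\<kappa> c * z = z * \<kappa> c" for c z
  proof -
    obtain p r where pr: "p \<in> lifts" "r \<in> lifts" "\<theta> r \<noteq> 0" "z = \<theta> p * inverse (\<theta> r)"
      by (rule fraction)
    have "\<kappa> c * inverse (\<theta> r) = inverse (\<theta> r) * \<kappa> c"
      using mult_commute_imp_mult_inverse_commute[of "\<theta> r" "\<kappa> c"] \<kappa>_commute_image[OF pr(2), of c] pr(3) by simp
    then show ?thesis
      using \<kappa>_commute_image[OF pr(1), of c] unfolding pr(4) by (metis mult.assoc)
  qed
qed

lemma is_algebra_A: "is_algebra A \<eta>"
proof -
  have \<eta>_A: "\<eta> c \<in> carrier A" for c
    unfolding carrier_A by (intro generate_ring.incl) auto
  have "\<eta> c \<otimes>\<^bsub>Q\<^esub> x = x \<otimes>\<^bsub>Q\<^esub> \<eta> c" if "x \<in> carrier A" for c x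
  proof -
    have "\<iota> (\<eta> c \<otimes>\<^bsub>Q\<^esub> x) = \<iota> (x \<otimes>\<^bsub>Q\<^esub> \<eta> c)"
      using that \<eta>_A S.scalar_central[of c "\<iota> x"] by (simp add: \<iota>_hom \<kappa>_def)
    then show ?thesis
      using that \<eta>_A subringE(6)[OF A_subring] by (simp add: \<iota>_inj)
  qed
  moreover have "\<eta> \<in> ring_hom type_ring A"
    using \<eta>_A by (auto simp: ring_hom_def \<eta>_eq free_const_simps cls_simps)
  ultimately show ?thesis
    using A_ring by (simp add: is_algebra_def)
qed

lemma is_algebra_F: "is_algebra type_ring \<kappa>"
  unfolding is_algebra_def
proof (intro conjI allI ballI)
  show "\<kappa> \<in> ring_hom type_ring type_ring"
    by (simp add: ring_hom_def S.scalar_add S.scalar_mult)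
  show "\<kappa> c \<otimes>\<^bsub>type_ring\<^esub> x = x \<otimes>\<^bsub>type_ring\<^esub> \<kappa> c" for c x
    unfolding type_ring_simps by (rule S.scalar_central)
qed (rule ring_type_ring)

text \<open>Zero divisors are excluded by the embedding into a skew field.\<close>

lemma noncomm_domain_A: "noncomm_domain A"
proof -
  have zero: "\<zero>\<^bsub>Q\<^esub> \<in> carrier A" "\<iota> \<zero>\<^bsub>Q\<^esub> = 0"
    using subringE(2)[OF A_subring] \<theta>_0 by (simp_all add: \<theta>_def cls_0)
  have "\<one>\<^bsub>Q\<^esub> \<noteq> \<zero>\<^bsub>Q\<^esub>" using zero \<iota>_hom(3) by force
  moreover have "a = \<zero>\<^bsub>Q\<^esub> \<or> b = \<zero>\<^bsub>Q\<^esub>"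
    if ab: "a \<in> carrier A" "b \<in> carrier A" "a \<otimes>\<^bsub>Q\<^esub> b = \<zero>\<^bsub>Q\<^esub>" for a b
  proof -
    have "\<iota> a * \<iota> b = 0" using ab zero \<iota>_hom(2) by metis
    then have "\<iota> a = \<iota> \<zero>\<^bsub>Q\<^esub> \<or> \<iota> b = \<iota> \<zero>\<^bsub>Q\<^esub>" using zero by simp
    then show ?thesis using ab zero \<iota>_inj by blast
  qed
  ultimately show ?thesis
    using A_ring by (auto simp: noncomm_domain_def)
qed

definition Pl :: "int \<times> int \<times> int \<Rightarrow> 'f" where
  "Pl I = \<theta> (minor_poly I)"

definition plucker_index :: "int \<times> int \<times> int \<Rightarrow> bool" where
  "plucker_index = (\<lambda>(a, b, c). 1 \<le> a \<and> a < b \<and> b < c \<and> c \<le> 6)"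

lemma plucker_lifts: "plucker_index I \<Longrightarrow> minor_poly I \<in> lifts"
  by (cases I) (simp add: plucker_index_def minor_poly_lifts)

text \<open>Generation and spanning arguments later take place inside the skew field, so the
  generators are carried over.\<close>

lemma image_A: "\<iota> ` carrier A = generate_ring type_ring (range \<kappa> \<union> Pl ` Collect plucker_index)"
proof (intro equalityI subsetI)
  interpret Q: ring Q by (rule Q_ring)
  let ?G = "generate_ring type_ring (range \<kappa> \<union> Pl ` Collect plucker_index)"
  have sub: "generate_ring Q (range \<eta> \<union> minors) = carrier A" by (simp only: carrier_A)
  fix z assume "z \<in> \<iota> ` carrier A"
  then obtain x where x: "x \<in> generate_ring Q (range \<eta> \<union> minors)" "z = \<iota> x"
    unfolding carrier_A by blast
  have "\<iota> x \<in> ?G"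
    using x(1)
  proof (induction rule: generate_ring.induct)
    case one
    show ?case using generate_ring.one[of "type_ring :: 'f ring"] by (simp add: \<iota>_hom)
  next
    case (incl x)
    then show ?case
    proof
      assume "x \<in> range \<eta>"
      then show ?thesis by (intro generate_ring.incl) (auto simp: \<kappa>_def)
    next
      assume "x \<in> minors"
      then obtain a b c where abc: "1 \<le> a" "a < b" "b < c" "c \<le> 6" "x = cls (minor_poly (a, b, c))"
        by (rule minorsE)
      then have "\<iota> x = Pl (a, b, c)" "plucker_index (a, b, c)"
        by (simp_all add: Pl_def \<theta>_def plucker_index_def)
      then show ?thesis by (intro generate_ring.incl) auto
    qed
  next
    case (a_inv x)
    have x: "x \<in> carrier A" using a_inv.hyps by (simp only: sub)
    have "\<ominus>\<^bsub>Q\<^esub> x \<in> carrier A" using subringE(5)[OF A_subring x] .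
    then have "\<iota> (\<ominus>\<^bsub>Q\<^esub> x) + \<iota> x = \<iota> (\<ominus>\<^bsub>Q\<^esub> x \<oplus>\<^bsub>Q\<^esub> x)"
      using x by (simp add: \<iota>_hom)
    also have "\<dots> = 0"
      using x subringE(1)[OF A_subring] \<theta>_0 by (simp add: \<theta>_def cls_0 Q.l_neg subset_iff)
    finally have "\<iota> (\<ominus>\<^bsub>Q\<^esub> x) = - \<iota> x" by (simp add: eq_neg_iff_add_eq_0)
    then show ?case
      using generate_ring.a_inv[OF a_inv.IH] by simp
  next
    case (eng_add x y)
    then have "x \<in> carrier A" "y \<in> carrier A" by (simp_all only: sub)
    then show ?case using generate_ring.eng_add[OF eng_add.IH] by (simp add: \<iota>_hom)
  next
    case (eng_mult x y)
    then have "x \<in> carrier A" "y \<in> carrier A" by (simp_all only: sub)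
    then show ?case using generate_ring.eng_mult[OF eng_mult.IH] by (simp add: \<iota>_hom)
  qed
  then show "z \<in> ?G" using x by simp
next
  fix z assume "z \<in> generate_ring type_ring (range \<kappa> \<union> Pl ` Collect plucker_index)"
  then have "\<exists>p\<in>lifts. z = \<theta> p"
  proof (induction rule: generate_ring.induct)
    case one
    show ?case using \<theta>_simps(3) lifts_closed(2) by force
  next
    case (incl z)
    then show ?case
    proof
      assume "z \<in> range \<kappa>"
      then obtain c where "z = \<theta> (free_const c)" by (auto simp: \<theta>_simps(4))
      then show ?thesis using lifts_closed(1) by blast
    next
      assume "z \<in> Pl ` Collect plucker_index"
      then show ?thesis using plucker_lifts by (auto simp: Pl_def)
    qed
  next
    case (a_inv z)
    then obtain p where p: "p \<in> lifts" "z = \<theta> p" by blast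
    then have eq: "- z = \<theta> (free_const (- 1) * p)"
      using \<theta>_simps(2)[OF lifts_closed(1) p(1), of "- 1"] by (simp add: \<theta>_simps(4) S.scalar_uminus)
    show ?case
      unfolding a_inv_type_ring eq by (rule bexI[OF refl lifts_closed(5)[OF lifts_closed(1) p(1)]])
  next
    case (eng_add x y)
    then obtain p r where "p \<in> lifts" "x = \<theta> p" "r \<in> lifts" "y = \<theta> r" by blast
    then have "p + r \<in> lifts" "x + y = \<theta> (p + r)" by (auto simp: \<theta>_simps(1))
    then show ?case by auto
  next
    case (eng_mult x y)
    then obtain p r where "p \<in> lifts" "x = \<theta> p" "r \<in> lifts" "y = \<theta> r" by blast
    then have "p * r \<in> lifts" "x * y = \<theta> (p * r)" by (auto simp: \<theta>_simps(2))
    then show ?case by auto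
  qed
  then show "z \<in> \<iota> ` carrier A" by (simp only: \<iota>_in_image_iff)
qed

lemma minor_relation_Pl:
  assumes rel: "minor_relation ts"
    and idx: "\<And>c e I K. (c, e, I, K) \<in> set ts \<Longrightarrow> plucker_index I \<and> plucker_index K"
  shows "sum_list (map (\<lambda>(c, e, I, K). of_int c * (S.hp (2 * e) * (Pl I * Pl K))) ts) = 0"
proof -
  \<comment> \<open>Exponents double because \<open>q\<close> is the square of
    \<open>h\<close>.\<close>
  have hp2: "\<kappa> (q powi e) = S.hp (2 * e)" for e
    using power_int_mult[of h 2 e] h_square by (simp add: S.hp_def)
  have \<kappa>_int: "\<kappa> (of_int c) = of_int c" for c
  proof -
    have nat: "\<kappa> (of_nat m) = of_nat m" for m
      by (induction m) (simp_all add: S.scalar_add)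
    show ?thesis
      by (cases c rule: int_diff_cases) (simp add: nat S.scalar_add S.scalar_uminus
          diff_conv_add_uminus del: add_uminus_conv_diff)
  qed
  have summand: "of_int c * (K.hp e * (minor_poly I * minor_poly K)) \<in> lifts \<and>
      \<theta> (of_int c * (K.hp e * (minor_poly I * minor_poly K))) = of_int c * (S.hp (2 * e) * (Pl I * Pl K))"
    if "plucker_index I" "plucker_index K" for c e I K
  proof -
    have l: "minor_poly I \<in> lifts" "minor_poly K \<in> lifts" using that plucker_lifts by auto
    then show ?thesis
      by (simp add: of_int_eq_const K.hp_def \<theta>_simps lifts_closed \<kappa>_int hp2 Pl_def)
  qed
  have 1: "sum_list (map (\<lambda>(c, e, I, K). of_int c * (K.hp e * (minor_poly I * minor_poly K))) ts) \<in> lifts \<and>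
      \<theta> (sum_list (map (\<lambda>(c, e, I, K). of_int c * (K.hp e * (minor_poly I * minor_poly K))) ts)) =
      sum_list (map (\<lambda>(c, e, I, K). of_int c * (S.hp (2 * e) * (Pl I * Pl K))) ts)"
    using idx
  proof (induction ts)
    case Nil
    then show ?case using \<theta>_0 lifts_closed(3) by simp
  next
    case (Cons t ts)
    obtain c e I K where t: "t = (c, e, I, K)" by (cases t)
    have 1: "plucker_index I" "plucker_index K" using Cons.prems[of c e I K] by (auto simp: t)
    have 2: "plucker_index I \<and> plucker_index K" if "(c, e, I, K) \<in> set ts" for c e I K
      using Cons.prems[of c e I K] that by simp
    show ?case
      using summand[OF 1, of c e] Cons.IH[OF 2] by (simp add: t \<theta>_simps lifts_closed)
  qed
  have 2: "sum_list (map (\<lambda>(c, e, I, K). of_int c * (K.hp e * (minor_poly I * minor_poly K))) ts) \<in> J"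
  proof (rule minor_relation[OF rel])
    fix c e I K assume "(c, e, I, K) \<in> set ts"
    then have "plucker_index I" "plucker_index K" using idx by auto
    then show "valid_index I \<and> valid_index K"
      by (cases I; cases K) (auto simp: plucker_index_def valid_index_def)
  qed
  show ?thesis
    using \<theta>_eq_0_iff[OF conjunct1[OF 1]] 2 conjunct2[OF 1] by simp
qed

end

section \<open>Twisted shift operators and the image of the generic matrix\<close>

section \<open>A representation of quantum matrices by weighted shifts\<close>

text \<open>Linear operators on the space of all functions on integer lists, of any length and
  without a condition on supports; composition makes them a ring.\<close>

typedef (overloaded) 'k endo = "{f :: (int list \<Rightarrow> 'k::field) \<Rightarrow> int list \<Rightarrow> 'k.
    (\<forall>x y. f (\<lambda>v. x v + y v) = (\<lambda>v. f x v + f y v)) \<and> (\<forall>c x. f (\<lambda>v. c * x v) = (\<lambda>v. c * f x v))}"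
  morphisms apply_endo Abs_endo
  by (rule exI[of _ "\<lambda>x. x"]) simp

setup_lifting type_definition_endo

instantiation endo :: (field) ring_1
begin

lift_definition zero_endo :: "'a endo" is "\<lambda>x v. 0" by simp
lift_definition one_endo :: "'a endo" is "\<lambda>x. x" by simp
lift_definition plus_endo :: "'a endo \<Rightarrow> 'a endo \<Rightarrow> 'a endo" is "\<lambda>f g x v. f x v + g x v"
  by (simp add: fun_eq_iff algebra_simps)
lift_definition uminus_endo :: "'a endo \<Rightarrow> 'a endo" is "\<lambda>f x v. - f x v"
  by (simp add: fun_eq_iff)
lift_definition minus_endo :: "'a endo \<Rightarrow> 'a endo \<Rightarrow> 'a endo" is "\<lambda>f g x v. f x v - g x v"
  by (simp add: fun_eq_iff algebra_simps)
lift_definition times_endo :: "'a endo \<Rightarrow> 'a endo \<Rightarrow> 'a endo" is "\<lambda>f g x. f (g x)"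
  by simp

instance
proof
  show "(0 :: 'a endo) \<noteq> 1"
    by transfer (auto simp: fun_eq_iff intro!: exI[of _ "\<lambda>_. 1"])
qed (transfer; simp add: fun_eq_iff algebra_simps)+

end

lift_definition scalar_endo :: "'k::field \<Rightarrow> 'k endo" is "\<lambda>c x v. c * x v"
  by (simp add: fun_eq_iff algebra_simps)

fun vec_diff :: "int list \<Rightarrow> int list \<Rightarrow> int list" where
  "vec_diff (x # xs) (y # ys) = (x - y) # vec_diff xs ys"
| "vec_diff xs ys = []"

text \<open>The factor depends bilinearly on \<open>v\<close> and \<open>a\<close>, so composing the
  shifts by \<open>a\<close> and \<open>b\<close> leaves exactly the power of \<open>h\<close> given
  by \<open>form \<Omega> a b\<close>. At lists of another length the result is zero.\<close>

lift_definition shift_endo :: "'k::field \<Rightarrow> int list list \<Rightarrow> int list \<Rightarrow> 'k endo" is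
  "\<lambda>h \<Omega> a x v. if length v = length a then h powi (- form \<Omega> v a) * x (vec_diff v a) else 0"
  by (auto simp: fun_eq_iff algebra_simps)

lemma apply_endo_simps:
  "apply_endo 0 x v = 0"
  "apply_endo (f + g) x v = apply_endo f x v + apply_endo g x v"
  "apply_endo (f * g) x = apply_endo f (apply_endo g x)"
  "apply_endo (scalar_endo c) x v = c * x v"
  by (transfer; simp)+

lemma apply_shift_endo:
  "apply_endo (shift_endo h \<Omega> a) x v =
    (if length v = length a then h powi (- form \<Omega> v a) * x (vec_diff v a) else 0)"
  by transfer simp

lemma apply_endo_sum: "apply_endo (sum f S) x v = (\<Sum>a\<in>S. apply_endo (f a) x v)"
  by (induction S rule: infinite_finite_induct) (simp_all add: apply_endo_simps)

lemma central_scalars_endo: "h \<noteq> 0 \<Longrightarrow> central_scalars scalar_endo h"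
  by unfold_locales (transfer; simp add: fun_eq_iff algebra_simps; fail)+

lemma length_vec_diff [simp]: "length (vec_diff xs ys) = min (length xs) (length ys)"
  by (induction xs ys rule: vec_diff.induct) auto

lemma vec_diff_vec_diff: "vec_diff (vec_diff v a) b = vec_diff v (vec_add a b)"
proof (induction v a arbitrary: b rule: vec_diff.induct)
  case (1 x xs y ys)
  then show ?case by (cases b) auto
qed auto

lemma dot_vec_diff: "length v = length a \<Longrightarrow> dot (vec_diff v a) w = dot v w - dot a w"
proof (induction v a arbitrary: w rule: list_induct2)
  case (Cons x xs y ys)
  then show ?case by (cases w) (auto simp: algebra_simps)
qed auto

lemma dot_vec_add: "length a = length b \<Longrightarrow> dot (vec_add a b) w = dot a w + dot b w"
proof (induction a b arbitrary: w rule: list_induct2)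
  case (Cons x xs y ys)
  then show ?case by (cases w) (auto simp: algebra_simps)
qed auto

lemma dot_map_add: "dot v (map (\<lambda>r. f r + g r) ws) = dot v (map f ws) + dot v (map g ws)"
proof (induction ws arbitrary: v)
  case (Cons w ws)
  then show ?case by (cases v) (auto simp: algebra_simps)
qed (simp add: dot.simps(2))

lemma form_vec_diff: "length v = length a \<Longrightarrow> form \<Omega> (vec_diff v a) b = form \<Omega> v b - form \<Omega> a b"
  by (simp add: form_def dot_vec_diff)

lemma form_vec_add: "length a = length b \<Longrightarrow> form \<Omega> v (vec_add a b) = form \<Omega> v a + form \<Omega> v b"
  by (simp add: form_def dot_vec_add dot_map_add cong: map_cong)

lemma quantum_torus_endo:
  assumes "h \<noteq> (0 :: 'k::field)"
  shows "quantum_torus scalar_endo h n \<Omega> (shift_endo h \<Omega>)"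
proof -
  interpret central_scalars scalar_endo h using assms by (rule central_scalars_endo)
  show ?thesis
  proof
    fix a b :: "int list" assume len: "length a = n" "length b = n"
    have pow: "h powi (- form \<Omega> v a) * h powi (- form \<Omega> (vec_diff v a) b) =
        h powi form \<Omega> a b * h powi (- form \<Omega> v (vec_add a b))" if "length v = n" for v
      using assms len that
      by (simp add: form_vec_diff form_vec_add flip: power_int_add) (rule arg_cong[where f = "power_int h"], simp)
    have "apply_endo (shift_endo h \<Omega> a * shift_endo h \<Omega> b) x v =
        apply_endo (hp (form \<Omega> a b) * shift_endo h \<Omega> (vec_add a b)) x v" for x v
      using len pow[of v] by (simp add: hp_def apply_endo_simps apply_shift_endo vec_diff_vec_diff flip: mult.assoc)
    then show "shift_endo h \<Omega> a * shift_endo h \<Omega> b = hp (form \<Omega> a b) * shift_endo h \<Omega> (vec_add a b)"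
      by (metis apply_endo_inject ext)
  qed
qed

lemma vec_diff_eq_zero_iff: "length v = length a \<Longrightarrow> vec_diff v a = map (\<lambda>_. 0) v \<longleftrightarrow> v = a"
  by (induction v a rule: list_induct2) auto

text \<open>Apply the relation to the indicator function of the zero vector and evaluate at
  \<open>b\<close>: only the shift by \<open>b\<close> contributes, with an invertible
  factor.\<close>

lemma shift_endo_independent:
  fixes c :: "int list \<Rightarrow> 'k::field"
  assumes "h \<noteq> 0" "finite S" "\<And>a. a \<in> S \<Longrightarrow> length a = n"
    and zero: "(\<Sum>a\<in>S. scalar_endo (c a) * shift_endo h \<Omega> a) = 0" and "b \<in> S"
  shows "c b = 0"
proof -
  define \<delta> :: "int list \<Rightarrow> 'k" where "\<delta> v = (if v = map (\<lambda>_. 0) b then 1 else 0)" for v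
  have zeros: "map (\<lambda>_. 0 :: int) b = map (\<lambda>_. 0) v" if "length v = n" for v :: "int list"
    using assms(3)[OF \<open>b \<in> S\<close>] that by (simp add: map_replicate_const)
  have summand: "apply_endo (scalar_endo (c a) * shift_endo h \<Omega> a) \<delta> b =
      (if a = b then c b * h powi (- form \<Omega> b b) else 0)" if "a \<in> S" for a
  proof -
    have len: "length b = length a" using assms(3) that \<open>b \<in> S\<close> by simp
    have "\<delta> (vec_diff b a) = (if a = b then 1 else 0)"
      using vec_diff_eq_zero_iff[OF len] by (auto simp: \<delta>_def)
    then show ?thesis
      using len by (auto simp: apply_endo_simps apply_shift_endo)
  qed
  have "0 = apply_endo (\<Sum>a\<in>S. scalar_endo (c a) * shift_endo h \<Omega> a) \<delta> b"
    by (simp add: zero apply_endo_simps)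
  also have "\<dots> = (\<Sum>a\<in>S. if a = b then c b * h powi (- form \<Omega> b b) else 0)"
    unfolding apply_endo_sum by (rule sum.cong[OF refl summand])
  also have "\<dots> = c b * h powi (- form \<Omega> b b)"
    using assms by simp
  finally show ?thesis using assms(1) by simp
qed

definition initial_indices :: "(int \<times> int \<times> int) list" where
  "initial_indices =
   [(1, 2, 4), (1, 2, 5), (1, 3, 4), (1, 4, 5), (1, 2, 3), (1, 2, 6), (1, 5, 6), (2, 3, 4), (3, 4, 5), (4, 5, 6)]"

text \<open>The generic \<open>3 \<times> 6\<close> matrix is mapped to the product of a matrix supported on a path from the
  upper left to the lower right corner and four bidiagonal matrices. The coordinates on the torus are
  chosen such that the \<open>i\<close>-th initial minor is mapped to the \<open>i\<close>-th coordinate.\<close>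

definition rep_form :: "int list list" where
  "rep_form =
   [[0, 1, 1, 1, - 1, 1, 2, 1, 2, 2, 0, 0],
    [- 1, 0, 0, 1, - 1, 1, 1, 0, 2, 2, 0, 0],
    [- 1, 0, 0, 1, - 1, 0, 2, 1, 1, 2, - 1, 0],
    [- 1, - 1, - 1, 0, - 2, 0, 1, 0, 1, 1, - 1, 0],
    [1, 1, 1, 2, 0, 1, 2, 1, 2, 3, 0, 0],
    [- 1, - 1, 0, 0, - 1, 0, 1, 0, 1, 2, 0, 0],
    [- 2, - 1, - 2, - 1, - 2, - 1, 0, - 1, 0, 1, - 1, 0],
    [- 1, 0, - 1, 0, - 1, 0, 1, 0, 1, 2, 0, - 1],
    [- 2, - 2, - 1, - 1, - 2, - 1, 0, - 1, 0, 1, - 1, - 1],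
    [- 2, - 2, - 2, - 1, - 3, - 2, - 1, - 2, - 1, 0, - 1, - 1],
    [0, 0, 1, 1, 0, 0, 1, 0, 1, 1, 0, 0],
    [0, 0, 0, 0, 0, 0, 0, 1, 1, 1, 0, 0]]"

text \<open>Each matrix entry is a sum of normalised monomials with coefficient 1; an empty list is
  the entry zero. The last two coordinates are constant along every row and add up to zero over the
  three rows, so they cancel in every minor.\<close>

definition rep_entries :: "int list list list list" where
  "rep_entries =
   [[[[0, 0, 0, 0, 0, 0, 0, 0, 0, 0, 0, 1]],
     [[0, 0, - 1, 0, 0, 0, 0, 1, 0, 0, 0, 1], [1, 0, - 1, - 1, 0, 0, 0, 0, 1, 0, 0, 1], [0, 1, 0, - 1, 0, 0, - 1, 0, 0, 1, 0, 1]],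
     [[0, 0, 0, - 1, 0, 0, 0, 0, 1, 0, 0, 1], [- 1, 1, 1, - 1, 0, 0, - 1, 0, 0, 1, 0, 1], [- 1, 0, 0, 0, 1, 0, - 1, 0, 0, 1, 0, 1]],
     [[0, 0, 0, 0, 0, 0, - 1, 0, 0, 1, 0, 1]],
     [],
     []],
    [[],
     [[0, 0, 0, 0, 0, 0, 0, 0, 0, 0, 1, 0]],
     [[- 1, 0, 1, 0, 0, 0, 0, 0, 0, 0, 1, 0], [- 1, - 1, 0, 1, 1, 0, 0, 0, 0, 0, 1, 0], [0, - 1, 0, 0, 1, - 1, 1, 0, 0, 0, 1, 0]],
     [[0, - 1, 0, 1, 0, 0, 0, 0, 0, 0, 1, 0], [1, - 1, 0, 0, 0, - 1, 1, 0, 0, 0, 1, 0]],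
     [[0, 0, 0, 0, 0, - 1, 1, 0, 0, 0, 1, 0]],
     []],
    [[],
     [],
     [[0, 0, 0, 0, 1, 0, 0, 0, 0, 0, - 1, - 1]],
     [[1, 0, 0, 0, 0, 0, 0, 0, 0, 0, - 1, - 1]],
     [[0, 1, 0, 0, 0, 0, 0, 0, 0, 0, - 1, - 1]],
     [[0, 0, 0, 0, 0, 1, 0, 0, 0, 0, - 1, - 1]]]]"

text \<open>Integer indices keep the evaluated tables within a single number type.\<close>

fun nth_int :: "'a list \<Rightarrow> int \<Rightarrow> 'a" where
  "nth_int (x # xs) i = (if i = 0 then x else nth_int xs (i - 1))"

text \<open>Rows and columns count from 1, the nested lists from 0; the leading 0 of a key is the
  exponent of \<open>h\<close>.\<close>

definition rep_entry :: "int \<Rightarrow> int \<Rightarrow> (int \<times> int list) list" where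
  "rep_entry i j = map (\<lambda>a. (1, 0 # a)) (nth_int (nth_int rep_entries (i - 1)) (j - 1))"

definition rep_relations :: "int \<Rightarrow> int \<Rightarrow> int \<Rightarrow> int \<Rightarrow> (int \<times> int list) list list" where
  "rep_relations i i' j j' =
    (let a = rep_entry i j; b = rep_entry i j'; c = rep_entry i' j; d = rep_entry i' j';
         mult = torus_mult rep_form in
     [mult a b @ torus_shift (- 1) 2 (mult b a),
      mult a c @ torus_shift (- 1) 2 (mult c a),
      mult b c @ torus_shift (- 1) 0 (mult c b),
      mult b d @ torus_shift (- 1) 2 (mult d b),
      mult c d @ torus_shift (- 1) 2 (mult d c),
      mult a d @ torus_shift (- 1) 0 (mult d a) @ torus_shift (- 1) 2 (mult b c) @ torus_shift 1 (- 2) (mult b c)])"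

definition rep_minor :: "int \<times> int \<times> int \<Rightarrow> (int \<times> int list) list" where
  "rep_minor I = concat (map (\<lambda>(d, f, x, y, z). torus_shift d (2 * f)
     (torus_mult rep_form (rep_entry 1 x) (torus_mult rep_form (rep_entry 2 y) (rep_entry 3 z)))) (minor_terms I))"

definition unit_vec :: "int \<Rightarrow> int list" where
  "unit_vec i = map (\<lambda>j. if j = i then 1 else 0) [0, 1, 2, 3, 4, 5, 6, 7, 8, 9, 10, 11]"

lemma rep_relations_check:
  "list_all (\<lambda>(i, i'). list_all (\<lambda>j. list_all (\<lambda>j'. j < j' \<longrightarrow> list_all (\<lambda>r. collect r = []) (rep_relations i i' j j'))
     [1, 2, 3, 4, 5, 6]) [1, 2, 3, 4, 5, 6]) [(1, 2), (1, 3), (2, 3)]"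
  by code_simp

lemma rep_minor_check:
  "list_all (\<lambda>(i, I). collect (rep_minor I) = [(1, 0 # unit_vec i)])
     (zip [0, 1, 2, 3, 4, 5, 6, 7, 8, 9] initial_indices)"
  by code_simp

lemma rep_entries_wf: "list_all (\<lambda>i. list_all (\<lambda>j. list_all (\<lambda>(c, k). length k = 13) (rep_entry i j)) [1, 2, 3, 4, 5, 6]) [1, 2, 3]"
  by code_simp

lemma rep_relation:
  assumes "1 \<le> i" "i < i'" "i' \<le> 3" "1 \<le> j" "j < j'" "j' \<le> 6" "r \<in> set (rep_relations i i' j j')"
  shows "collect r = []"
proof -
  have "(i, i') \<in> set [(1, 2), (1, 3), (2, 3)]"
    using assms(1-3) by (simp add: prod_eq_iff) presburger
  moreover have "j \<in> set [1, 2, 3, 4, 5, 6]" "j' \<in> set [1, 2, 3, 4, 5, 6]"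
    using assms(4-6) by (simp, presburger)+
  ultimately show ?thesis
    using rep_relations_check assms(5,7) unfolding list_all_iff by blast
qed

lemma rep_entry_wf:
  assumes "1 \<le> i" "i \<le> 3" "1 \<le> j" "j \<le> 6"
  shows "wf_keys 12 (rep_entry i j)"
proof -
  have "i \<in> set [1, 2, 3]" "j \<in> set [1, 2, 3, 4, 5, 6]"
    using assms by (simp, presburger)+
  then show ?thesis
    using rep_entries_wf unfolding list_all_iff wf_keys_def by fastforce
qed

context central_scalars
begin

lemma free_eval_of_int: "free_eval \<kappa> X (of_int c) = of_int c"
proof -
  have "free_eval \<kappa> X (of_nat m) = of_nat m" for m
    by (induction m) (simp_all add: free_eval_add)
  then show ?thesis
    by (cases c rule: int_diff_cases) (simp add: free_eval_diff)
qed

end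

context grassmannian_fractions
begin

sublocale T: quantum_torus scalar_endo h 12 rep_form "shift_endo h rep_form :: int list \<Rightarrow> 'k endo"
  by (rule quantum_torus_endo) (rule S.h_nonzero)

definition rep_var :: "nat \<times> nat \<Rightarrow> 'k endo" where
  "rep_var = (\<lambda>(i, j). T.torus_eval (rep_entry (int i) (int j)))"

abbreviation rep :: "'k qpoly \<Rightarrow> 'k endo" where
  "rep \<equiv> free_eval scalar_endo rep_var"

lemma T_eval_collect: "collect r = [] \<Longrightarrow> T.torus_eval r = 0"
  using lincomb_collect[of T.torus_key r] by simp

lemma T_hp_q: "scalar_endo q = T.hp 2" "scalar_endo (q - inverse q) = T.hp 2 - T.hp (- 2)"
    "scalar_endo (q powi e) = T.hp (2 * e)"
proof -
  show 1: "scalar_endo (q powi e) = T.hp (2 * e)" for e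
    using power_int_mult[of h 2 e] h_square by (simp add: T.hp_def)
  show "scalar_endo q = T.hp 2" using 1[of 1] by simp
  moreover have "scalar_endo (inverse q) = T.hp (- 2)" using 1[of "- 1"] by simp
  moreover have "scalar_endo (q - inverse q) + scalar_endo (inverse q) = scalar_endo q"
    by (simp flip: T.scalar_add)
  ultimately show "scalar_endo (q - inverse q) = T.hp 2 - T.hp (- 2)"
    unfolding eq_diff_eq by simp
qed

text \<open>The operators satisfy the matrix relations, so the evaluation factors through the
  quantum matrices.\<close>

lemma rep_ideal:
  assumes "p \<in> J"
  shows "rep p = 0"
proof (rule ideal_subset_kernel[OF T.central_scalars_axioms _ assms])
  fix i i' j j' :: nat
  assume ij: "1 \<le> i" "i < i'" "i' \<le> 3" "1 \<le> j" "j < j'" "j' \<le> 6"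
  let ?a = "rep_entry (int i) (int j)" and ?b = "rep_entry (int i) (int j')"
  let ?c = "rep_entry (int i') (int j)" and ?d = "rep_entry (int i') (int j')"
  have wf: "wf_keys 12 ?a" "wf_keys 12 ?b" "wf_keys 12 ?c" "wf_keys 12 ?d"
    using ij by (auto intro!: rep_entry_wf)
  have zero: "list_all (\<lambda>r. T.torus_eval r = 0) (rep_relations (int i) (int i') (int j) (int j'))"
    unfolding list_all_iff
    using ij by (intro ballI T_eval_collect rep_relation[of "int i" "int i'" "int j" "int j'"]) auto
  note eval = T.torus_eval_shift T.torus_eval_mult wf_keys_torus_mult wf T.hp_mult_left mult.assoc
  have "T.torus_eval ?a * T.torus_eval ?b - T.hp 2 * (T.torus_eval ?b * T.torus_eval ?a) = 0"
    "T.torus_eval ?a * T.torus_eval ?c - T.hp 2 * (T.torus_eval ?c * T.torus_eval ?a) = 0"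
    "T.torus_eval ?b * T.torus_eval ?c - T.torus_eval ?c * T.torus_eval ?b = 0"
    "T.torus_eval ?b * T.torus_eval ?d - T.hp 2 * (T.torus_eval ?d * T.torus_eval ?b) = 0"
    "T.torus_eval ?c * T.torus_eval ?d - T.hp 2 * (T.torus_eval ?d * T.torus_eval ?c) = 0"
    using zero by (simp_all add: rep_relations_def Let_def eval)
  moreover have "T.torus_eval ?a * T.torus_eval ?d - T.torus_eval ?d * T.torus_eval ?a
      - T.hp 2 * (T.torus_eval ?b * T.torus_eval ?c) + T.hp (- 2) * (T.torus_eval ?b * T.torus_eval ?c) = 0"
  proof -
    let ?m = "torus_mult rep_form"
    have "T.torus_eval (?m ?a ?d @ torus_shift (- 1) 0 (?m ?d ?a) @ torus_shift (- 1) 2 (?m ?b ?c) @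
        torus_shift 1 (- 2) (?m ?b ?c)) = 0"
      using zero by (simp add: rep_relations_def Let_def)
    then show ?thesis by (simp add: eval algebra_simps)
  qed
  ultimately show "free_eval scalar_endo rep_var `
      submatrix_relations q (qvar i j) (qvar i j') (qvar i' j) (qvar i' j') \<subseteq> {0}"
    unfolding submatrix_relations_def
    by (simp add: T.free_eval_diff T.free_eval_mult T.free_eval_const T.free_eval_var rep_var_def T_hp_q
        left_diff_distrib mult.assoc) (simp add: algebra_simps)
qed

lemma rep_minor_poly:
  assumes "plucker_index I"
  shows "rep (minor_poly I) = T.torus_eval (rep_minor I)"
proof -
  have summand: "rep (of_int d * (K.hp f * (X 1 x * (X 2 y * X 3 z)))) =
      T.torus_eval (torus_shift d (2 * f)
        (torus_mult rep_form (rep_entry 1 x) (torus_mult rep_form (rep_entry 2 y) (rep_entry 3 z))))"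
    if "valid_cols [x, y, z]" for d f x y z
  proof -
    have wf: "wf_keys 12 (rep_entry 1 x)" "wf_keys 12 (rep_entry 2 y)" "wf_keys 12 (rep_entry 3 z)"
      using that by (auto intro!: rep_entry_wf)
    have X: "rep (X i j) = T.torus_eval (rep_entry (int i) j)" if "1 \<le> j" for i j
      using that by (simp add: X_def T.free_eval_var rep_var_def)
    show ?thesis
      using that wf
      by (simp add: T.free_eval_mult T.free_eval_of_int K.hp_def T.free_eval_const T_hp_q X
          T.torus_eval_shift T.torus_eval_mult wf_keys_torus_mult mult.assoc)
  qed
  have "valid_index I" using assms by (cases I) (auto simp: plucker_index_def valid_index_def)
  then have valid: "valid_cols [x, y, z]" if "(d, f, x, y, z) \<in> set (minor_terms I)" for d f x y z
    using minor_terms_valid that by blast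
  have "rep (sum_list (map g ts)) = sum_list (map (\<lambda>t. rep (g t)) ts)" for g :: "'b \<Rightarrow> 'k qpoly" and ts
    by (induction ts) (simp_all add: T.free_eval_add)
  then have "rep (minor_poly I) = sum_list (map (\<lambda>t. rep ((\<lambda>(d, f, x, y, z).
      of_int d * (K.hp f * (X 1 x * (X 2 y * X 3 z)))) t)) (minor_terms I))"
    unfolding minor_poly_def .
  also have "\<dots> = T.torus_eval (rep_minor I)"
    unfolding rep_minor_def lincomb_concat map_map comp_def
  proof (intro arg_cong[where f = sum_list] map_cong refl)
    fix t assume t: "t \<in> set (minor_terms I)"
    obtain d f x y z where t': "t = (d, f, x, y, z)" by (cases t)
    show "rep ((\<lambda>(d, f, x, y, z). of_int d * (K.hp f * (X 1 x * (X 2 y * X 3 z)))) t) =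
        T.torus_eval ((\<lambda>(d, f, x, y, z). torus_shift d (2 * f) (torus_mult rep_form (rep_entry 1 x)
          (torus_mult rep_form (rep_entry 2 y) (rep_entry 3 z)))) t)"
      using summand[OF valid[OF t[unfolded t']]] unfolding t' prod.case .
  qed
  finally show ?thesis .
qed

lemma initial_minor:
  assumes "i < (10 :: nat)"
  shows "plucker_index (nth_int initial_indices (int i))"
    and "rep (minor_poly (nth_int initial_indices (int i))) = shift_endo h rep_form (unit_vec (int i))"
proof -
  have "i \<in> {0, 1, 2, 3, 4, 5, 6, 7, 8, 9}" using assms by auto
  then have *: "(int i, nth_int initial_indices (int i)) \<in> set (zip [0, 1, 2, 3, 4, 5, 6, 7, 8, 9] initial_indices) \<and>
      plucker_index (nth_int initial_indices (int i))"
    by (elim insertE emptyE) (simp_all add: initial_indices_def plucker_index_def)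
  then show idx: "plucker_index (nth_int initial_indices (int i))" by blast
  have "collect (rep_minor (nth_int initial_indices (int i))) = [(1, 0 # unit_vec (int i))]"
    using rep_minor_check * unfolding list_all_iff by blast
  then show "rep (minor_poly (nth_int initial_indices (int i))) = shift_endo h rep_form (unit_vec (int i))"
    unfolding rep_minor_poly[OF idx] using lincomb_collect[of T.torus_key "rep_minor (nth_int initial_indices (int i))"]
    by (simp add: T.torus_key_def)
qed

end

section \<open>Laurent expansions, clusters and straightening relations as finite data\<close>

section \<open>Tables\<close>

text \<open>The 22 cluster variables are numbered: 0 to 3 are the mutable and 4 to 9 the frozen variables of
  the initial cluster; 13 and 19 are the two cluster variables that are not quantum minors.\<close>

definition variable_index :: "int \<Rightarrow> int \<times> int \<times> int" where
  "variable_index = nth_int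
   [(1, 2, 4), (1, 2, 5), (1, 3, 4), (1, 4, 5), (1, 2, 3), (1, 2, 6), (1, 5, 6), (2, 3, 4), (3, 4, 5), (4,
     5, 6), (1, 3, 5), (1, 4, 6), (2, 4, 5), (0, 0, 0), (1, 3, 6), (2, 3, 5), (3, 5, 6), (3, 4, 6), (2, 5,
     6), (0, 0, 0), (2, 4, 6), (2, 3, 6)]"

text \<open>In the normalized Laurent monomials of the initial cluster, every cluster variable is a sum of
  distinct monomials with coefficient 1.\<close>

definition laurent_table :: "int list list list" where
  "laurent_table =
   [[[1, 0, 0, 0, 0, 0, 0, 0, 0, 0]],
    [[0, 1, 0, 0, 0, 0, 0, 0, 0, 0]],
    [[0, 0, 1, 0, 0, 0, 0, 0, 0, 0]],
    [[0, 0, 0, 1, 0, 0, 0, 0, 0, 0]],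
    [[0, 0, 0, 0, 1, 0, 0, 0, 0, 0]],
    [[0, 0, 0, 0, 0, 1, 0, 0, 0, 0]],
    [[0, 0, 0, 0, 0, 0, 1, 0, 0, 0]],
    [[0, 0, 0, 0, 0, 0, 0, 1, 0, 0]],
    [[0, 0, 0, 0, 0, 0, 0, 0, 1, 0]],
    [[0, 0, 0, 0, 0, 0, 0, 0, 0, 1]],
    [[- 1, 0, 0, 1, 1, 0, 0, 0, 0, 0], [- 1, 1, 1, 0, 0, 0, 0, 0, 0, 0]],
    [[0, - 1, 0, 1, 0, 1, 0, 0, 0, 0], [1, - 1, 0, 0, 0, 0, 1, 0, 0, 0]],
    [[0, 0, - 1, 1, 0, 0, 0, 1, 0, 0], [1, 0, - 1, 0, 0, 0, 0, 0, 1, 0]],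
    [[0, 1, 1, - 1, 0, 0, 0, 0, 0, 1], [1, 0, 0, - 1, 0, 0, 1, 0, 1, 0]],
    [[- 1, - 1, 0, 1, 1, 1, 0, 0, 0, 0], [- 1, 0, 1, 0, 0, 1, 0, 0, 0, 0], [0, - 1, 0, 0, 1, 0, 1, 0, 0, 0]],
    [[- 1, 0, - 1, 1, 1, 0, 0, 1, 0, 0], [- 1, 1, 0, 0, 0, 0, 0, 1, 0, 0], [0, 0, - 1, 0, 1, 0, 0, 0, 1, 0]],
    [[- 1, 0, 0, 0, 1, 0, 0, 0, 0, 1], [- 1, 1, 1, - 1, 0, 0, 0, 0, 0, 1], [0, 0, 0, - 1, 0, 0, 1, 0, 1, 0]],
    [[0, - 1, 0, 0, 0, 1, 0, 0, 1, 0], [0, 0, 1, - 1, 0, 0, 0, 0, 0, 1], [1, - 1, 0, - 1, 0, 0, 1, 0, 1, 0]],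
    [[0, 0, - 1, 0, 0, 0, 1, 1, 0, 0], [0, 1, 0, - 1, 0, 0, 0, 0, 0, 1], [1, 0, - 1, - 1, 0, 0, 1, 0, 1, 0]],
    [[- 1, - 1, - 1, 2, 1, 1, 0, 1, 0, 0], [- 1, 0, 0, 1, 0, 1, 0, 1, 0, 0], [0, - 1, - 1, 1, 1, 0, 1, 1, 0,
     0], [0, - 1, - 1, 1, 1, 1, 0, 0, 1, 0], [1, - 1, - 1, 0, 1, 0, 1, 0, 1, 0]],
    [[0, - 1, - 1, 1, 0, 1, 0, 1, 0, 0], [1, - 1, - 1, 0, 0, 0, 1, 1, 0, 0], [1, - 1, - 1, 0, 0, 1, 0, 0, 1,
     0], [1, 0, 0, - 1, 0, 0, 0, 0, 0, 1], [2, - 1, - 1, - 1, 0, 0, 1, 0, 1, 0]],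
    [[- 1, - 1, - 1, 1, 1, 1, 0, 1, 0, 0], [- 1, 0, 0, 0, 0, 1, 0, 1, 0, 0], [0, - 1, - 1, 0, 1, 0, 1, 1, 0,
     0], [0, - 1, - 1, 0, 1, 1, 0, 0, 1, 0], [0, 0, 0, - 1, 1, 0, 0, 0, 0, 1], [1, - 1, - 1, - 1, 1, 0, 1,
     0, 1, 0]]]"

definition laurent_keys :: "int \<Rightarrow> (int \<times> int list) list" where
  "laurent_keys x = map (\<lambda>a. (1, 0 # a)) (nth_int laurent_table x)"

text \<open>The block of the ten initial minors, which is at the same time their quasi-commutation
  matrix.\<close>

definition initial_form :: "int list list" where
  "initial_form = map (take 10) (take 10 rep_form)"

text \<open>An entry \<open>(y, x, a, u, v, b, s, t)\<close> is the three-term relation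
  \<open>y x = q\<^sup>a u v + q\<^sup>b s t\<close>.\<close>

definition plucker_relations :: "(int \<times> int \<times> int \<times> int \<times> int \<times> int
     \<times> int \<times> int) list" where
  "plucker_relations =
   [(0, 10, 1, 3, 4, 1, 1, 2),
    (1, 11, - 1, 0, 6, 1, 3, 5),
    (2, 12, - 1, 0, 8, 1, 3, 7),
    (1, 14, - 1, 4, 6, 1, 5, 10),
    (2, 15, - 1, 4, 8, 1, 7, 10),
    (3, 16, 1, 9, 10, 1, 6, 8),
    (3, 17, - 1, 2, 9, 1, 8, 11),
    (3, 18, - 1, 1, 9, 1, 6, 12),
    (3, 20, - 1, 0, 9, 1, 11, 12),
    (2, 21, - 1, 4, 17, 1, 7, 14)]"

definition plucker_relation where
  "plucker_relation = (\<lambda>(y, x, a, u, v, b, s, t).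
     [(1, 0, variable_index y, variable_index x), (- 1, a, variable_index u, variable_index v),
      (- 1, b, variable_index s, variable_index t)])"

text \<open>The counterpart of \<open>plucker_relation\<close> in the torus. Together the two
  identify a Laurent polynomial with a minor.\<close>

definition laurent_relation where
  "laurent_relation = (\<lambda>(y, x, a, u, v, b, s, t).
     torus_mult initial_form (laurent_keys y) (laurent_keys x) @
     torus_shift (- 1) (2 * a) (torus_mult initial_form (laurent_keys u) (laurent_keys v)) @
     torus_shift (- 1) (2 * b) (torus_mult initial_form (laurent_keys s) (laurent_keys t)))"

definition quasi_relation :: "int \<times> int \<Rightarrow> (int \<times> int \<times> (int \<times> int
     \<times> int) \<times> (int \<times> int \<times> int)) list" where
  "quasi_relation = (\<lambda>(i, j).
     [(1, 0, nth_int initial_indices i, nth_int initial_indices j),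
      (- 1, nth_int (nth_int rep_form i) j, nth_int initial_indices j, nth_int initial_indices i)])"

definition initial_pairs :: "(int \<times> int) list" where
  "initial_pairs =
   [(0, 1), (0, 2), (0, 3), (0, 4), (0, 5), (0, 6), (0, 7), (0, 8), (0, 9), (1, 2), (1, 3), (1, 4), (1, 5),
     (1, 6), (1, 7), (1, 8), (1, 9), (2, 3), (2, 4), (2, 5), (2, 6), (2, 7), (2, 8), (2, 9), (3, 4), (3, 5),
     (3, 6), (3, 7), (3, 8), (3, 9), (4, 5), (4, 6), (4, 7), (4, 8), (4, 9), (5, 6), (5, 7), (5, 8), (5, 9),
     (6, 7), (6, 8), (6, 9), (7, 8), (7, 9), (8, 9)]"

text \<open>Quasi-commutation exponents; 99 marks pairs that do not occur in a common cluster.\<close>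

definition quasi_table :: "int list list" where
  "quasi_table =
   [[0, 1, 1, 1, - 1, 1, 2, 1, 2, 2, 99, 1, 1, 3, 99, 99, 99, 2, 2, 99, 1, 99],
    [- 1, 0, 0, 1, - 1, 1, 1, 0, 2, 2, 1, 99, 1, 1, 99, 1, 2, 99, 1, 99, 99, 99],
    [- 1, 0, 0, 1, - 1, 0, 2, 1, 1, 2, 1, 1, 99, 1, 1, 99, 2, 1, 99, 99, 99, 99],
    [- 1, - 1, - 1, 0, - 2, 0, 1, 0, 1, 1, - 1, 1, 1, 99, 0, 0, 99, 99, 99, 1, 99, 99],
    [1, 1, 1, 2, 0, 1, 2, 1, 2, 3, 1, 2, 2, 3, 1, 1, 2, 2, 2, 3, 2, 1],
    [- 1, - 1, 0, 0, - 1, 0, 1, 0, 1, 2, 0, 1, 0, 1, 1, 0, 2, 2, 1, 1, 1, 1],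
    [- 2, - 1, - 2, - 1, - 2, - 1, 0, - 1, 0, 1, - 1, - 1, 0, - 1, - 1, 0, 1, 0, 1, - 1, 0, 0],
    [- 1, 0, - 1, 0, - 1, 0, 1, 0, 1, 2, 0, 0, 1, 1, 0, 1, 2, 1, 2, 1, 1, 1],
    [- 2, - 2, - 1, - 1, - 2, - 1, 0, - 1, 0, 1, - 1, 0, - 1, - 1, 0, - 1, 1, 1, 0, - 1, 0, 0],
    [- 2, - 2, - 2, - 1, - 3, - 2, - 1, - 2, - 1, 0, - 2, - 1, - 1, - 3, - 2, - 2, - 1, - 1, - 1, - 3, - 1,
     - 2],
    [99, - 1, - 1, 1, - 1, 0, 1, 0, 1, 2, 0, 99, 99, 99, 1, 1, 1, 99, 99, 99, 99, 99],
    [- 1, 99, - 1, - 1, - 2, - 1, 1, 0, 0, 1, 99, 0, 0, 99, - 1, 99, 99, 1, 99, - 1, 1, 0],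
    [- 1, - 1, 99, - 1, - 2, 0, 0, - 1, 1, 1, 99, 0, 0, 99, 99, - 1, 99, 99, 1, - 1, 1, 0],
    [- 3, - 1, - 1, 99, - 3, - 1, 1, - 1, 1, 3, 99, 99, 99, 0, 99, 99, 3, 1, 1, 99, 99, 99],
    [99, 99, - 1, 0, - 1, - 1, 1, 0, 0, 2, - 1, 1, 99, 99, 0, 0, 1, 1, 99, 1, 99, 1],
    [99, - 1, 99, 0, - 1, 0, 0, - 1, 1, 2, - 1, 99, 1, 99, 0, 0, 1, 99, 1, 1, 99, 1],
    [99, - 2, - 2, 99, - 2, - 2, - 1, - 2, - 1, 1, - 1, 99, 99, - 3, - 1, - 1, 0, - 1, - 1, 99, 99, - 1],
    [- 2, 99, - 1, 99, - 2, - 2, 0, - 1, - 1, 1, 99, - 1, 99, - 1, - 1, 99, 1, 0, 0, 99, - 1, - 1],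
    [- 2, - 1, 99, 99, - 2, - 1, - 1, - 2, 0, 1, 99, 99, - 1, - 1, 99, - 1, 1, 0, 0, 99, - 1, - 1],
    [99, 99, 99, - 1, - 3, - 1, 1, - 1, 1, 3, 99, 1, 1, 99, - 1, - 1, 99, 99, 99, 0, 99, 1],
    [- 1, 99, 99, 99, - 2, - 1, 0, - 1, 0, 1, 99, - 1, - 1, 99, 99, 99, 99, 1, 1, 99, 0, - 1],
    [99, 99, 99, 99, - 1, - 1, 0, - 1, 0, 2, 99, 0, 0, 99, - 1, - 1, 1, 1, 1, - 1, 1, 0]]"

definition quasi :: "int \<Rightarrow> int \<Rightarrow> int" where
  "quasi x z = nth_int (nth_int quasi_table x) z"

text \<open>A seed is given by the list of its mutable variables \<open>z\<close>, each with the variable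
     \<open>z'\<close> by which
  mutation at \<open>z\<close> replaces it, and with the nonzero entries of its column of the exchange
     matrix.\<close>

type_synonym cluster = "(int \<times> int \<times> (int \<times> int) list) list"

text \<open>Type D4 has 16 mutable cluster variables and 50 clusters; the initial cluster comes
  first. All nonzero exchange entries are 1 or -1, so each exchange monomial is a product of
  distinct variables.\<close>

definition clusters :: "cluster list" where
  "clusters =
   [[(0, 10, [(3, 1), (4, 1), (1, - 1), (2, - 1)]), (1, 11, [(0, 1), (6, 1), (3, - 1), (5, - 1)]), (2, 12,
     [(0, 1), (8, 1), (3, - 1), (7, - 1)]), (3, 13, [(1, 1), (2, 1), (9, 1), (0, - 1), (6, - 1), (8, -
     1)])],
    [(10, 0, [(1, 1), (2, 1), (3, - 1), (4, - 1)]), (1, 14, [(4, 1), (6, 1), (5, - 1), (10, - 1)]), (2, 15,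
     [(4, 1), (8, 1), (7, - 1), (10, - 1)]), (3, 16, [(9, 1), (10, 1), (6, - 1), (8, - 1)])],
    [(0, 14, [(4, 1), (11, 1), (2, - 1), (5, - 1)]), (11, 1, [(3, 1), (5, 1), (0, - 1), (6, - 1)]), (2, 12,
     [(0, 1), (8, 1), (3, - 1), (7, - 1)]), (3, 17, [(2, 1), (9, 1), (8, - 1), (11, - 1)])],
    [(0, 15, [(4, 1), (12, 1), (1, - 1), (7, - 1)]), (1, 11, [(0, 1), (6, 1), (3, - 1), (5, - 1)]), (12, 2,
     [(3, 1), (7, 1), (0, - 1), (8, - 1)]), (3, 18, [(1, 1), (9, 1), (6, - 1), (12, - 1)])],
    [(0, 16, [(4, 1), (9, 1), (13, - 1)]), (1, 17, [(13, 1), (5, - 1), (8, - 1)]), (2, 18, [(13, 1), (6, -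
     1), (7, - 1)]), (13, 3, [(0, 1), (6, 1), (8, 1), (1, - 1), (2, - 1), (9, - 1)])],
    [(10, 11, [(2, 1), (6, 1), (3, - 1), (14, - 1)]), (14, 1, [(5, 1), (10, 1), (4, - 1), (6, - 1)]), (2,
     15, [(4, 1), (8, 1), (7, - 1), (10, - 1)]), (3, 16, [(9, 1), (10, 1), (6, - 1), (8, - 1)])],
    [(10, 12, [(1, 1), (8, 1), (3, - 1), (15, - 1)]), (1, 14, [(4, 1), (6, 1), (5, - 1), (10, - 1)]), (15,
     2, [(7, 1), (10, 1), (4, - 1), (8, - 1)]), (3, 16, [(9, 1), (10, 1), (6, - 1), (8, - 1)])],
    [(10, 13, [(1, 1), (2, 1), (16, 1), (4, - 1), (6, - 1), (8, - 1)]), (1, 14, [(4, 1), (6, 1), (5, - 1),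
     (10, - 1)]), (2, 15, [(4, 1), (8, 1), (7, - 1), (10, - 1)]), (16, 3, [(6, 1), (8, 1), (9, - 1), (10, -
     1)])],
    [(14, 0, [(2, 1), (5, 1), (4, - 1), (11, - 1)]), (11, 10, [(3, 1), (14, 1), (2, - 1), (6, - 1)]), (2,
     19, [(4, 1), (8, 1), (11, 1), (3, - 1), (7, - 1), (14, - 1)]), (3, 17, [(2, 1), (9, 1), (8, - 1), (11,
     - 1)])],
    [(0, 19, [(4, 1), (11, 1), (12, 1), (3, - 1), (5, - 1), (7, - 1)]), (11, 1, [(3, 1), (5, 1), (0, - 1),
     (6, - 1)]), (12, 2, [(3, 1), (7, 1), (0, - 1), (8, - 1)]), (3, 20, [(0, 1), (9, 1), (11, - 1), (12, -
     1)])],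
    [(0, 14, [(4, 1), (11, 1), (2, - 1), (5, - 1)]), (11, 13, [(2, 1), (5, 1), (9, 1), (0, - 1), (6, - 1),
     (17, - 1)]), (2, 20, [(0, 1), (17, 1), (7, - 1), (11, - 1)]), (17, 3, [(8, 1), (11, 1), (2, - 1), (9, -
     1)])],
    [(15, 0, [(1, 1), (7, 1), (4, - 1), (12, - 1)]), (1, 19, [(4, 1), (6, 1), (12, 1), (3, - 1), (5, - 1),
     (15, - 1)]), (12, 10, [(3, 1), (15, 1), (1, - 1), (8, - 1)]), (3, 18, [(1, 1), (9, 1), (6, - 1), (12, -
     1)])],
    [(0, 15, [(4, 1), (12, 1), (1, - 1), (7, - 1)]), (1, 20, [(0, 1), (18, 1), (5, - 1), (12, - 1)]), (12,
     13, [(1, 1), (7, 1), (9, 1), (0, - 1), (8, - 1), (18, - 1)]), (18, 3, [(6, 1), (12, 1), (1, - 1), (9, -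
     1)])],
    [(16, 0, [(13, 1), (4, - 1), (9, - 1)]), (1, 17, [(13, 1), (5, - 1), (8, - 1)]), (2, 18, [(13, 1), (6, -
     1), (7, - 1)]), (13, 10, [(4, 1), (6, 1), (8, 1), (1, - 1), (2, - 1), (16, - 1)])],
    [(0, 16, [(4, 1), (9, 1), (13, - 1)]), (17, 1, [(5, 1), (8, 1), (13, - 1)]), (2, 18, [(13, 1), (6, - 1),
     (7, - 1)]), (13, 11, [(0, 1), (6, 1), (17, 1), (2, - 1), (5, - 1), (9, - 1)])],
    [(0, 16, [(4, 1), (9, 1), (13, - 1)]), (1, 17, [(13, 1), (5, - 1), (8, - 1)]), (18, 2, [(6, 1), (7, 1),
     (13, - 1)]), (13, 12, [(0, 1), (8, 1), (18, 1), (1, - 1), (7, - 1), (9, - 1)])],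
    [(10, 19, [(4, 1), (6, 1), (8, 1), (3, - 1), (14, - 1), (15, - 1)]), (14, 1, [(5, 1), (10, 1), (4, - 1),
     (6, - 1)]), (15, 2, [(7, 1), (10, 1), (4, - 1), (8, - 1)]), (3, 16, [(9, 1), (10, 1), (6, - 1), (8, -
     1)])],
    [(10, 17, [(2, 1), (16, 1), (8, - 1), (14, - 1)]), (14, 1, [(5, 1), (10, 1), (4, - 1), (6, - 1)]), (2,
     15, [(4, 1), (8, 1), (7, - 1), (10, - 1)]), (16, 3, [(6, 1), (8, 1), (9, - 1), (10, - 1)])],
    [(10, 18, [(1, 1), (16, 1), (6, - 1), (15, - 1)]), (1, 14, [(4, 1), (6, 1), (5, - 1), (10, - 1)]), (15,
     2, [(7, 1), (10, 1), (4, - 1), (8, - 1)]), (16, 3, [(6, 1), (8, 1), (9, - 1), (10, - 1)])],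
    [(14, 12, [(5, 1), (8, 1), (19, - 1)]), (11, 15, [(19, 1), (6, - 1), (7, - 1)]), (19, 2, [(3, 1), (7,
     1), (14, 1), (4, - 1), (8, - 1), (11, - 1)]), (3, 21, [(4, 1), (9, 1), (19, - 1)])],
    [(14, 0, [(2, 1), (5, 1), (4, - 1), (11, - 1)]), (11, 16, [(9, 1), (14, 1), (6, - 1), (17, - 1)]), (2,
     21, [(4, 1), (17, 1), (7, - 1), (14, - 1)]), (17, 3, [(8, 1), (11, 1), (2, - 1), (9, - 1)])],
    [(19, 0, [(3, 1), (5, 1), (7, 1), (4, - 1), (11, - 1), (12, - 1)]), (11, 15, [(19, 1), (6, - 1), (7, -
     1)]), (12, 14, [(19, 1), (5, - 1), (8, - 1)]), (3, 21, [(4, 1), (9, 1), (19, - 1)])],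
    [(0, 21, [(4, 1), (20, 1), (5, - 1), (7, - 1)]), (11, 18, [(5, 1), (9, 1), (6, - 1), (20, - 1)]), (12,
     17, [(7, 1), (9, 1), (8, - 1), (20, - 1)]), (20, 3, [(11, 1), (12, 1), (0, - 1), (9, - 1)])],
    [(0, 21, [(4, 1), (20, 1), (5, - 1), (7, - 1)]), (11, 18, [(5, 1), (9, 1), (6, - 1), (20, - 1)]), (20,
     2, [(7, 1), (11, 1), (0, - 1), (17, - 1)]), (17, 12, [(8, 1), (20, 1), (7, - 1), (9, - 1)])],
    [(15, 11, [(6, 1), (7, 1), (19, - 1)]), (19, 1, [(3, 1), (5, 1), (15, 1), (4, - 1), (6, - 1), (12, -
     1)]), (12, 14, [(19, 1), (5, - 1), (8, - 1)]), (3, 21, [(4, 1), (9, 1), (19, - 1)])],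
    [(15, 0, [(1, 1), (7, 1), (4, - 1), (12, - 1)]), (1, 21, [(4, 1), (18, 1), (5, - 1), (15, - 1)]), (12,
     16, [(9, 1), (15, 1), (8, - 1), (18, - 1)]), (18, 3, [(6, 1), (12, 1), (1, - 1), (9, - 1)])],
    [(0, 21, [(4, 1), (20, 1), (5, - 1), (7, - 1)]), (20, 1, [(5, 1), (12, 1), (0, - 1), (18, - 1)]), (12,
     17, [(7, 1), (9, 1), (8, - 1), (20, - 1)]), (18, 11, [(6, 1), (20, 1), (5, - 1), (9, - 1)])],
    [(16, 0, [(13, 1), (4, - 1), (9, - 1)]), (17, 1, [(5, 1), (8, 1), (13, - 1)]), (2, 18, [(13, 1), (6, -
     1), (7, - 1)]), (13, 14, [(4, 1), (6, 1), (17, 1), (2, - 1), (5, - 1), (16, - 1)])],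
    [(16, 0, [(13, 1), (4, - 1), (9, - 1)]), (1, 17, [(13, 1), (5, - 1), (8, - 1)]), (18, 2, [(6, 1), (7,
     1), (13, - 1)]), (13, 15, [(4, 1), (8, 1), (18, 1), (1, - 1), (7, - 1), (16, - 1)])],
    [(0, 16, [(4, 1), (9, 1), (13, - 1)]), (17, 1, [(5, 1), (8, 1), (13, - 1)]), (18, 2, [(6, 1), (7, 1),
     (13, - 1)]), (13, 20, [(0, 1), (17, 1), (18, 1), (5, - 1), (7, - 1), (9, - 1)])],
    [(19, 10, [(3, 1), (14, 1), (15, 1), (4, - 1), (6, - 1), (8, - 1)]), (14, 12, [(5, 1), (8, 1), (19, -
     1)]), (15, 11, [(6, 1), (7, 1), (19, - 1)]), (3, 21, [(4, 1), (9, 1), (19, - 1)])],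
    [(10, 21, [(4, 1), (16, 1), (14, - 1), (15, - 1)]), (14, 1, [(5, 1), (10, 1), (4, - 1), (6, - 1)]), (15,
     2, [(7, 1), (10, 1), (4, - 1), (8, - 1)]), (16, 3, [(6, 1), (8, 1), (9, - 1), (10, - 1)])],
    [(17, 10, [(8, 1), (14, 1), (2, - 1), (16, - 1)]), (14, 13, [(2, 1), (5, 1), (16, 1), (4, - 1), (6, -
     1), (17, - 1)]), (2, 21, [(4, 1), (17, 1), (7, - 1), (14, - 1)]), (16, 11, [(6, 1), (17, 1), (9, - 1),
     (14, - 1)])],
    [(18, 10, [(6, 1), (15, 1), (1, - 1), (16, - 1)]), (1, 21, [(4, 1), (18, 1), (5, - 1), (15, - 1)]), (15,
     13, [(1, 1), (7, 1), (16, 1), (4, - 1), (8, - 1), (18, - 1)]), (16, 12, [(8, 1), (18, 1), (9, - 1),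
     (15, - 1)])],
    [(14, 12, [(5, 1), (8, 1), (19, - 1)]), (11, 15, [(19, 1), (6, - 1), (7, - 1)]), (19, 17, [(7, 1), (9,
     1), (14, 1), (8, - 1), (11, - 1), (21, - 1)]), (21, 3, [(19, 1), (4, - 1), (9, - 1)])],
    [(14, 20, [(5, 1), (17, 1), (11, - 1), (21, - 1)]), (11, 16, [(9, 1), (14, 1), (6, - 1), (17, - 1)]),
     (21, 2, [(7, 1), (14, 1), (4, - 1), (17, - 1)]), (17, 19, [(8, 1), (11, 1), (21, 1), (7, - 1), (9, -
     1), (14, - 1)])],
    [(19, 20, [(5, 1), (7, 1), (9, 1), (11, - 1), (12, - 1), (21, - 1)]), (11, 15, [(19, 1), (6, - 1), (7, -
     1)]), (12, 14, [(19, 1), (5, - 1), (8, - 1)]), (21, 3, [(19, 1), (4, - 1), (9, - 1)])],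
    [(21, 0, [(5, 1), (7, 1), (4, - 1), (20, - 1)]), (11, 18, [(5, 1), (9, 1), (6, - 1), (20, - 1)]), (12,
     17, [(7, 1), (9, 1), (8, - 1), (20, - 1)]), (20, 19, [(11, 1), (12, 1), (21, 1), (5, - 1), (7, - 1),
     (9, - 1)])],
    [(21, 0, [(5, 1), (7, 1), (4, - 1), (20, - 1)]), (11, 18, [(5, 1), (9, 1), (6, - 1), (20, - 1)]), (20,
     14, [(11, 1), (21, 1), (5, - 1), (17, - 1)]), (17, 12, [(8, 1), (20, 1), (7, - 1), (9, - 1)])],
    [(0, 21, [(4, 1), (20, 1), (5, - 1), (7, - 1)]), (18, 11, [(6, 1), (20, 1), (5, - 1), (9, - 1)]), (20,
     13, [(5, 1), (7, 1), (9, 1), (0, - 1), (17, - 1), (18, - 1)]), (17, 12, [(8, 1), (20, 1), (7, - 1), (9,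
     - 1)])],
    [(15, 11, [(6, 1), (7, 1), (19, - 1)]), (19, 18, [(5, 1), (9, 1), (15, 1), (6, - 1), (12, - 1), (21, -
     1)]), (12, 14, [(19, 1), (5, - 1), (8, - 1)]), (21, 3, [(19, 1), (4, - 1), (9, - 1)])],
    [(15, 20, [(7, 1), (18, 1), (12, - 1), (21, - 1)]), (21, 1, [(5, 1), (15, 1), (4, - 1), (18, - 1)]),
     (12, 16, [(9, 1), (15, 1), (8, - 1), (18, - 1)]), (18, 19, [(6, 1), (12, 1), (21, 1), (5, - 1), (9, -
     1), (15, - 1)])],
    [(21, 0, [(5, 1), (7, 1), (4, - 1), (20, - 1)]), (20, 15, [(12, 1), (21, 1), (7, - 1), (18, - 1)]), (12,
     17, [(7, 1), (9, 1), (8, - 1), (20, - 1)]), (18, 11, [(6, 1), (20, 1), (5, - 1), (9, - 1)])],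
    [(16, 0, [(13, 1), (4, - 1), (9, - 1)]), (17, 1, [(5, 1), (8, 1), (13, - 1)]), (18, 2, [(6, 1), (7, 1),
     (13, - 1)]), (13, 21, [(4, 1), (17, 1), (18, 1), (5, - 1), (7, - 1), (16, - 1)])],
    [(19, 16, [(9, 1), (14, 1), (15, 1), (6, - 1), (8, - 1), (21, - 1)]), (14, 12, [(5, 1), (8, 1), (19, -
     1)]), (15, 11, [(6, 1), (7, 1), (19, - 1)]), (21, 3, [(19, 1), (4, - 1), (9, - 1)])],
    [(21, 10, [(14, 1), (15, 1), (4, - 1), (16, - 1)]), (14, 18, [(5, 1), (16, 1), (6, - 1), (21, - 1)]),
     (15, 17, [(7, 1), (16, 1), (8, - 1), (21, - 1)]), (16, 19, [(6, 1), (8, 1), (21, 1), (9, - 1), (14, -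
     1), (15, - 1)])],
    [(17, 15, [(8, 1), (21, 1), (7, - 1), (16, - 1)]), (14, 18, [(5, 1), (16, 1), (6, - 1), (21, - 1)]),
     (21, 2, [(7, 1), (14, 1), (4, - 1), (17, - 1)]), (16, 11, [(6, 1), (17, 1), (9, - 1), (14, - 1)])],
    [(18, 14, [(6, 1), (21, 1), (5, - 1), (16, - 1)]), (21, 1, [(5, 1), (15, 1), (4, - 1), (18, - 1)]), (15,
     17, [(7, 1), (16, 1), (8, - 1), (21, - 1)]), (16, 12, [(8, 1), (18, 1), (9, - 1), (15, - 1)])],
    [(21, 0, [(5, 1), (7, 1), (4, - 1), (20, - 1)]), (18, 11, [(6, 1), (20, 1), (5, - 1), (9, - 1)]), (20,
     16, [(9, 1), (21, 1), (17, - 1), (18, - 1)]), (17, 12, [(8, 1), (20, 1), (7, - 1), (9, - 1)])],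
    [(16, 20, [(17, 1), (18, 1), (9, - 1), (21, - 1)]), (17, 15, [(8, 1), (21, 1), (7, - 1), (16, - 1)]),
     (18, 14, [(6, 1), (21, 1), (5, - 1), (16, - 1)]), (21, 13, [(5, 1), (7, 1), (16, 1), (4, - 1), (17, -
     1), (18, - 1)])]]"

definition frozen :: "int list" where
  "frozen = [4, 5, 6, 7, 8, 9]"

definition variables :: "cluster \<Rightarrow> int list" where
  "variables E = map fst E @ frozen"

fun entry :: "(int \<times> int) list \<Rightarrow> int \<Rightarrow> int" where
  "entry [] x = 0"
| "entry ((y, b) # ps) x = (if y = x then b else entry ps x)"

fun column :: "cluster \<Rightarrow> int \<Rightarrow> (int \<times> int) list" where
  "column [] z = []"
| "column ((w, w', col) # E) z = (if w = z then col else column E z)"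

definition exchange :: "cluster \<Rightarrow> int \<Rightarrow> int \<Rightarrow> int" where
  "exchange E x z = entry (column E z) x"

definition signed_part :: "int \<Rightarrow> (int \<times> int) list \<Rightarrow> int list" where
  "signed_part s col = map fst (filter (\<lambda>(x, b). b = s) col)"

text \<open>The exponent of \<open>h\<close> by which a product taken in list order differs from the
  normalised monomial.\<close>

fun pair_sum :: "('b \<Rightarrow> 'b \<Rightarrow> int) \<Rightarrow> 'b list \<Rightarrow> int" where
  "pair_sum L [] = 0"
| "pair_sum L (p # ps) = sum_list (map (L p) ps) + pair_sum L ps"

fun laurent_product :: "int list \<Rightarrow> (int \<times> int list) list" where
  "laurent_product [] = [(1, [0, 0, 0, 0, 0, 0, 0, 0, 0, 0, 0])]"
| "laurent_product (x # xs) = torus_mult initial_form (laurent_keys x) (laurent_product xs)"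

text \<open>The shift is the power of \<open>h\<close> that remains when a normalised exchange
  monomial is multiplied by the exchanged variable from the left; \<open>NM_exchange_term\<close>
  explains it.\<close>

definition exchange_relation :: "int \<Rightarrow> int \<Rightarrow> (int \<times> int) list \<Rightarrow>
     (int \<times> int list) list" where
  "exchange_relation z z' col =
     torus_mult initial_form (laurent_keys z) (laurent_keys z') @
     concat (map (\<lambda>s. let ps = signed_part s col in
       torus_shift (- 1) (sum_list (map (quasi z) ps) - pair_sum quasi ps) (laurent_product ps)) [1, - 1])"

definition valid_cluster :: "cluster \<Rightarrow> bool" where
  "valid_cluster E \<longleftrightarrow> length E = 4 \<and> distinct (variables E) \<and>
     list_all (\<lambda>x. 0 \<le> x \<and> x < 22) (variables E) \<and>
     list_all (\<lambda>x. list_all (\<lambda>z. quasi x z \<noteq> 99) (variables E)) (variables E) \<and>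
     list_all (\<lambda>(z, z', col). 0 \<le> z' \<and> z' < 22 \<and> distinct (map fst col) \<and>
       list_all (\<lambda>(x, b). x \<in> set (variables E) \<and> x \<noteq> z \<and> (b = 1 \<or> b = -
     1)) col \<and>
       collect (exchange_relation z z' col) = []) E"

text \<open>Clusters are matched by their variables and not by positions. \<open>o_w\<close> and
  \<open>o_x\<close> are the names before the mutation, which differ from the new ones only at
  \<open>z'\<close>.\<close>

definition mutated_cluster :: "cluster \<Rightarrow> int \<Rightarrow> int \<Rightarrow> cluster
     \<Rightarrow> bool" where
  "mutated_cluster E z z' E' \<longleftrightarrow>
     z' \<in> set (map fst E') \<and> list_all (\<lambda>w. w = z \<or> w \<in> set (map fst E')) (map fst
     E) \<and>
     list_all (\<lambda>x. quasi x z' = - quasi x z + sum_list (map (quasi x) (signed_part 1 (column E z)))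
     \<and>
       quasi z' x = - quasi x z') (filter (\<lambda>x. x \<noteq> z) (variables E)) \<and> quasi z' z' = 0
     \<and>
     list_all (\<lambda>w. let o_w = (if w = z' then z else w) in
       list_all (\<lambda>x. let o_x = (if x = z' then z else x) in
         exchange E' x w =
           (if o_x = z \<or> o_w = z then - exchange E o_x o_w
            else exchange E o_x o_w +
              (\<bar>exchange E o_x z\<bar> * exchange E z o_w + exchange E o_x z * \<bar>exchange E z
     o_w\<bar>) div 2))
       (variables E')) (map fst E')"

text \<open>\<open>walk E p\<close> checks that \<open>p\<close> is a sequence of mutations, given by the
     exchanged variables,
  starting in \<open>E\<close>.\<close>

fun walk :: "cluster \<Rightarrow> (int \<times> int) list \<Rightarrow> bool" where
  "walk E [] = True"
| "walk E ((z, z') # p) = ((z, z') \<in> set (map (\<lambda>(z, z', col). (z, z')) E) \<and>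
     (case filter (mutated_cluster E z z') clusters of [E'] \<Rightarrow> walk E' p | _ \<Rightarrow> False))"

text \<open>Twelve mutations, each of which creates a different one of the twelve variables outside
  the initial cluster.\<close>

definition mutation_walk :: "(int \<times> int) list" where
  "mutation_walk = [(0, 10), (1, 14), (10, 11), (2, 19), (11, 15), (14, 12), (3, 21), (19, 18), (15, 20),
     (12, 17), (20, 16), (21, 13)]"

text \<open>Generators of the Grassmannian in the lexicographic order of their index sets.\<close>

definition lex_variables :: "int list" where
  "lex_variables = [4, 0, 1, 5, 2, 10, 14, 3, 11, 6, 7, 15, 21, 12, 20, 18, 8, 17, 16, 9]"

text \<open>An entry \<open>(i, j, e, ts)\<close> is the relation \<open>u\<^sub>i u\<^sub>j = h\<^sup>e
     u\<^sub>j u\<^sub>i + \<Sum>(c, f, s, t). c h\<^sup>f u\<^sub>s u\<^sub>t\<close>.\<close>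

definition straightening :: "(int \<times> int \<times> int \<times> (int \<times> int \<times> int \<times>
     int) list) list" where
  "straightening =
   [(1, 0, - 2, []), (2, 0, - 2, []), (2, 1, - 2, []), (3, 0, - 2, []), (3, 1, - 2, []), (3, 2, - 2, []),
     (4, 0, - 2, []), (4, 1, - 2, []), (4, 2, 0, []), (4, 3, 0, []), (5, 0, - 2, []), (5, 1, 0, [(1, - 2, 2,
     4), (- 1, 2, 2, 4)]), (5, 2, - 2, []), (5, 3, 0, []), (5, 4, - 2, []), (6, 0, - 2, []), (6, 1, 0, [(1,
     - 2, 3, 4), (- 1, 2, 3, 4)]), (6, 2, 0, [(1, - 2, 3, 5), (- 1, 2, 3, 5)]), (6, 3, - 2, []), (6, 4, - 2,
     []), (6, 5, - 2, []), (7, 0, - 4, []), (7, 1, - 2, []), (7, 2, - 2, []), (7, 3, 0, []), (7, 4, - 2,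
     []), (7, 5, - 2, []), (7, 6, 0, []), (8, 0, - 4, []), (8, 1, - 2, []), (8, 2, 0, [(1, - 2, 3, 7), (- 1,
     2, 3, 7)]), (8, 3, - 2, []), (8, 4, - 2, []), (8, 5, 0, [(1, - 2, 6, 7), (- 1, 2, 6, 7)]), (8, 6, - 2,
     []), (8, 7, - 2, []), (9, 0, - 4, []), (9, 1, - 4, []), (9, 2, - 2, []), (9, 3, - 2, []), (9, 4, - 4,
     []), (9, 5, - 2, []), (9, 6, - 2, []), (9, 7, - 2, []), (9, 8, - 2, []), (10, 0, - 2, []), (10, 1, - 2,
     []), (10, 2, 0, []), (10, 3, 0, []), (10, 4, - 2, []), (10, 5, 0, []), (10, 6, 0, []), (10, 7, 0, []),
     (10, 8, 0, []), (10, 9, 2, []), (11, 0, - 2, []), (11, 1, 0, [(1, - 2, 2, 10), (- 1, 2, 2, 10)]), (11,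
     2, - 2, []), (11, 3, 0, []), (11, 4, 0, [(1, - 2, 5, 10), (- 1, 2, 5, 10)]), (11, 5, - 2, []), (11, 6,
     0, []), (11, 7, 0, []), (11, 8, 2, [(1, 0, 9, 10), (- 1, 4, 9, 10)]), (11, 9, 0, []), (11, 10, - 2,
     []), (12, 0, - 2, []), (12, 1, 0, [(1, - 2, 3, 10), (- 1, 2, 3, 10)]), (12, 2, 0, [(1, - 2, 3, 11), (-
     1, 2, 3, 11)]), (12, 3, - 2, []), (12, 4, 0, [(1, - 2, 6, 10), (- 1, 2, 6, 10)]), (12, 5, 0, [(1, - 2,
     6, 11), (- 1, 2, 6, 11)]), (12, 6, - 2, []), (12, 7, 2, [(1, 0, 8, 11), (- 1, 4, 8, 11), (- 1, 2, 9,
     10), (1, 6, 9, 10)]), (12, 8, 0, []), (12, 9, 0, []), (12, 10, - 2, []), (12, 11, - 2, []), (13, 0, -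
     4, []), (13, 1, - 2, []), (13, 2, - 2, []), (13, 3, 0, []), (13, 4, 0, [(1, - 2, 7, 10), (- 1, 2, 7,
     10)]), (13, 5, 0, [(1, - 2, 7, 11), (- 1, 2, 7, 11)]), (13, 6, 2, [(1, 0, 8, 11), (- 1, 4, 8, 11), (-
     1, 2, 9, 10), (1, 6, 9, 10)]), (13, 7, - 2, []), (13, 8, 0, []), (13, 9, 0, []), (13, 10, - 2, []),
     (13, 11, - 2, []), (13, 12, 0, []), (14, 0, - 4, []), (14, 1, - 2, []), (14, 2, 0, [(1, - 2, 3, 13), (-
     1, 2, 3, 13)]), (14, 3, - 2, []), (14, 4, 0, [(1, - 2, 8, 10), (- 1, 2, 8, 10)]), (14, 5, 2, [(1, 0, 7,
     12), (- 1, 4, 7, 12), (1, - 2, 8, 11), (- 2, 2, 8, 11), (1, 6, 8, 11), (1, 0, 6, 13), (- 1, 4, 6, 13),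
     (1, 4, 9, 10), (- 1, 8, 9, 10)]), (14, 6, 0, [(1, - 2, 8, 12), (- 1, 2, 8, 12)]), (14, 7, 0, [(1, - 2,
     8, 13), (- 1, 2, 8, 13)]), (14, 8, - 2, []), (14, 9, 0, []), (14, 10, - 2, []), (14, 11, 0, [(1, - 2,
     12, 13), (- 1, 2, 12, 13)]), (14, 12, - 2, []), (14, 13, - 2, []), (15, 0, - 4, []), (15, 1, - 4, []),
     (15, 2, - 2, []), (15, 3, - 2, []), (15, 4, - 2, [(1, - 2, 9, 10), (- 1, 2, 9, 10)]), (15, 5, 0, [(1, -
     2, 9, 11), (- 1, 2, 9, 11)]), (15, 6, 0, [(1, - 2, 9, 12), (- 1, 2, 9, 12)]), (15, 7, 0, [(1, - 2, 9,
     13), (- 1, 2, 9, 13)]), (15, 8, 0, [(1, - 2, 9, 14), (- 1, 2, 9, 14)]), (15, 9, - 2, []), (15, 10, - 4,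
     []), (15, 11, - 2, []), (15, 12, - 2, []), (15, 13, - 2, []), (15, 14, - 2, []), (16, 0, - 4, []), (16,
     1, - 4, []), (16, 2, - 4, []), (16, 3, - 2, []), (16, 4, - 2, []), (16, 5, - 2, []), (16, 6, 0, []),
     (16, 7, - 2, []), (16, 8, 0, []), (16, 9, 0, []), (16, 10, - 2, []), (16, 11, - 2, []), (16, 12, 0,
     []), (16, 13, - 2, []), (16, 14, 0, []), (16, 15, 0, []), (17, 0, - 4, []), (17, 1, - 4, []), (17, 2, -
     2, [(1, - 4, 3, 16), (- 1, 0, 3, 16)]), (17, 3, - 4, []), (17, 4, - 2, []), (17, 5, 0, [(1, - 2, 6,
     16), (- 1, 2, 6, 16)]), (17, 6, - 2, []), (17, 7, 0, [(1, - 2, 8, 16), (- 1, 2, 8, 16)]), (17, 8, - 2,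
     []), (17, 9, 0, []), (17, 10, - 2, []), (17, 11, 0, [(1, - 2, 12, 16), (- 1, 2, 12, 16)]), (17, 12, -
     2, []), (17, 13, 0, [(1, - 2, 14, 16), (- 1, 2, 14, 16)]), (17, 14, - 2, []), (17, 15, 0, []), (17, 16,
     - 2, []), (18, 0, - 4, []), (18, 1, - 2, [(- 1, - 2, 3, 16), (1, 2, 3, 16), (1, - 4, 2, 17), (- 1, 0,
     2, 17)]), (18, 2, - 4, []), (18, 3, - 4, []), (18, 4, - 4, []), (18, 5, - 2, []), (18, 6, - 2, []),
     (18, 7, 0, [(1, - 2, 9, 16), (- 1, 2, 9, 16)]), (18, 8, 0, [(1, - 2, 9, 17), (- 1, 2, 9, 17)]), (18, 9,
     - 2, []), (18, 10, - 4, []), (18, 11, - 2, []), (18, 12, - 2, []), (18, 13, 0, [(1, - 2, 15, 16), (- 1,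
     2, 15, 16)]), (18, 14, 0, [(1, - 2, 15, 17), (- 1, 2, 15, 17)]), (18, 15, - 2, []), (18, 16, - 2, []),
     (18, 17, - 2, []), (19, 0, - 6, []), (19, 1, - 4, []), (19, 2, - 4, []), (19, 3, - 4, []), (19, 4, - 4,
     []), (19, 5, - 4, []), (19, 6, - 4, []), (19, 7, - 2, []), (19, 8, - 2, []), (19, 9, - 2, []), (19, 10,
     - 4, []), (19, 11, - 4, []), (19, 12, - 4, []), (19, 13, - 2, []), (19, 14, - 2, []), (19, 15, - 2,
     []), (19, 16, - 2, []), (19, 17, - 2, []), (19, 18, - 2, [])]"

text \<open>The subscripts are places in the lexicographic list of minors, not numbers of cluster
  variables.\<close>

definition straightening_relation :: "int \<times> int \<times> int \<times> (int \<times> int \<times> int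
     \<times> int) list \<Rightarrow> (int \<times> int list) list" where
  "straightening_relation = (\<lambda>(i, j, e, ts).
     let m = (\<lambda>s t. torus_mult initial_form (laurent_keys (nth_int lex_variables s)) (laurent_keys
     (nth_int lex_variables t)))
     in m i j @ torus_shift (- 1) e (m j i) @ concat (map (\<lambda>(c, f, s, t). torus_shift (- c) f (m s
     t)) ts))"

text \<open>For \<open>j < i\<close> this is the multiset order on pairs: either both letters are
  below \<open>i\<close>, or one is \<open>i\<close> and the other is below
  \<open>j\<close>.\<close>

fun lower_pair :: "int \<Rightarrow> int \<Rightarrow> int \<Rightarrow> int \<Rightarrow> bool" where
  "lower_pair i j s t \<longleftrightarrow> 0 \<le> s \<and> 0 \<le> t \<and> s < i \<and> t < i \<or> s = i
     \<and> 0 \<le> t \<and> t < j \<or> t = i \<and> 0 \<le> s \<and> s < j"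

section \<open>Verification of the finite data by evaluation\<close>

lemma laurent_keys_length: "list_all (\<lambda>x. list_all (\<lambda>(c, k). length k = 11) (laurent_keys
     x)) [0..21]"
  by code_simp

lemma laurent_distinct: "list_all (\<lambda>as. distinct as \<and> as \<noteq> []) laurent_table"
  by code_simp

lemma laurent_relations_check: "list_all (\<lambda>r. collect (laurent_relation r) = []) plucker_relations"
  by code_simp

lemma quasi_check:
  "list_all (\<lambda>x. list_all (\<lambda>z. quasi x z = 99 \<or> quasi z x = - quasi x z \<and>
     collect (torus_mult initial_form (laurent_keys x) (laurent_keys z) @
       torus_shift (- 1) (2 * quasi x z) (torus_mult initial_form (laurent_keys z) (laurent_keys x))) = [])
     [0..21]) [0..21]"
  by code_simp

lemma straightening_check:
  "list_all (\<lambda>r. collect (straightening_relation r) = [] \<and>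
     (case r of (i, j, e, ts) \<Rightarrow> 0 \<le> j \<and> j < i \<and> i < 20 \<and> list_all
     (\<lambda>(c, f, s, t). lower_pair i j s t) ts)) straightening"
  by code_simp

lemma straightening_complete:
  "list_all (\<lambda>i. list_all (\<lambda>j. (i, j) \<in> set (map (\<lambda>(i, j, e, ts). (i, j))
     straightening)) [0..i - 1]) [0..19]"
  by code_simp

lemma clusters_valid: "list_all valid_cluster clusters"
  by code_simp

lemma clusters_mutated:
  "list_all (\<lambda>E. list_all (\<lambda>(z, z', col). list_ex (mutated_cluster E z z') clusters) E)
     clusters"
  by code_simp

lemma mutation_walk_check: "walk (hd clusters) mutation_walk"
  by code_simp

text \<open>Up to powers of \<open>h\<close>, variable 13 is the product of the minors 124 and 356,
  and variable 19 that of 145 and 236, each corrected by the product of 123 and 456. This is why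
  both lie in the Grassmannian.\<close>

lemma quadratic_variables_check:
  "collect (torus_mult initial_form (laurent_keys 0) (laurent_keys 16) @ torus_shift (- 1) 3 (laurent_keys 13) @
     torus_shift (- 1) (- 2) (torus_mult initial_form (laurent_keys 4) (laurent_keys 9))) = []"
  "collect (torus_mult initial_form (laurent_keys 3) (laurent_keys 21) @ torus_shift (- 1) 1 (laurent_keys 19) @
     torus_shift (- 1) (- 4) (torus_mult initial_form (laurent_keys 4) (laurent_keys 9))) = []"
  by code_simp+

lemma quasi_relations_check: "list_all (\<lambda>p. minor_relation (quasi_relation p)) initial_pairs"
  by code_simp

lemma plucker_relations_check: "list_all (\<lambda>r. minor_relation (plucker_relation r)) plucker_relations"
  by code_simp

section \<open>Quasi-commutation and linear independence of the initial Laurent monomials\<close>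

section \<open>The initial cluster\<close>

lemma dot_eq_sum: "length a = length b \<Longrightarrow> dot a b = (\<Sum>i<length a. a ! i * b ! i)"
proof (induction a b rule: list_induct2)
  case (Cons x xs y ys)
  then show ?case by (simp add: sum.lessThan_Suc_shift del: sum.lessThan_Suc)
qed simp

lemma form_eq_sum:
  assumes "length a = n" "length b = n" "length \<Omega> = n" "\<And>i. i < n \<Longrightarrow> length (\<Omega> ! i) = n"
  shows "form \<Omega> a b = (\<Sum>i<n. \<Sum>j<n. a ! i * b ! j * \<Omega> ! i ! j)"
proof -
  have "form \<Omega> a b = (\<Sum>i<n. a ! i * dot b (\<Omega> ! i))"
    using assms by (simp add: form_def dot_eq_sum)
  also have "\<dots> = (\<Sum>i<n. \<Sum>j<n. a ! i * b ! j * \<Omega> ! i ! j)"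
    using assms by (intro sum.cong refl) (simp add: dot_eq_sum sum_distrib_left mult.assoc)
  finally show ?thesis .
qed

lemma nth_vec_add: "i < length a \<Longrightarrow> i < length b \<Longrightarrow> vec_add a b ! i = a ! i + b ! i"
proof (induction a b arbitrary: i rule: vec_add.induct)
  case (1 x xs y ys)
  then show ?case by (cases i) auto
qed auto

lemma (in quasi_commuting) quantum_torus_NM:
  assumes "length \<Omega> = r" "\<And>i. i < r \<Longrightarrow> length (\<Omega> ! i) = r" "\<And>i j. i < r \<Longrightarrow> j < r \<Longrightarrow> \<Omega> ! i ! j = L i j"
  shows "quantum_torus \<kappa> h r \<Omega> (\<lambda>a. NM (\<lambda>i. a ! i))"
proof
  fix a b :: "int list" assume len: "length a = r" "length b = r"
  have "NM (\<lambda>i. a ! i) * NM (\<lambda>i. b ! i) = hp (\<Sum>i<r. \<Sum>j<r. a ! i * b ! j * L i j) * NM (\<lambda>i. a ! i + b ! i)"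
    by (rule NM_mult)
  also have "(\<Sum>i<r. \<Sum>j<r. a ! i * b ! j * L i j) = form \<Omega> a b"
    using assms len by (subst form_eq_sum) auto
  also have "NM (\<lambda>i. a ! i + b ! i) = NM (\<lambda>i. vec_add a b ! i)"
    using len by (intro NM_cong) (simp add: nth_vec_add)
  finally show "NM (\<lambda>i. a ! i) * NM (\<lambda>i. b ! i) = hp (form \<Omega> a b) * NM (\<lambda>i. vec_add a b ! i)" .
qed

lemma rep_form_check:
  "list_all (\<lambda>i. list_all (\<lambda>j.
     nth_int (nth_int rep_form i) j = - nth_int (nth_int rep_form j) i \<and>
     nth_int (nth_int rep_form i) j = quasi i j) [0..9]) [0..9]"
  by code_simp

lemma initial_pairs_check:
  "list_all (\<lambda>j. list_all (\<lambda>i. (i, j) \<in> set initial_pairs) [0..j - 1]) [0..9]"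
  by code_simp

lemma nth_int_eq: "i < length xs \<Longrightarrow> nth_int xs (int i) = xs ! i"
proof (induction xs arbitrary: i)
  case (Cons x xs)
  then show ?case by (cases i) auto
qed simp

context grassmannian_fractions
begin

definition init_var :: "nat \<Rightarrow> 'f" where
  "init_var i = Pl (nth_int initial_indices (int i))"

definition init_L :: "nat \<Rightarrow> nat \<Rightarrow> int" where
  "init_L i j = initial_form ! i ! j"

lemma init_L_eq: "i < 10 \<Longrightarrow> j < 10 \<Longrightarrow> nth_int (nth_int rep_form (int i)) (int j) = init_L i j"
proof -
  have "\<forall>i\<in>{..<10}. \<forall>j\<in>{..<10}. nth_int (nth_int rep_form (int i)) (int j) = initial_form ! i ! j"
    by (simp add: lessThan_Suc eval_nat_numeral One_nat_def initial_form_def rep_form_def)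
  then show "i < 10 \<Longrightarrow> j < 10 \<Longrightarrow> nth_int (nth_int rep_form (int i)) (int j) = init_L i j"
    by (simp add: init_L_def)
qed

lemma init_L_table:
  assumes "i < 10" "j < 10"
  shows "init_L i j = - init_L j i" "init_L i j = quasi (int i) (int j)"
proof -
  have "int i \<in> set [0..9]" "int j \<in> set [0..9]" using assms by auto
  then have "nth_int (nth_int rep_form (int i)) (int j) = - nth_int (nth_int rep_form (int j)) (int i) \<and>
      nth_int (nth_int rep_form (int i)) (int j) = quasi (int i) (int j)"
    using rep_form_check unfolding list_all_iff by blast
  then show "init_L i j = - init_L j i" "init_L i j = quasi (int i) (int j)"
    using init_L_eq assms by simp_all
qed

lemmas init_L_skew = init_L_table(1)

text \<open>If the minor vanished, its polynomial would lie in the ideal and act as zero, but it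
  acts as a single shift.\<close>

lemma init_var_nonzero:
  assumes "i < 10"
  shows "init_var i \<noteq> 0"
proof
  assume "init_var i = 0"
  then have "minor_poly (nth_int initial_indices (int i)) \<in> J"
    using plucker_lifts[OF initial_minor(1)[OF assms]] by (simp add: init_var_def Pl_def \<theta>_eq_0_iff)
  then have "(\<Sum>a\<in>{unit_vec (int i)}. scalar_endo 1 * shift_endo h rep_form a) = 0"
    using rep_ideal initial_minor(2)[OF assms] by simp
  then have "(\<lambda>_. 1 :: 'k) (unit_vec (int i)) = 0"
    by (intro shift_endo_independent[where c = "\<lambda>_. 1" and n = 12 and S = "{unit_vec (int i)}", OF S.h_nonzero])
       (auto simp: unit_vec_def)
  then show False by simp
qed

lemma init_var_commute:
  assumes "i < 10" "j < 10"
  shows "init_var i * init_var j = S.hp (2 * init_L i j) * init_var j * init_var i"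
proof -
  have less: "init_var i * init_var j = S.hp (2 * init_L i j) * init_var j * init_var i"
    if "i < j" "j < 10" for i j
  proof -
    have "i < 10" using that by simp
    have "int j \<in> set [0..9]" "int i \<in> set [0..int j - 1]" using that by auto
    then have "(int i, int j) \<in> set initial_pairs"
      using initial_pairs_check unfolding list_all_iff by blast
    then have "minor_relation (quasi_relation (int i, int j))"
      using quasi_relations_check unfolding list_all_iff by blast
    moreover have "plucker_index (nth_int initial_indices (int i))" "plucker_index (nth_int initial_indices (int j))"
      using initial_minor(1) that by simp_all
    ultimately have "sum_list (map (\<lambda>(c, e, I, K). of_int c * (S.hp (2 * e) * (Pl I * Pl K))) (quasi_relation (int i, int j))) = 0"
      by (intro minor_relation_Pl) (auto simp: quasi_relation_def)
    then show ?thesis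
      using init_L_eq[OF \<open>i < 10\<close> that(2)] by (simp add: quasi_relation_def init_var_def mult.assoc)
  qed
  consider "i < j" | "i = j" | "j < i" by linarith
  then show ?thesis
  proof cases
    case 1
    then show ?thesis using less assms by simp
  next
    case 2
    then show ?thesis using init_L_skew[OF assms] by simp
  next
    case 3
    then have "S.hp (2 * init_L i j) * (init_var j * init_var i) =
        S.hp (2 * init_L i j) * (S.hp (2 * init_L j i) * (init_var i * init_var j))"
      using less[OF 3 assms(1)] by (simp add: mult.assoc)
    then show ?thesis
      using init_L_skew[OF assms] by (simp add: S.hp_mult_left mult.assoc)
  qed
qed

sublocale Y: quasi_commuting \<kappa> h 10 init_var init_L
proof
  fix i j :: nat
  show "i < 10 \<Longrightarrow> init_var i \<noteq> 0" by (rule init_var_nonzero)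
  assume "i < 10" "j < 10"
  then show "init_L i j = - init_L j i" by (rule init_L_skew)
  show "init_var i * init_var j = \<kappa> ((h\<^sup>2) powi init_L i j) * init_var j * init_var i"
    using init_var_commute[OF \<open>i < 10\<close> \<open>j < 10\<close>] by (simp add: S.hp_def power_int_mult)
qed

definition Mon :: "int list \<Rightarrow> 'f" where
  "Mon a = Y.NM (\<lambda>i. a ! i)"

sublocale F: quantum_torus \<kappa> h 10 initial_form Mon
proof -
  have "length initial_form = 10" "\<forall>r\<in>set initial_form. length r = 10"
    by (simp_all add: initial_form_def rep_form_def)
  then show "quantum_torus \<kappa> h 10 initial_form Mon"
    unfolding Mon_def[abs_def] by (intro Y.quantum_torus_NM) (simp_all add: init_L_def)
qed

text \<open>Linear independence of the Laurent monomials: after multiplication with a common monomial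
  all exponents are nonnegative, so the relation lifts to quantum matrices, where it is
  refuted by the representation.\<close>

definition mon_poly :: "nat \<Rightarrow> (nat \<Rightarrow> int) \<Rightarrow> 'k qpoly" where
  "mon_poly s b = prod_list (map (\<lambda>i. minor_poly (nth_int initial_indices (int i)) ^ nat (b i)) [0..<s])"

lemma mon_poly_theta:
  assumes "\<And>i. 0 \<le> b i" "s \<le> 10"
  shows "mon_poly s b \<in> lifts \<and> \<theta> (mon_poly s b) = laurent_monomial s init_var b"
  using assms(2)
proof (induction s)
  case 0
  then show ?case using \<theta>_simps(3) lifts_closed(2) by (simp add: mon_poly_def laurent_monomial_def)
next
  case (Suc s)
  let ?p = "minor_poly (nth_int initial_indices (int s))"
  have p: "?p \<in> lifts" using Suc.prems by (intro plucker_lifts initial_minor) simp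
  have pow: "?p ^ m \<in> lifts \<and> \<theta> (?p ^ m) = init_var s ^ m" for m
  proof (induction m)
    case 0
    then show ?case using \<theta>_simps(3) lifts_closed(2) by simp
  next
    case (Suc m)
    then show ?case using p by (auto simp: \<theta>_simps(2) init_var_def Pl_def)
  qed
  have "init_var s ^ nat (b s) = init_var s powi b s"
    using assms(1)[of s] by (simp add: power_int_def)
  then show ?case
    using Suc pow[of "nat (b s)"] by (auto simp: mon_poly_def laurent_monomial_def \<theta>_simps(2))
qed

definition shift_fun :: "(nat \<Rightarrow> int) \<Rightarrow> 'k endo" where
  "shift_fun f = shift_endo h rep_form (map f [0..<12])"

lemma vec_add_map: "vec_add (map f xs) (map g xs) = map (\<lambda>x. f x + g x) xs"
  by (induction xs) auto

lemma shift_fun_mult: "\<exists>t. shift_fun f * shift_fun g = T.hp t * shift_fun (\<lambda>j. f j + g j)"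
  using T.M_mult[of "map f [0..<12]" "map g [0..<12]"] unfolding shift_fun_def vec_add_map by auto

lemma unit_vec_eq: "unit_vec (int s) = map (\<lambda>j. if j = s then 1 else 0) [0..<12]"
proof -
  have "[0, 1, 2, 3, 4, 5, 6, 7, 8, 9, 10, 11] = map int [0..<12]"
    by (simp add: upt_rec)
  then show ?thesis
    unfolding unit_vec_def by (simp only: map_map comp_def of_nat_eq_iff)
qed

lemma shift_fun_power:
  "\<exists>t. shift_fun f * shift_endo h rep_form (unit_vec (int s)) ^ m =
    T.hp t * shift_fun (\<lambda>j. f j + (if j = s then int m else 0))"
proof (induction m)
  case 0
  have "(\<lambda>j. f j + (if j = s then int 0 else 0)) = f" by auto
  then show ?case by (intro exI[of _ 0]) (simp only: power_0 T.hp_0 mult_1 mult_1_right)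
next
  case (Suc m)
  let ?u = "shift_endo h rep_form (unit_vec (int s))"
  have u: "?u = shift_fun (\<lambda>j. if j = s then 1 else 0)"
    by (simp add: shift_fun_def unit_vec_eq)
  obtain t where t: "shift_fun f * ?u ^ m = T.hp t * shift_fun (\<lambda>j. f j + (if j = s then int m else 0))"
    using Suc by blast
  obtain t' where t': "shift_fun (\<lambda>j. f j + (if j = s then int m else 0)) * ?u =
      T.hp t' * shift_fun (\<lambda>j. f j + (if j = s then int m else 0) + (if j = s then 1 else 0))"
    unfolding u using shift_fun_mult by blast
  have "(\<lambda>j. f j + (if j = s then int m else 0) + (if j = s then 1 else 0)) =
      (\<lambda>j. f j + (if j = s then int (Suc m) else 0))"
    by auto
  then have "shift_fun f * ?u ^ Suc m = T.hp (t + t') * shift_fun (\<lambda>j. f j + (if j = s then int (Suc m) else 0))"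
    using t t' by (simp only: power_Suc2 T.hp_add mult.assoc flip: mult.assoc[of "shift_fun f"])
  then show ?case by blast
qed

text \<open>The factor \<open>shift_fun (\<lambda>_. 0)\<close> is needed to start the induction:
  the empty product acts as the identity, which is not a shift, since shifts ignore lists of other
  lengths.\<close>

lemma rep_mon_poly:
  assumes "\<And>i. 0 \<le> b i" "s \<le> 10"
  shows "\<exists>t. shift_fun (\<lambda>_. 0) * rep (mon_poly s b) = T.hp t * shift_fun (\<lambda>j. if j < s then b j else 0)"
  using assms(2)
proof (induction s)
  case 0
  then show ?case by (intro exI[of _ 0]) (simp add: mon_poly_def)
next
  case (Suc s)
  let ?p = "minor_poly (nth_int initial_indices (int s))"
  let ?g = "\<lambda>j. if j < s then b j else 0"
  have rp: "rep (?p ^ m) = shift_endo h rep_form (unit_vec (int s)) ^ m" for m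
    using initial_minor(2)[of s] Suc.prems by (induction m) (simp_all add: T.free_eval_mult)
  obtain t where t: "shift_fun (\<lambda>_. 0) * rep (mon_poly s b) = T.hp t * shift_fun ?g"
    using Suc by auto
  obtain t' where t': "shift_fun ?g * rep (?p ^ nat (b s)) =
      T.hp t' * shift_fun (\<lambda>j. ?g j + (if j = s then int (nat (b s)) else 0))"
    unfolding rp using shift_fun_power by blast
  have g: "(\<lambda>j. ?g j + (if j = s then int (nat (b s)) else 0)) = (\<lambda>j. if j < Suc s then b j else 0)"
    using assms(1)[of s] by (auto simp: fun_eq_iff)
  have "shift_fun (\<lambda>_. 0) * rep (mon_poly (Suc s) b) = shift_fun (\<lambda>_. 0) * rep (mon_poly s b) * rep (?p ^ nat (b s))"
    by (simp add: mon_poly_def T.free_eval_mult mult.assoc)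
  also have "\<dots> = T.hp (t + t') * shift_fun (\<lambda>j. if j < Suc s then b j else 0)"
    unfolding t using t' by (simp only: mult.assoc T.hp_add g)
  finally show ?case by blast
qed

lemma laurent_independent_init: "laurent_independent \<kappa> 10 init_var"
  unfolding laurent_independent_def
proof (intro allI impI, elim conjE)
  fix S :: "(nat \<Rightarrow> int) set" and c
  assume S: "finite S" "S \<subseteq> {a. \<forall>i\<ge>10. a i = 0}"
    and zero: "(\<Sum>a\<in>S. \<kappa> (c a) * laurent_monomial 10 init_var a) = 0"
  \<comment> \<open>Multiplying the relation by the monomial with all exponents \<open>N\<close>
    makes every exponent nonnegative, so that it becomes a relation between polynomials in the
    minors.\<close>
  define N where "N = (\<Sum>a\<in>S. \<Sum>i<10. \<bar>a i\<bar>)"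
  define b where "b a = (\<lambda>i::nat. a i + N)" for a :: "nat \<Rightarrow> int"
  have N: "\<bar>a i\<bar> \<le> N" if "a \<in> S" "i < 10" for a i
  proof -
    have "\<bar>a i\<bar> \<le> (\<Sum>i<10. \<bar>a i\<bar>)" using that by (intro member_le_sum) auto
    also have "\<dots> \<le> N" unfolding N_def using that S by (intro member_le_sum[of a]) (auto intro: sum_nonneg)
    finally show ?thesis .
  qed
  have N0: "0 \<le> N" unfolding N_def by (intro sum_nonneg) auto
  have b_pos: "0 \<le> b a i" if "a \<in> S" for a i
  proof (cases "i < 10")
    case True
    then show ?thesis using N[OF that True] by (simp add: b_def)
  next
    case False
    then show ?thesis using S that N0 by (auto simp: b_def)
  qed
  have lm: "\<exists>s. laurent_monomial 10 init_var a = S.hp s * Y.NM a \<and> Y.NM a = S.hp (- s) * laurent_monomial 10 init_var a" for a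
    unfolding Y.NM_def normalized_monomial_def S.hp_def[symmetric]
    by (intro exI[of _ "- (\<Sum>j<10. \<Sum>i<j. a i * a j * init_L j i)"]) (simp add: S.hp_mult_left)
  have "\<exists>s. laurent_monomial 10 init_var a * Y.NM (\<lambda>_. N) = S.hp s * laurent_monomial 10 init_var (b a)" for a
  proof -
    obtain s1 where "laurent_monomial 10 init_var a = S.hp s1 * Y.NM a" using lm by blast
    moreover obtain s2 where "Y.NM a * Y.NM (\<lambda>_. N) = S.hp s2 * Y.NM (b a)"
      using Y.NM_mult[of a "\<lambda>_. N"] unfolding b_def by blast
    moreover obtain s3 where "Y.NM (b a) = S.hp s3 * laurent_monomial 10 init_var (b a)" using lm by blast
    ultimately show ?thesis by (intro exI[of _ "s1 + (s2 + s3)"]) (simp add: S.hp_add mult.assoc)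
  qed
  then obtain s where s: "\<And>a. laurent_monomial 10 init_var a * Y.NM (\<lambda>_. N) = S.hp (s a) * laurent_monomial 10 init_var (b a)"
    by metis
  \<comment> \<open>\<open>d a\<close> absorbs the power of \<open>h\<close> caused by this
    multiplication; it vanishes only if \<open>c a\<close> does.\<close>
  define d where "d a = c a * h powi s a" for a
  let ?p = "\<Sum>a\<in>S. free_const (d a) * mon_poly 10 (b a)"
  have mon: "mon_poly 10 (b a) \<in> lifts" "\<theta> (mon_poly 10 (b a)) = laurent_monomial 10 init_var (b a)" if "a \<in> S" for a
    using mon_poly_theta[of "b a" 10] b_pos[OF that] by auto
  have sum_lifts: "sum f R \<in> lifts \<and> \<theta> (sum f R) = (\<Sum>a\<in>R. \<theta> (f a))"
    if "finite R" "\<And>a. a \<in> R \<Longrightarrow> f a \<in> lifts" for f :: "(nat \<Rightarrow> int) \<Rightarrow> 'k qpoly" and R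
    using that
  proof (induction R rule: finite_induct)
    case empty
    then show ?case using lifts_closed(3) \<theta>_0 by simp
  next
    case (insert a R)
    then have "f a \<in> lifts" "sum f R \<in> lifts" "\<theta> (sum f R) = (\<Sum>a\<in>R. \<theta> (f a))" by auto
    then show ?case using insert.hyps by (auto simp: \<theta>_simps(1))
  qed
  have lift: "?p \<in> lifts \<and> \<theta> ?p = (\<Sum>a\<in>S. \<theta> (free_const (d a) * mon_poly 10 (b a)))"
    using S(1) mon by (intro sum_lifts) auto
  have "\<theta> ?p = (\<Sum>a\<in>S. \<kappa> (c a) * laurent_monomial 10 init_var a * Y.NM (\<lambda>_. N))"
    unfolding conjunct2[OF lift]
  proof (rule sum.cong[OF refl])
    fix a assume "a \<in> S"
    then show "\<theta> (free_const (d a) * mon_poly 10 (b a)) = \<kappa> (c a) * laurent_monomial 10 init_var a * Y.NM (\<lambda>_. N)"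
      using mon[of a] s[of a] lifts_closed(1)
      by (simp add: \<theta>_simps(2,4) d_def S.scalar_mult S.hp_def[symmetric] mult.assoc)
  qed
  also have "\<dots> = 0"
    unfolding sum_distrib_right[symmetric] zero by simp
  finally have "?p \<in> J"
    using \<theta>_eq_0_iff[OF conjunct1[OF lift]] by simp
  then have "0 = shift_fun (\<lambda>_. 0) * rep ?p"
    using rep_ideal by simp
  also have "\<dots> = (\<Sum>a\<in>S. scalar_endo (d a) * (shift_fun (\<lambda>_. 0) * rep (mon_poly 10 (b a))))"
    by (simp add: T.free_eval_sum T.free_eval_mult T.free_eval_const sum_distrib_left
        T.scalar_left_commute[of "shift_fun _"])
  finally have rep0: "(\<Sum>a\<in>S. scalar_endo (d a) * (shift_fun (\<lambda>_. 0) * rep (mon_poly 10 (b a)))) = 0" by simp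
  \<comment> \<open>The two coordinates of the operator torus beyond the initial minors get exponent
    0.\<close>
  define v where "v a = map (\<lambda>j. if j < 10 then b a j else 0) [0..<12]" for a
  have "\<exists>t. shift_fun (\<lambda>_. 0) * rep (mon_poly 10 (b a)) = T.hp t * shift_endo h rep_form (v a)" if "a \<in> S" for a
    using rep_mon_poly[of "b a" 10] b_pos[OF that] by (simp add: v_def shift_fun_def)
  then obtain t where t: "\<And>a. a \<in> S \<Longrightarrow> shift_fun (\<lambda>_. 0) * rep (mon_poly 10 (b a)) = T.hp (t a) * shift_endo h rep_form (v a)"
    by metis
  have v_inj: "inj_on v S"
  proof (rule inj_onI)
    fix a a' assume a: "a \<in> S" "a' \<in> S" "v a = v a'"
    have "a i = a' i" for i
    proof (cases "i < 10")
      case True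
      have "v a ! i = v a' ! i" using a by simp
      then show ?thesis using True by (simp add: v_def b_def)
    next
      case False
      then have "a i = 0" "a' i = 0"
        using subsetD[OF S(2) a(1)] subsetD[OF S(2) a(2)] by simp_all
      then show ?thesis by simp
    qed
    then show "a = a'" by blast
  qed
  \<comment> \<open>Independence of shifts is stated for sums over exponent vectors, so the
    coefficients are transported along the injective map \<open>v\<close>.\<close>
  define c' where "c' w = d (the_inv_into S v w) * h powi t (the_inv_into S v w)" for w
  have c': "c' (v a) = d a * h powi t a" if "a \<in> S" for a
    using that v_inj by (simp add: c'_def the_inv_into_f_f)
  have zero': "(\<Sum>w\<in>v ` S. scalar_endo (c' w) * shift_endo h rep_form w) = 0"
    unfolding sum.reindex[OF v_inj] comp_def rep0[symmetric]
    by (rule sum.cong[OF refl]) (simp add: c' t T.scalar_mult T.hp_def mult.assoc)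
  have "c' (v a) = 0" if "a \<in> S" for a
    by (rule shift_endo_independent[where n = 12, OF S.h_nonzero _ _ zero']) (use S that in \<open>auto simp: v_def\<close>)
  then show "\<forall>a\<in>S. c a = 0"
    using c' by (auto simp: d_def)
qed

end

section \<open>Cluster variables as Laurent polynomials, and which of them are minors\<close>

section \<open>The cluster variables\<close>

lemma laurent_keys_wf:
  assumes "0 \<le> x" "x < 22"
  shows "wf_keys 10 (laurent_keys x)"
proof -
  have "x \<in> set [0..21]" using assms by simp
  then show ?thesis
    using laurent_keys_length unfolding list_all_iff wf_keys_def by fastforce
qed

lemma variable_index_check:
  "list_all (\<lambda>a. list_all (\<lambda>b. list_all (\<lambda>c. a < b \<and> b < c \<longrightarrow>
     (a, b, c) \<in> set (map variable_index ([0..12] @ [14..18] @ [20..21]))) [1..6]) [1..6]) [1..6]"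
  by code_simp

lemma (in central_scalars) scalar_of_int: "\<kappa> (of_int c) = of_int c"
proof -
  have nat: "\<kappa> (of_nat m) = of_nat m" for m
    by (induction m) (simp_all add: scalar_add)
  show ?thesis
    by (cases c rule: int_diff_cases) (simp add: nat scalar_add scalar_uminus
        diff_conv_add_uminus del: add_uminus_conv_diff)
qed

context grassmannian_fractions
begin

text \<open>Cluster variables are defined by their expansions; that twenty of them are quantum
  minors has to be proved.\<close>

definition V :: "int \<Rightarrow> 'f" where
  "V x = F.torus_eval (laurent_keys x)"

lemma F_eval_collect: "collect r = [] \<Longrightarrow> F.torus_eval r = 0"
  using lincomb_collect[of F.torus_key r] by simp

lemma V_initial:
  assumes "i < 10"
  shows "V (int i) = init_var i" "variable_index (int i) = nth_int initial_indices (int i)"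
proof -
  have i: "i \<in> {0, 1, 2, 3, 4, 5, 6, 7, 8, 9}" using assms by auto
  then have *: "laurent_keys (int i) = [(1, 0 # map (\<lambda>j. if j = i then 1 else 0) [0..<10])] \<and>
      variable_index (int i) = nth_int initial_indices (int i)"
    by (elim insertE emptyE)
       (simp_all add: laurent_keys_def laurent_table_def variable_index_def initial_indices_def upt_rec)
  then show "variable_index (int i) = nth_int initial_indices (int i)" by blast
  have "V (int i) = Mon (map (\<lambda>j. if j = i then 1 else 0) [0..<10])"
    using * by (simp add: V_def F.torus_key_def)
  also have "\<dots> = Y.NM (\<lambda>j. if j = i then 1 else 0)"
    unfolding Mon_def by (rule Y.NM_cong) simp
  also have "\<dots> = init_var i" using assms by (rule Y.NM_unit)
  finally show "V (int i) = init_var i" .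
qed

definition is_minor :: "int \<Rightarrow> bool" where
  "is_minor x \<longleftrightarrow> plucker_index (variable_index x) \<and> V x = Pl (variable_index x)"

lemma is_minor_initial: "i < 10 \<Longrightarrow> is_minor (int i)"
  using V_initial[of i] initial_minor(1)[of i] by (simp add: is_minor_def init_var_def)

text \<open>The minor and the Laurent polynomial satisfy three-term relations with the same
  right-hand side. As \<open>y\<close> is an initial variable, \<open>V y\<close> is invertible and
  can be cancelled.\<close>

lemma is_minor_step:
  assumes rel: "(y, x, a, u, v, b, s, t) \<in> set plucker_relations"
    and y: "0 \<le> y" "y < 10" and m: "is_minor u" "is_minor v" "is_minor s" "is_minor t"
    and x: "plucker_index (variable_index x)" "list_all (\<lambda>z. 0 \<le> z \<and> z < 22) [x, u, v, s, t]"
  shows "is_minor x"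
proof -
  have "y = int (nat y)" "nat y < 10" using y by auto
  then have my: "is_minor y" and Vy: "V y \<noteq> 0"
    using is_minor_initial[of "nat y"] V_initial(1)[of "nat y"] init_var_nonzero[of "nat y"] by simp_all
  have "minor_relation (plucker_relation (y, x, a, u, v, b, s, t))"
    using rel plucker_relations_check unfolding list_all_iff by blast
  then have "sum_list (map (\<lambda>(c, e, I, K). of_int c * (S.hp (2 * e) * (Pl I * Pl K)))
      (plucker_relation (y, x, a, u, v, b, s, t))) = 0"
    by (rule minor_relation_Pl) (use m my x in \<open>auto simp: plucker_relation_def is_minor_def\<close>)
  then have 1: "V y * Pl (variable_index x) =
      S.hp (2 * a) * (V u * V v) + S.hp (2 * b) * (V s * V t)"
    using m my by (simp add: plucker_relation_def is_minor_def algebra_simps)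
  have wf: "wf_keys 10 (laurent_keys y)" "wf_keys 10 (laurent_keys x)" "wf_keys 10 (laurent_keys u)"
    "wf_keys 10 (laurent_keys v)" "wf_keys 10 (laurent_keys s)" "wf_keys 10 (laurent_keys t)"
    using y x(2) by (auto intro!: laurent_keys_wf)
  have "collect (laurent_relation (y, x, a, u, v, b, s, t)) = []"
    using rel laurent_relations_check unfolding list_all_iff by blast
  then have "F.torus_eval (laurent_relation (y, x, a, u, v, b, s, t)) = 0"
    by (rule F_eval_collect)
  then have 2: "V y * V x = S.hp (2 * a) * (V u * V v) + S.hp (2 * b) * (V s * V t)"
    using wf by (simp add: laurent_relation_def V_def F.torus_eval_mult F.torus_eval_shift wf_keys_torus_mult
        algebra_simps)
  have "V y * V x = V y * Pl (variable_index x)"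
    unfolding 1 2 ..
  then show ?thesis
    using Vy x(1) by (simp add: is_minor_def)
qed

text \<open>The relations are used in an order in which their right-hand sides are already known to
  consist of minors. Variables 13 and 19 carry the dummy index (0, 0, 0) and are left out.\<close>

lemma is_minor_variable:
  assumes "x \<in> {0..<22} - {13, 19}"
  shows "is_minor x"
proof -
  have init: "is_minor 0" "is_minor 1" "is_minor 2" "is_minor 3" "is_minor 4" "is_minor 5" "is_minor 6"
    "is_minor 7" "is_minor 8" "is_minor 9"
    using is_minor_initial[of 0] is_minor_initial[of 1] is_minor_initial[of 2] is_minor_initial[of 3]
      is_minor_initial[of 4] is_minor_initial[of 5] is_minor_initial[of 6] is_minor_initial[of 7]
      is_minor_initial[of 8] is_minor_initial[of 9] by simp_all
  note facts = plucker_relations_def plucker_index_def variable_index_def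
  have m10: "is_minor 10"
    by (rule is_minor_step[of 0 10 "1" 3 4 "1" 1 2]) (simp_all add: facts init)
  have m11: "is_minor 11"
    by (rule is_minor_step[of 1 11 "- 1" 0 6 "1" 3 5]) (simp_all add: facts init m10)
  have m12: "is_minor 12"
    by (rule is_minor_step[of 2 12 "- 1" 0 8 "1" 3 7]) (simp_all add: facts init m10 m11)
  have m14: "is_minor 14"
    by (rule is_minor_step[of 1 14 "- 1" 4 6 "1" 5 10]) (simp_all add: facts init m10 m11 m12)
  have m15: "is_minor 15"
    by (rule is_minor_step[of 2 15 "- 1" 4 8 "1" 7 10]) (simp_all add: facts init m10 m11 m12 m14)
  have m16: "is_minor 16"
    by (rule is_minor_step[of 3 16 "1" 9 10 "1" 6 8]) (simp_all add: facts init m10 m11 m12 m14 m15)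
  have m17: "is_minor 17"
    by (rule is_minor_step[of 3 17 "- 1" 2 9 "1" 8 11]) (simp_all add: facts init m10 m11 m12 m14 m15 m16)
  have m18: "is_minor 18"
    by (rule is_minor_step[of 3 18 "- 1" 1 9 "1" 6 12]) (simp_all add: facts init m10 m11 m12 m14 m15 m16 m17)
  have m20: "is_minor 20"
    by (rule is_minor_step[of 3 20 "- 1" 0 9 "1" 11 12]) (simp_all add: facts init m10 m11 m12 m14 m15 m16 m17 m18)
  have m21: "is_minor 21"
    by (rule is_minor_step[of 2 21 "- 1" 4 17 "1" 7 14]) (simp_all add: facts init m10 m11 m12 m14 m15 m16 m17 m18 m20)
  note others = m10 m11 m12 m14 m15 m16 m17 m18 m20 m21
  have "x \<in> {0, 1, 2, 3, 4, 5, 6, 7, 8, 9, 10, 11, 12, 14, 15, 16, 17, 18, 20, 21}"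
    using assms by simp presburger
  then show ?thesis
    using init others by blast
qed

lemma plucker_variable:
  assumes "plucker_index I"
  shows "\<exists>x\<in>{0..<22} - {13, 19}. variable_index x = I"
proof -
  obtain a b c where I: "I = (a, b, c)" by (cases I)
  have abc: "a \<in> set [1..6]" "b \<in> set [1..6]" "c \<in> set [1..6]" "a < b \<and> b < c"
    using assms by (auto simp: I plucker_index_def)
  let ?xs = "[0..12] @ [14..18] @ [20..21]"
  have "(a, b, c) \<in> set (map variable_index ?xs)"
    using bspec[OF bspec[OF bspec[OF variable_index_check[unfolded list_all_iff] abc(1)] abc(2)] abc(3)] abc(4)
    by (rule mp)
  then obtain x where x: "x \<in> set ?xs" "(a, b, c) = variable_index x"
    unfolding set_map by (rule imageE)
  have "x \<in> {0..<22} - {13, 19}" using x(1) by auto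
  then show ?thesis using x(2) I by auto
qed

text \<open>The exponent vectors of one expansion are distinct and the coefficients are powers of
  \<open>h\<close>, so linear independence applies.\<close>

lemma V_nonzero:
  assumes "0 \<le> x" "x < 22"
  shows "V x \<noteq> 0"
proof
  assume V0: "V x = 0"
  define as where "as = nth_int laurent_table x"
  have "x = int (nat x)" "nat x < length laurent_table"
    using assms by (simp_all add: laurent_table_def)
  then have "as \<in> set laurent_table"
    unfolding as_def by (metis nth_int_eq nth_mem)
  then have as: "distinct as" "as \<noteq> []"
    using laurent_distinct unfolding list_all_iff by blast+
  have len: "length a = 10" if "a \<in> set as" for a
    using laurent_keys_wf[OF assms] that by (auto simp: wf_keys_def laurent_keys_def as_def)
  define f where "f a = (\<lambda>i::nat. if i < 10 then a ! i else 0)" for a :: "int list"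
  have inj: "inj_on f (set as)"
  proof (rule inj_onI)
    fix a b assume ab: "a \<in> set as" "b \<in> set as" "f a = f b"
    show "a = b"
    proof (rule nth_equalityI)
      show "length a = length b" using len ab by simp
      fix i assume "i < length a"
      then have "i < 10" using len ab by simp
      then show "a ! i = b ! i" using fun_cong[OF ab(3), of i] by (simp add: f_def)
    qed
  qed
  define e where "e b = h powi (\<Sum>j<10. \<Sum>i<j. b i * b j * init_L j i)" for b :: "nat \<Rightarrow> int"
  have Mon: "Mon a = \<kappa> (e (f a)) * laurent_monomial 10 init_var (f a)" if "a \<in> set as" for a
  proof -
    have "Mon a = Y.NM (f a)"
      unfolding Mon_def by (rule Y.NM_cong) (simp add: f_def)
    then show ?thesis by (simp add: Y.NM_def normalized_monomial_def e_def)
  qed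
  have "F.torus_eval (map (\<lambda>a. (1, 0 # a)) bs) = sum_list (map Mon bs)" for bs
    by (induction bs) (simp_all add: F.torus_key_def)
  then have "sum_list (map Mon as) = 0"
    using V0 by (simp add: V_def laurent_keys_def as_def)
  then have "(\<Sum>a\<in>set as. Mon a) = 0"
    using as(1) by (simp add: sum_list_distinct_conv_sum_set)
  then have "(\<Sum>b\<in>f ` set as. \<kappa> (e b) * laurent_monomial 10 init_var b) = 0"
    unfolding sum.reindex[OF inj] comp_def using Mon by simp
  moreover have "f ` set as \<subseteq> {a. \<forall>i\<ge>10. a i = 0}" by (auto simp: f_def)
  ultimately have "\<forall>b\<in>f ` set as. e b = 0"
    using laurent_independent_init unfolding laurent_independent_def by blast
  then obtain b where "e b = 0" using as(2) by (metis ex_in_conv image_eqI set_empty)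
  then show False by (simp add: e_def)
qed

lemma V_quasi:
  assumes "0 \<le> x" "x < 22" "0 \<le> z" "z < 22" "quasi x z \<noteq> 99"
  shows "V x * V z = S.hp (2 * quasi x z) * (V z * V x)" "quasi z x = - quasi x z"
proof -
  have "x \<in> set [0..21]" "z \<in> set [0..21]" using assms by simp_all
  then have *: "quasi z x = - quasi x z \<and>
     collect (torus_mult initial_form (laurent_keys x) (laurent_keys z) @
       torus_shift (- 1) (2 * quasi x z) (torus_mult initial_form (laurent_keys z) (laurent_keys x))) = []"
    using quasi_check assms(5) unfolding list_all_iff by blast
  then show "quasi z x = - quasi x z" by blast
  have "F.torus_eval (torus_mult initial_form (laurent_keys x) (laurent_keys z) @
       torus_shift (- 1) (2 * quasi x z) (torus_mult initial_form (laurent_keys z) (laurent_keys x))) = 0"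
    using * by (intro F_eval_collect) blast
  then show "V x * V z = S.hp (2 * quasi x z) * (V z * V x)"
    using laurent_keys_wf[of x] laurent_keys_wf[of z] assms
    by (simp add: V_def F.torus_eval_mult F.torus_eval_shift wf_keys_torus_mult)
qed

lemma laurent_product_eval:
  assumes "\<And>x. x \<in> set xs \<Longrightarrow> 0 \<le> x \<and> x < 22"
  shows "wf_keys 10 (laurent_product xs) \<and> F.torus_eval (laurent_product xs) = prod_list (map V xs)"
  using assms
proof (induction xs)
  case Nil
  have "Mon [0, 0, 0, 0, 0, 0, 0, 0, 0, 0] = Y.NM (\<lambda>i. 0)"
    unfolding Mon_def by (rule Y.NM_cong) (auto simp: nth_Cons split: nat.split)
  then show ?case by (simp add: F.torus_key_def Y.NM_0)
next
  case (Cons x xs)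
  then show ?case
    using laurent_keys_wf[of x] by (simp add: F.torus_eval_mult V_def wf_keys_torus_mult)
qed

lemma V_exchange:
  assumes "collect (exchange_relation z z' col) = []" "0 \<le> z" "z < 22" "0 \<le> z'" "z' < 22"
    "\<And>x b. (x, b) \<in> set col \<Longrightarrow> 0 \<le> x \<and> x < 22"
  shows "V z * V z' =
    S.hp (sum_list (map (quasi z) (signed_part 1 col)) - pair_sum quasi (signed_part 1 col)) *
      prod_list (map V (signed_part 1 col)) +
    S.hp (sum_list (map (quasi z) (signed_part (- 1) col)) - pair_sum quasi (signed_part (- 1) col)) *
      prod_list (map V (signed_part (- 1) col))"
proof -
  have prod: "wf_keys 10 (laurent_product (signed_part s col)) \<and>
      F.torus_eval (laurent_product (signed_part s col)) = prod_list (map V (signed_part s col))" for s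
    by (rule laurent_product_eval) (use assms(6) in \<open>auto simp: signed_part_def\<close>)
  have "F.torus_eval (exchange_relation z z' col) = 0"
    using assms(1) by (rule F_eval_collect)
  then show ?thesis
    using prod[of 1] prod[of "- 1"] laurent_keys_wf[of z] laurent_keys_wf[of z'] assms(2-5)
    by (simp add: exchange_relation_def Let_def F.torus_eval_mult F.torus_eval_shift wf_keys_torus_mult V_def
        algebra_simps)
qed

end


section \<open>Invariance of the table of clusters under mutation\<close>

section \<open>Seeds and their mutations\<close>

context quasi_commuting
begin

lemma NM_prod_list:
  assumes "\<And>p. p \<in> set ps \<Longrightarrow> p < r"
  shows "prod_list (map y ps) = hp (pair_sum L ps) * NM (\<lambda>i. int (count_list ps i))"
  using assms
proof (induction ps)
  case Nil
  then show ?case by (simp add: NM_0)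
next
  case (Cons p ps)
  have p: "p < r" using Cons.prems by simp
  have L: "(\<Sum>j<r. int (count_list ps j) * L p j) = sum_list (map (L p) ps)"
  proof -
    have "set ps \<subseteq> {..<r}" using Cons.prems by auto
    then show ?thesis
    proof (induction ps)
      case (Cons a ps)
      have "(\<Sum>j<r. int (count_list (a # ps) j) * L p j) =
          (\<Sum>j<r. (if j = a then L p j else 0) + int (count_list ps j) * L p j)"
        by (intro sum.cong refl) (auto simp: algebra_simps)
      then show ?case using Cons by (simp add: sum.distrib)
    qed simp
  qed
  have "(\<Sum>i<r. \<Sum>j<r. (if i = p then 1 else 0) * int (count_list ps j) * L i j) =
      (\<Sum>i<r. if i = p then (\<Sum>j<r. int (count_list ps j) * L p j) else 0)"
    by (intro sum.cong refl) simp
  also have "\<dots> = sum_list (map (L p) ps)"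
    using p L by simp
  finally have form: "(\<Sum>i<r. \<Sum>j<r. (if i = p then 1 else 0) * int (count_list ps j) * L i j) =
      sum_list (map (L p) ps)" .
  have "y p * NM (\<lambda>i. int (count_list ps i)) =
      hp (sum_list (map (L p) ps)) * NM (\<lambda>i. (if i = p then 1 else 0) + int (count_list ps i))"
    unfolding NM_unit[OF p, symmetric] NM_mult form ..
  also have "(\<lambda>i. (if i = p then 1 else 0) + int (count_list ps i)) = (\<lambda>i. int (count_list (p # ps) i))"
    by auto
  finally have step: "y p * NM (\<lambda>i. int (count_list ps i)) =
      hp (sum_list (map (L p) ps)) * NM (\<lambda>i. int (count_list (p # ps) i))" .
  have "prod_list (map y (p # ps)) = hp (pair_sum L ps) * (y p * NM (\<lambda>i. int (count_list ps i)))"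
    using Cons by (simp add: hp_left_commute)
  then show ?case
    unfolding step by (simp add: hp_mult_left add.commute)
qed

text \<open>Multiplying by \<open>y k\<close> contributes the form of the \<open>k\<close>-th unit
  vector with the exponent vector, which is the first sum because \<open>L k k\<close> is zero.
  Undoing the normalisation of the remaining product gives the second.\<close>

lemma NM_exchange_term:
  assumes k: "k < r" and ps: "\<And>p. p \<in> set ps \<Longrightarrow> p < r" "distinct ps" "k \<notin> set ps"
  shows "y k * NM (\<lambda>i. - (if i = k then 1 else 0) + (if i \<in> set ps then 1 else 0)) =
    hp (sum_list (map (L k) ps) - pair_sum L ps) * prod_list (map y ps)"
proof -
  let ?b = "\<lambda>i. - (if i = k then 1 else 0) + (if i \<in> set ps then 1 else (0::int))"
  have count: "int (count_list ps i) = (if i \<in> set ps then 1 else 0)" for i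
    using ps(2) by (induction ps) auto
  have Lkk: "L k k = 0" using L_skew[OF k k] by simp
  have "(\<Sum>i<r. \<Sum>j<r. (if i = k then 1 else 0) * ?b j * L i j) =
      (\<Sum>i<r. if i = k then (\<Sum>j<r. ?b j * L k j) else 0)"
    by (intro sum.cong refl) simp
  also have "\<dots> = (\<Sum>j<r. ?b j * L k j)" using k by simp
  also have "\<dots> = (\<Sum>j<r. if j \<in> set ps then L k j else 0)"
    by (intro sum.cong refl) (use Lkk in auto)
  also have "\<dots> = (\<Sum>j\<in>set ps. L k j)"
    using ps(1) by (intro sum.mono_neutral_cong_right) auto
  also have "\<dots> = sum_list (map (L k) ps)"
    using ps(2) by (simp add: sum_list_distinct_conv_sum_set)
  finally have form: "(\<Sum>i<r. \<Sum>j<r. (if i = k then 1 else 0) * ?b j * L i j) = sum_list (map (L k) ps)" .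
  have "y k * NM ?b = hp (sum_list (map (L k) ps)) * NM (\<lambda>i. (if i = k then 1 else 0) + ?b i)"
    unfolding NM_unit[OF k, symmetric] NM_mult form ..
  also have "(\<lambda>i. (if i = k then 1 else 0) + ?b i) = (\<lambda>i. int (count_list ps i))"
    by (auto simp: count)
  finally have "y k * NM ?b = hp (sum_list (map (L k) ps)) * NM (\<lambda>i. int (count_list ps i))" .
  moreover have "NM (\<lambda>i. int (count_list ps i)) = hp (- pair_sum L ps) * prod_list (map y ps)"
    using NM_prod_list[of ps] ps(1) by (simp add: hp_mult_left)
  ultimately show ?thesis by (simp add: hp_mult_left)
qed

end

lemma entry_eq: "distinct (map fst col) \<Longrightarrow> (x, b) \<in> set col \<Longrightarrow> entry col x = b"
  by (induction col) (auto simp: rev_image_eqI)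

lemma entry_0: "x \<notin> fst ` set col \<Longrightarrow> entry col x = 0"
  by (induction col) auto

lemma signed_part_iff:
  assumes "distinct (map fst col)" "\<forall>(x, b)\<in>set col. b = 1 \<or> b = - 1" "s = 1 \<or> s = - 1"
  shows "x \<in> set (signed_part s col) \<longleftrightarrow> entry col x = s"
proof
  assume "x \<in> set (signed_part s col)"
  then have "(x, s) \<in> set col" by (auto simp: signed_part_def)
  then show "entry col x = s" using assms(1) by (rule entry_eq[rotated])
next
  assume e: "entry col x = s"
  then have "x \<in> fst ` set col" using entry_0[of x col] assms(3) by fastforce
  then obtain b where "(x, b) \<in> set col" by auto
  then show "x \<in> set (signed_part s col)"
    using e entry_eq[OF assms(1)] by (force simp: signed_part_def)
qed

lemma entry_cases:
  assumes "\<forall>(x, b)\<in>set col. b = 1 \<or> b = - 1"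
  shows "entry col x \<in> {0, 1, - 1}"
  using assms by (induction col) (auto split: if_splits)

lemma column_eq: "distinct (map fst E) \<Longrightarrow> (z, z', col) \<in> set E \<Longrightarrow> column E z = col"
  by (induction E) (auto simp: rev_image_eqI)

lemma pair_sum_map: "pair_sum L (map f xs) = pair_sum (\<lambda>x z. L (f x) (f z)) xs"
  by (induction xs) (simp_all add: comp_def)

lemma pair_sum_cong: "(\<And>x z. x \<in> set xs \<Longrightarrow> z \<in> set xs \<Longrightarrow> L x z = L' x z) \<Longrightarrow> pair_sum L xs = pair_sum L' xs"
proof (induction xs)
  case (Cons x xs)
  have "map (L x) xs = map (L' x) xs" "pair_sum L xs = pair_sum L' xs"
    using Cons by auto
  then show ?case by (simp only: pair_sum.simps)
qed simp

lemma exchanged_not_in_cluster: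
  "list_all (\<lambda>E. list_all (\<lambda>(z, z', col). z' \<notin> set (map fst E)) E) clusters"
  by code_simp

lemma cluster_facts:
  assumes "E \<in> set clusters"
  shows "length E = 4" "distinct (variables E)" "distinct (map fst E)"
    "\<And>x. x \<in> set (variables E) \<Longrightarrow> 0 \<le> x \<and> x < 22"
    "\<And>x z. x \<in> set (variables E) \<Longrightarrow> z \<in> set (variables E) \<Longrightarrow> quasi x z \<noteq> 99"
proof -
  have "valid_cluster E" using clusters_valid assms unfolding list_all_iff by blast
  then show "length E = 4" "distinct (variables E)" "distinct (map fst E)"
    "\<And>x. x \<in> set (variables E) \<Longrightarrow> 0 \<le> x \<and> x < 22"
    "\<And>x z. x \<in> set (variables E) \<Longrightarrow> z \<in> set (variables E) \<Longrightarrow> quasi x z \<noteq> 99"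
    unfolding valid_cluster_def list_all_iff by (auto simp: variables_def)
qed

lemma column_facts:
  assumes "E \<in> set clusters" "(z, z', col) \<in> set E"
  shows "0 \<le> z'" "z' < 22" "distinct (map fst col)" "\<forall>(x, b)\<in>set col. b = 1 \<or> b = - 1"
    "\<And>x b. (x, b) \<in> set col \<Longrightarrow> x \<in> set (variables E) \<and> x \<noteq> z"
    "collect (exchange_relation z z' col) = []" "z' \<notin> set (map fst E)"
proof -
  have "valid_cluster E" using clusters_valid assms unfolding list_all_iff by blast
  then have "case (z, z', col) of (z, z', col) \<Rightarrow> 0 \<le> z' \<and> z' < 22 \<and> distinct (map fst col) \<and>
       list_all (\<lambda>(x, b). x \<in> set (variables E) \<and> x \<noteq> z \<and> (b = 1 \<or> b = - 1)) col \<and>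
       collect (exchange_relation z z' col) = []"
    using assms(2) unfolding valid_cluster_def list_all_iff by blast
  then show "0 \<le> z'" "z' < 22" "distinct (map fst col)" "\<forall>(x, b)\<in>set col. b = 1 \<or> b = - 1"
    "\<And>x b. (x, b) \<in> set col \<Longrightarrow> x \<in> set (variables E) \<and> x \<noteq> z"
    "collect (exchange_relation z z' col) = []"
    unfolding list_all_iff by auto
  show "z' \<notin> set (map fst E)"
    using exchanged_not_in_cluster assms unfolding list_all_iff by fast
qed

context grassmannian_fractions
begin

text \<open>\<open>v\<close> labels the positions of the seed by the variables of the cluster \<open>E\<close>.\<close>

definition seed_inv :: "cluster \<Rightarrow> (nat \<Rightarrow> int) \<Rightarrow> 'f qseed \<Rightarrow> bool" where
  "seed_inv E v = (\<lambda>(y, B, L). E \<in> set clusters \<and> v ` {..<4} = set (map fst E) \<and>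
     (\<forall>i. 4 \<le> i \<and> i < 10 \<longrightarrow> v i = int i) \<and> (\<forall>i<10. y i = V (v i)) \<and>
     (\<forall>i<10. \<forall>k<4. B i k = exchange E (v i) (v k)) \<and> (\<forall>i<10. \<forall>j<10. L i j = quasi (v i) (v j)))"

text \<open>The ten variables of a cluster are distinct, so a labelling of ten positions that
  reaches all of them is injective.\<close>

lemma seed_inv_bij:
  assumes "seed_inv E v (y, B, L)"
  shows "bij_betw v {..<10} (set (variables E))"
proof -
  have E: "E \<in> set clusters" and v: "v ` {..<4} = set (map fst E)" "\<forall>i. 4 \<le> i \<and> i < 10 \<longrightarrow> v i = int i"
    using assms by (auto simp: seed_inv_def)
  have "{4..<10::nat} = {4, 5, 6, 7, 8, 9}" by auto
  then have "int ` {4..<10} = set frozen" by (simp add: frozen_def)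
  moreover have "v ` {4..<10} = int ` {4..<10}" using v(2) by (intro image_cong) auto
  ultimately have "v ` {4..<10} = set frozen" by simp
  moreover have "{..<10::nat} = {..<4} \<union> {4..<10}" by auto
  ultimately have im: "v ` {..<10} = set (variables E)"
    using v(1) by (simp add: image_Un variables_def)
  moreover have "card (set (variables E)) = 10"
    using cluster_facts[OF E] by (simp add: distinct_card) (simp add: variables_def frozen_def)
  ultimately have "inj_on v {..<10}" by (intro eq_card_imp_inj_on) auto
  then show ?thesis using im by (simp add: bij_betw_def)
qed

lemma seed_inv_range:
  assumes "seed_inv E v (y, B, L)" "i < 10"
  shows "v i \<in> set (variables E)" "0 \<le> v i" "v i < 22"
proof -
  show 1: "v i \<in> set (variables E)"
    using bij_betwE[OF seed_inv_bij[OF assms(1)]] assms(2) by simp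
  have "E \<in> set clusters" using assms by (simp add: seed_inv_def)
  then show "0 \<le> v i" "v i < 22" using cluster_facts(4) 1 by auto
qed

lemma seed_inv_quasi:
  assumes inv: "seed_inv E v (y, B, L)"
  shows "quasi_commuting \<kappa> h 10 y L"
proof
  have E: "E \<in> set clusters" using inv by (simp add: seed_inv_def)
  fix i j :: nat
  assume i: "i < 10"
  then show "y i \<noteq> 0"
    using inv V_nonzero seed_inv_range[OF inv i] by (auto simp: seed_inv_def)
  assume j: "j < 10"
  have y: "y i = V (v i)" "y j = V (v j)" and L: "L i j = quasi (v i) (v j)" "L j i = quasi (v j) (v i)"
    using inv i j by (auto simp: seed_inv_def)
  have "quasi (v i) (v j) \<noteq> 99"
    using cluster_facts(5)[OF E] seed_inv_range(1)[OF inv] i j by blast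
  note q = V_quasi[OF seed_inv_range(2,3)[OF inv i] seed_inv_range(2,3)[OF inv j] this]
  show "L i j = - L j i" using q(2) L by simp
  show "y i * y j = \<kappa> ((h\<^sup>2) powi L i j) * y j * y i"
    using q(1) y L by (simp add: S.hp_def power_int_mult mult.assoc)
qed

text \<open>\<open>y k\<close> times the mutation formula is the right-hand side of the tabulated
  exchange relation, so cancelling \<open>y k\<close> shows that the new element is
  \<open>V z'\<close>. The new matrices are compared entry by entry with the finite checks.\<close>

lemma seed_inv_mutate:
  assumes inv: "seed_inv E v (y, B, L)" and k: "k < 4" and zE: "(v k, z', col) \<in> set E"
    and E': "E' \<in> set clusters" "mutated_cluster E (v k) z' E'"
  shows "seed_inv E' (v(k := z')) (mutate_seed \<kappa> h 10 k (y, B, L))"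
proof -
  define z where "z = v k"
  have k10: "k < 10" using k by simp
  have E: "E \<in> set clusters" and v4: "v ` {..<4} = set (map fst E)"
    and vfrozen: "\<And>i. 4 \<le> i \<Longrightarrow> i < 10 \<Longrightarrow> v i = int i" and y: "\<And>i. i < 10 \<Longrightarrow> y i = V (v i)"
    and B: "\<And>i k. i < 10 \<Longrightarrow> k < 4 \<Longrightarrow> B i k = exchange E (v i) (v k)"
    and L: "\<And>i j. i < 10 \<Longrightarrow> j < 10 \<Longrightarrow> L i j = quasi (v i) (v j)"
    using inv by (auto simp: seed_inv_def)
  note col = column_facts[OF E zE]
  note bij = seed_inv_bij[OF inv]
  have v_eq: "v i = v j \<longleftrightarrow> i = j" if "i < 10" "j < 10" for i j
    using bij that by (auto simp: bij_betw_def inj_on_eq_iff)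
  interpret q: quasi_commuting \<kappa> h 10 y L using inv by (rule seed_inv_quasi)
  have column: "column E z = col"
    unfolding z_def using cluster_facts(3)[OF E] zE by (rule column_eq)
  have Bk: "B i k = entry col (v i)" if "i < 10" for i
    using B[OF that k] by (simp add: exchange_def column flip: z_def)
  define pos where "pos = inv_into {..<10} v"
  have pos: "pos x < 10" "v (pos x) = x" if "x \<in> set (variables E)" for x
    using that bij_betw_inv_into_right[OF bij that] bij_betwE[OF bij_betw_inv_into[OF bij]]
    by (auto simp: pos_def)
  \<comment> \<open>The positions of the variables in the exchange monomial of sign
    \<open>s\<close>; the tabulated column speaks of variables, the mutation formula of
    positions.\<close>
  define ps where "ps s = map pos (signed_part s col)" for s
  have part: "x \<in> set (variables E)" "x \<noteq> z" if "x \<in> set (signed_part s col)" for x s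
    using that col(5) by (auto simp: signed_part_def z_def)
  have part_distinct: "distinct (signed_part s col)" for s
    using col(3) unfolding signed_part_def by (rule distinct_map_filter)
  have ps_lt: "p < 10" if "p \<in> set (ps s)" for p s
    using that pos(1) part(1) by (auto simp: ps_def)
  have ps_distinct: "distinct (ps s)" for s
  proof -
    have "inj_on pos (set (signed_part s col))"
      using pos(2) part(1) by (metis inj_onI)
    then show ?thesis using part_distinct by (simp add: ps_def distinct_map)
  qed
  have ps_iff: "i \<in> set (ps s) \<longleftrightarrow> B i k = s" if "i < 10" "s = 1 \<or> s = - 1" for i s
  proof -
    have "i \<in> set (ps s) \<longleftrightarrow> v i \<in> set (signed_part s col)"
    proof
      assume "i \<in> set (ps s)"
      then show "v i \<in> set (signed_part s col)" using pos(2) part(1) by (auto simp: ps_def)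
    next
      assume *: "v i \<in> set (signed_part s col)"
      have "pos (v i) = i" unfolding pos_def using bij that by (intro bij_betw_inv_into_left[of v _ "set (variables E)"]) auto
      then show "i \<in> set (ps s)" using * unfolding ps_def by force
    qed
    also have "\<dots> \<longleftrightarrow> entry col (v i) = s"
      using col(3,4) that(2) by (rule signed_part_iff)
    finally show ?thesis using Bk[OF that(1)] by simp
  qed
  have B_cases: "B i k \<in> {0, 1, - 1}" if "i < 10" for i
    using entry_cases[OF col(4)] Bk[OF that] by simp
  have k_ps: "k \<notin> set (ps s)" for s
  proof
    assume "k \<in> set (ps s)"
    then obtain x where x: "x \<in> set (signed_part s col)" "k = pos x" by (auto simp: ps_def)
    then show False using part[OF x(1)] pos(2)[of x] by (simp add: z_def)
  qed
  have ps_sum: "sum_list (map (L j) (ps s)) = sum_list (map (quasi (v j)) (signed_part s col))" if "j < 10" for j s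
    unfolding ps_def map_map using that pos part(1) L
    by (intro arg_cong[where f = sum_list] map_cong) auto
  have ps_pair: "pair_sum L (ps s) = pair_sum quasi (signed_part s col)" for s
    unfolding ps_def pair_sum_map using pos part(1) L by (intro pair_sum_cong) auto
  have ps_prod: "prod_list (map y (ps s)) = prod_list (map V (signed_part s col))" for s
    unfolding ps_def map_map using pos part(1) y
    by (intro arg_cong[where f = prod_list] map_cong) auto
  have monomial: "y k * q.NM (\<lambda>i. - (if i = k then 1 else 0) + (if i \<in> set (ps s) then 1 else 0)) =
      S.hp (sum_list (map (quasi z) (signed_part s col)) - pair_sum quasi (signed_part s col)) *
      prod_list (map V (signed_part s col))" for s
    using q.NM_exchange_term[OF k10 ps_lt ps_distinct k_ps, of s] ps_sum[OF k10] ps_pair ps_prod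
    by (simp add: z_def)
  have plus: "normalized_monomial \<kappa> h 10 y L (\<lambda>i. - (if i = k then 1 else 0) + (if B i k > 0 then B i k else 0)) =
      q.NM (\<lambda>i. - (if i = k then 1 else 0) + (if i \<in> set (ps 1) then 1 else 0))"
    unfolding q.NM_def[symmetric]
  proof (rule q.NM_cong)
    fix i :: nat assume "i < 10"
    then show "- (if i = k then 1 else 0) + (if B i k > 0 then B i k else 0) =
        - (if i = k then 1 else 0) + (if i \<in> set (ps 1) then 1 else 0)"
      using ps_iff[of i 1] B_cases[of i] by auto
  qed
  have minus: "normalized_monomial \<kappa> h 10 y L (\<lambda>i. - (if i = k then 1 else 0) - (if B i k < 0 then B i k else 0)) =
      q.NM (\<lambda>i. - (if i = k then 1 else 0) + (if i \<in> set (ps (- 1)) then 1 else 0))"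
    unfolding q.NM_def[symmetric]
  proof (rule q.NM_cong)
    fix i :: nat assume "i < 10"
    then show "- (if i = k then 1 else 0) - (if B i k < 0 then B i k else 0) =
        - (if i = k then 1 else 0) + (if i \<in> set (ps (- 1)) then 1 else 0)"
      using ps_iff[of i "- 1"] B_cases[of i] by auto
  qed
  have z: "0 \<le> z" "z < 22" using seed_inv_range[OF inv k10] by (simp_all add: z_def)
  have "y k * mutate_cluster \<kappa> h 10 k (y, B, L) k = V z * V z'"
    unfolding mutate_cluster_def prod.case fun_upd_same plus minus distrib_left monomial
    using V_exchange[OF col(6)[folded z_def] z col(1,2)] col(5) cluster_facts(4)[OF E] by auto
  then have new: "mutate_cluster \<kappa> h 10 k (y, B, L) k = V z'"
    using y[OF k10] V_nonzero[OF z] by (simp add: z_def)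
  have vars': "v' \<in> set (variables E')" if "v' \<in> set (map fst E')" for v'
    using that by (simp add: variables_def)
  have m: "z' \<in> set (map fst E')" "\<forall>w\<in>set (map fst E). w = z \<or> w \<in> set (map fst E')" "quasi z' z' = 0"
    "\<forall>x\<in>set (variables E). x \<noteq> z \<longrightarrow>
      quasi x z' = - quasi x z + sum_list (map (quasi x) (signed_part 1 (column E z))) \<and> quasi z' x = - quasi x z'"
    using E'(2) unfolding mutated_cluster_def list_all_iff z_def[symmetric] by simp_all
  have mB: "exchange E' x w =
           (if o_x = z \<or> o_w = z then - exchange E o_x o_w
            else exchange E o_x o_w +
              (\<bar>exchange E o_x z\<bar> * exchange E z o_w + exchange E o_x z * \<bar>exchange E z o_w\<bar>) div 2)"
    if "w \<in> set (map fst E')" "x \<in> set (variables E')"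
      "o_w = (if w = z' then z else w)" "o_x = (if x = z' then z else x)" for x w o_x o_w
    using E'(2) that unfolding mutated_cluster_def list_all_iff Let_def z_def[symmetric] by blast
  let ?v = "v(k := z')"
  \<comment> \<open>A mutable position is excluded by a check on the table, a frozen one by the
    distinctness of the variables of \<open>E'\<close>.\<close>
  have z'_new: "v i \<noteq> z'" if "i < 10" for i
  proof (cases "i < 4")
    case True
    then have "v i \<in> set (map fst E)" using v4 by blast
    then show ?thesis using col(7) by metis
  next
    case False
    then have "v i \<in> set frozen"
      using vfrozen[of i] that by (auto simp: frozen_def)
    then show ?thesis using cluster_facts(2)[OF E'(1)] m(1) by (auto simp: variables_def)
  qed
  have v'4: "?v ` {..<4} = set (map fst E')"
  proof (rule card_subset_eq)
    show "?v ` {..<4} \<subseteq> set (map fst E')"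
    proof
      fix x assume "x \<in> ?v ` {..<4}"
      then obtain i where i: "i < 4" "x = ?v i" by auto
      show "x \<in> set (map fst E')"
      proof (cases "i = k")
        case False
        then have "v i \<noteq> z" using v_eq[of i k] i k10 by (simp add: z_def)
        moreover have "v i \<in> set (map fst E)" using v4 i by blast
        ultimately have "v i \<in> set (map fst E')" using bspec[OF m(2), of "v i"] by blast
        then show ?thesis using i False by simp
      qed (use m(1) i in simp)
    qed
    have "inj_on ?v {..<4}"
    proof (rule inj_onI)
      fix i j assume "i \<in> {..<4}" "j \<in> {..<4}" "?v i = ?v j"
      then show "i = j" using v_eq[of i j] z'_new[of i] z'_new[of j] by (auto split: if_splits)
    qed
    then have "card (?v ` {..<4}) = 4" by (metis card_image card_lessThan)
    moreover have "card (set (map fst E')) = 4"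
      using cluster_facts(1,3)[OF E'(1)] by (simp only: distinct_card length_map)
    ultimately show "card (?v ` {..<4}) = card (set (map fst E'))" by simp
  qed simp
  have v'frozen: "?v i = int i" if "4 \<le> i" "i < 10" for i
    using vfrozen that k by auto
  have v'_vars: "?v i \<in> set (variables E')" if "i < 10" for i
  proof (cases "i < 4")
    case True
    then have "?v i \<in> set (map fst E')" using v'4 by blast
    then show ?thesis by (rule vars')
  next
    case False
    then have "?v i \<in> set frozen" using v'frozen[of i] that by (auto simp: frozen_def)
    then show ?thesis by (simp add: variables_def)
  qed
  \<comment> \<open>The old name of a position is recovered from the new one in the form in which
    \<open>mutated_cluster\<close> was checked.\<close>
  have old: "v i = (if ?v i = z' then z else ?v i)" if "i < 10" for i
    using z'_new[OF that] by (auto simp: z_def)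
  have "mutate_exchange k B i j = exchange E' (?v i) (?v j)" if "i < 10" "j < 4" for i j
  proof -
    have "?v j \<in> set (map fst E')" using v'4 that by blast
    moreover have "j < 10" using that by simp
    ultimately have "exchange E' (?v i) (?v j) =
        (if v i = z \<or> v j = z then - exchange E (v i) (v j)
         else exchange E (v i) (v j) +
           (\<bar>exchange E (v i) z\<bar> * exchange E z (v j) + exchange E (v i) z * \<bar>exchange E z (v j)\<bar>) div 2)"
      using v'_vars[OF that(1)] old[OF that(1)] old[OF \<open>j < 10\<close>] by (intro mB)
    then show ?thesis
      using B[OF that] B[OF that(1) k] B[OF k10 that(2)] v_eq[OF that(1) k10] v_eq[OF \<open>j < 10\<close> k10]
      by (simp add: mutate_exchange_def z_def)
  qed
  moreover have "mutate_quasi_commutation 10 k B L i j = quasi (?v i) (?v j)" if ij: "i < 10" "j < 10" for i j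
  proof -
    have l': "- L j k + (\<Sum>i | i < 10 \<and> B i k > 0. B i k * L j i) = quasi (v j) z'" if "j < 10" "j \<noteq> k" for j
    proof -
      have "{i. i < 10 \<and> B i k > 0} = set (ps 1)"
      proof (rule Set.set_eqI)
        fix i
        show "i \<in> {i. i < 10 \<and> B i k > 0} \<longleftrightarrow> i \<in> set (ps 1)"
          using ps_iff[of i 1] B_cases[of i] ps_lt[of i 1] by (cases "i < 10") auto
      qed
      then have "(\<Sum>i | i < 10 \<and> B i k > 0. B i k * L j i) = (\<Sum>i\<in>set (ps 1). B i k * L j i)"
        by (rule arg_cong)
      also have "\<dots> = (\<Sum>i\<in>set (ps 1). L j i)"
      proof (intro sum.cong refl)
        fix i assume i: "i \<in> set (ps 1)"
        then show "B i k * L j i = L j i" using ps_iff[OF ps_lt[OF i], of 1] by simp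
      qed
      also have "\<dots> = sum_list (map (quasi (v j)) (signed_part 1 col))"
        using ps_distinct[of 1] ps_sum[OF that(1), of 1] by (simp add: sum_list_distinct_conv_sum_set)
      finally have "(\<Sum>i | i < 10 \<and> B i k > 0. B i k * L j i) =
          sum_list (map (quasi (v j)) (signed_part 1 col))" .
      moreover have "v j \<in> set (variables E)" "v j \<noteq> z"
        using seed_inv_range(1)[OF inv that(1)] v_eq[OF that(1) k10] that(2) by (simp_all add: z_def)
      moreover from this have "quasi (v j) z' = - quasi (v j) z + sum_list (map (quasi (v j)) (signed_part 1 (column E z)))"
        using bspec[OF m(4), of "v j"] by blast
      ultimately show ?thesis using L[OF that(1) k10] unfolding column z_def[symmetric] by linarith
    qed
    have anti: "quasi z' (v j) = - quasi (v j) z'" if "j < 10" "j \<noteq> k" for j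
    proof -
      have "v j \<noteq> z" using v_eq[OF that(1) k10] that(2) by (simp add: z_def)
      then show ?thesis using bspec[OF m(4) seed_inv_range(1)[OF inv that(1)]] by blast
    qed
    show ?thesis
      using l'[OF ij(1)] l'[OF ij(2)] anti[OF ij(2)] L[OF ij] m(3)
      by (simp add: mutate_quasi_commutation_def Let_def)
  qed
  moreover have "mutate_cluster \<kappa> h 10 k (y, B, L) i = V (?v i)" if "i < 10" for i
  proof (cases "i = k")
    case False
    then show ?thesis using y[OF that] by (simp add: mutate_cluster_def)
  qed (use new in simp)
  ultimately show ?thesis
    using E'(1) v'4 v'frozen by (simp add: seed_inv_def mutate_seed_def)
qed

end

lemma initial_cluster_eq: "hd clusters =
    [(0, 10, [(3, 1), (4, 1), (1, - 1), (2, - 1)]), (1, 11, [(0, 1), (6, 1), (3, - 1), (5, - 1)]), (2, 12, [(0, 1), (8, 1), (3, - 1), (7, - 1)]), (3, 13, [(1, 1), (2, 1), (9, 1), (0, - 1), (6, - 1), (8, - 1)])]"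
  by (simp add: clusters_def)

lemma initial_compatibility_check:
  "list_all (\<lambda>k. list_all (\<lambda>j.
     sum_list (map (\<lambda>i. exchange (hd clusters) i k * nth_int (nth_int rep_form i) j) [0..9]) =
       (if j = k then 2 else 0)) [0..9]) [0..3]"
  "list_all (\<lambda>i. list_all (\<lambda>j. exchange (hd clusters) i j = - exchange (hd clusters) j i) [0..3]) [0..3]"
  by code_simp+

section \<open>Reachable seeds, generation of the algebra, and the type\<close>

context grassmannian_fractions
begin

definition init_B :: "nat \<Rightarrow> nat \<Rightarrow> int" where
  "init_B i j = exchange (hd clusters) (int i) (int j)"

definition init_seed :: "'f qseed" where
  "init_seed = (init_var, init_B, init_L)"

definition mutation_step :: "'f qseed \<Rightarrow> 'f qseed \<Rightarrow> bool" where
  "mutation_step = (\<lambda>S T. \<exists>k\<in>{..<4}. T = mutate_seed \<kappa> h 10 k S)"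

lemma hd_clusters: "hd clusters \<in> set clusters" "map fst (hd clusters) = [0, 1, 2, 3]"
  by (simp_all add: clusters_def)

lemma init_seed_inv: "seed_inv (hd clusters) int init_seed"
proof -
  have "{..<4::nat} = {0, 1, 2, 3}" by auto
  then have "int ` {..<4} = set (map fst (hd clusters))"
    by (simp add: hd_clusters)
  then show ?thesis
    using V_initial(1) hd_clusters(1) init_L_table(2) by (simp add: seed_inv_def init_seed_def init_B_def)
qed

lemma mutate_seed_inv:
  assumes "seed_inv E v S" "k < 4"
  obtains E' z' where "seed_inv E' (v(k := z')) (mutate_seed \<kappa> h 10 k S)"
proof -
  obtain y B L where S: "S = (y, B, L)" by (cases S)
  have E: "E \<in> set clusters" "v k \<in> set (map fst E)"
    using assms by (auto simp: seed_inv_def S)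
  then obtain z' col where zE: "(v k, z', col) \<in> set E" by auto
  have "list_ex (mutated_cluster E (v k) z') clusters"
    using clusters_mutated E(1) zE unfolding list_all_iff by fast
  then obtain E' where "E' \<in> set clusters" "mutated_cluster E (v k) z' E'"
    unfolding list_ex_iff by blast
  then show ?thesis
    using that seed_inv_mutate[OF assms(1)[unfolded S] assms(2) zE] unfolding S by blast
qed

text \<open>The table is closed under mutation, so only its clusters occur on any path. The same
  cluster may return with its positions permuted, hence the existential labelling.\<close>

lemma reachable_seed_inv:
  assumes "mutation_step\<^sup>*\<^sup>* init_seed S"
  shows "\<exists>E v. seed_inv E v S"
  using assms
proof (induction rule: rtranclp_induct)
  case base
  show ?case using init_seed_inv by blast
next
  case (step S T)
  then obtain E v k where "seed_inv E v S" "k < 4" "T = mutate_seed \<kappa> h 10 k S"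
    by (auto simp: mutation_step_def)
  then show ?case by (metis mutate_seed_inv)
qed

lemma cluster_variables_eq:
  "cluster_variables \<kappa> h 10 {..<4} init_seed = {y i | y B L i. i < 10 \<and> mutation_step\<^sup>*\<^sup>* init_seed (y, B, L)}"
  by (simp add: cluster_variables_def mutation_step_def)

lemma seed_variable:
  assumes "mutation_step\<^sup>*\<^sup>* init_seed (y, B, L)" "seed_inv E v (y, B, L)" "i < 10"
  shows "V (v i) \<in> cluster_variables \<kappa> h 10 {..<4} init_seed"
proof -
  have "V (v i) = y i" using assms(2,3) by (simp add: seed_inv_def)
  then show ?thesis unfolding cluster_variables_eq using assms(1,3) by blast
qed

lemma cluster_variables_subset: "cluster_variables \<kappa> h 10 {..<4} init_seed \<subseteq> V ` {0..<22}"
proof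
  fix x assume "x \<in> cluster_variables \<kappa> h 10 {..<4} init_seed"
  then obtain y B L i where x: "x = y i" "i < 10" "mutation_step\<^sup>*\<^sup>* init_seed (y, B, L)"
    unfolding cluster_variables_eq by blast
  obtain E v where inv: "seed_inv E v (y, B, L)" using reachable_seed_inv[OF x(3)] by blast
  then have "x = V (v i)" using x by (simp add: seed_inv_def)
  then show "x \<in> V ` {0..<22}" using seed_inv_range[OF inv x(2)] by auto
qed

lemma list_cases_singleton:
  obtains "xs = []" | x where "xs = [x]" | x x' xs' where "xs = x # x' # xs'"
  by (metis list.exhaust)

text \<open>Each step of the checked walk is realised by a mutation of actual seeds, and the
  variable created by it stands at the mutated position.\<close>

lemma walk_visits:
  "walk E p \<Longrightarrow> seed_inv E v S \<Longrightarrow> mutation_step\<^sup>*\<^sup>* init_seed S \<Longrightarrow> (z, z') \<in> set p \<Longrightarrow>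
    V z' \<in> cluster_variables \<kappa> h 10 {..<4} init_seed"
proof (induction p arbitrary: E v S)
  case (Cons s p)
  obtain w w' where s: "s = (w, w')" by (cases s)
  obtain y B L where S: "S = (y, B, L)" by (cases S)
  have "(w, w') \<in> set (map (\<lambda>(z, z', col). (z, z')) E)"
    and "case filter (mutated_cluster E w w') clusters of [E'] \<Rightarrow> walk E' p | _ \<Rightarrow> False"
    using Cons.prems(1) by (simp_all only: s walk.simps)
  then obtain col E' where E: "(w, w', col) \<in> set E"
    and F: "filter (mutated_cluster E w w') clusters = [E']" "walk E' p"
    by (cases "filter (mutated_cluster E w w') clusters" rule: list_cases_singleton) auto
  have E': "E' \<in> set clusters" "mutated_cluster E w w' E'"
  proof -
    have "E' \<in> set (filter (mutated_cluster E w w') clusters)" unfolding F(1) by simp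
    then show "E' \<in> set clusters" "mutated_cluster E w w' E'" by simp_all
  qed
  have "v ` {..<4} = set (map fst E)"
    using Cons.prems(2) unfolding seed_inv_def S prod.case by blast
  moreover have "w \<in> set (map fst E)" using imageI[OF E, of fst] by simp
  ultimately have "w \<in> v ` {..<4}" by simp
  then obtain k where k: "k < 4" "w = v k" by auto
  define T where "T = mutate_seed \<kappa> h 10 k S"
  have T: "seed_inv E' (v(k := w')) T"
    unfolding T_def S by (rule seed_inv_mutate[OF Cons.prems(2)[unfolded S] k(1) E[unfolded k(2)] E'[unfolded k(2)]])
  have reach: "mutation_step\<^sup>*\<^sup>* init_seed T"
    using Cons.prems(3) k(1) by (auto simp: T_def mutation_step_def intro: rtranclp.rtrancl_into_rtrancl)
  show ?case
  proof (cases "(z, z') = s")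
    case True
    obtain y' B' L' where T': "T = (y', B', L')" by (cases T)
    have "k < 10" using k(1) by simp
    from seed_variable[OF reach[unfolded T'] T[unfolded T'] this] show ?thesis using True s by simp
  next
    case False
    then show ?thesis using Cons.IH[OF F(2) T reach] Cons.prems(4) by simp
  qed
qed simp

lemma V_cluster_variable:
  assumes "0 \<le> x" "x < 22"
  shows "V x \<in> cluster_variables \<kappa> h 10 {..<4} init_seed"
proof (cases "x < 10")
  case True
  then have "V (int (nat x)) \<in> cluster_variables \<kappa> h 10 {..<4} init_seed"
    using seed_variable[OF _ init_seed_inv[unfolded init_seed_def], of "nat x"] assms
    by (simp add: init_seed_def)
  then show ?thesis using assms by simp
next
  case False
  then have "x \<in> {10, 11, 12, 13, 14, 15, 16, 17, 18, 19, 20, 21}"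
    using assms(2) by simp presburger
  then have "x \<in> snd ` set mutation_walk"
    by (elim insertE emptyE; simp add: mutation_walk_def)
  then obtain z where "(z, x) \<in> set mutation_walk" by auto
  then show ?thesis
    using walk_visits[OF mutation_walk_check init_seed_inv rtranclp.rtrancl_refl] by blast
qed

abbreviation GA :: "'f set" where
  "GA \<equiv> \<iota> ` carrier A"

lemma GA_subring: "subring GA type_ring"
  unfolding image_A by (rule ring.generate_ring_is_subring[OF ring_type_ring]) simp

lemma GA_closed:
  "\<kappa> c \<in> GA" "x \<in> GA \<Longrightarrow> y \<in> GA \<Longrightarrow> x + y \<in> GA" "x \<in> GA \<Longrightarrow> y \<in> GA \<Longrightarrow> x * y \<in> GA"
  "x \<in> GA \<Longrightarrow> - x \<in> GA" "S.hp e \<in> GA"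
proof -
  show c: "\<kappa> c \<in> GA" for c
    unfolding image_A by (intro generate_ring.incl) auto
  then show "S.hp e \<in> GA" by (simp add: S.hp_def)
  show "x \<in> GA \<Longrightarrow> y \<in> GA \<Longrightarrow> x + y \<in> GA" "x \<in> GA \<Longrightarrow> y \<in> GA \<Longrightarrow> x * y \<in> GA" "x \<in> GA \<Longrightarrow> - x \<in> GA"
    using subringE(5-7)[OF GA_subring] by simp_all
qed

text \<open>Minors are generators. The two other variables are found by solving their quadratic
  relations, where their coefficient is a power of \<open>h\<close> and hence invertible.\<close>

lemma V_GA:
  assumes "0 \<le> x" "x < 22"
  shows "V x \<in> GA"
proof -
  have minor: "V x \<in> GA" if "x \<in> {0..<22} - {13, 19}" for x
    using is_minor_variable[OF that] unfolding image_A is_minor_def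
    by (intro generate_ring.incl) auto
  have wf: "wf_keys 10 (laurent_keys x)" if "x \<in> {0..<22}" for x
    using that by (intro laurent_keys_wf) auto
  have quadratic: "V x \<in> GA"
    if "collect (torus_mult initial_form (laurent_keys a) (laurent_keys b) @ torus_shift (- 1) e (laurent_keys x) @
      torus_shift (- 1) f (torus_mult initial_form (laurent_keys c) (laurent_keys d))) = []"
      "{a, b, c, d} \<subseteq> {0..<22} - {13, 19}" "x \<in> {0..<22}" for a b c d e f x
  proof -
    have "F.torus_eval (torus_mult initial_form (laurent_keys a) (laurent_keys b) @ torus_shift (- 1) e (laurent_keys x) @
      torus_shift (- 1) f (torus_mult initial_form (laurent_keys c) (laurent_keys d))) = 0"
      using that(1) by (rule F_eval_collect)
    then have "S.hp e * V x = V a * V b + - (S.hp f * (V c * V d))"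
      using wf[of a] wf[of b] wf[of c] wf[of d] wf[of x] that(2,3)
      by (simp add: V_def F.torus_eval_mult F.torus_eval_shift wf_keys_torus_mult algebra_simps)
    then have "S.hp (- e) * (S.hp e * V x) = S.hp (- e) * (V a * V b + - (S.hp f * (V c * V d)))"
      by simp
    then have "V x = S.hp (- e) * (V a * V b + - (S.hp f * (V c * V d)))"
      by (simp add: S.hp_mult_left)
    then show ?thesis
      using minor that(2) by (simp del: add_uminus_conv_diff add: GA_closed)
  qed
  consider "x = 13" | "x = 19" | "x \<in> {0..<22} - {13, 19}" using assms by auto
  then show ?thesis
  proof cases
    case 1
    show ?thesis unfolding 1 by (rule quadratic[OF quadratic_variables_check(1)]) simp_all
  next
    case 2
    show ?thesis unfolding 2 by (rule quadratic[OF quadratic_variables_check(2)]) simp_all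
  next
    case 3
    then show ?thesis by (rule minor)
  qed
qed

text \<open>One inclusion holds because only tabulated variables are reachable, the other because
  all twenty minors are reached.\<close>

lemma generated_by_cluster_variables:
  "subalgebra_generated type_ring \<kappa> (cluster_variables \<kappa> h 10 {..<4} init_seed) = GA"
  unfolding subalgebra_generated_def
proof (rule equalityI)
  have "range \<kappa> \<union> cluster_variables \<kappa> h 10 {..<4} init_seed \<subseteq> GA"
  proof (rule Un_least)
    show "range \<kappa> \<subseteq> GA" by (rule image_subsetI) (rule GA_closed(1))
    have "V ` {0..<22} \<subseteq> GA" by (rule image_subsetI) (simp only: atLeastLessThan_iff V_GA)
    then show "cluster_variables \<kappa> h 10 {..<4} init_seed \<subseteq> GA"
      by (rule subset_trans[OF cluster_variables_subset])
  qed
  then show "generate_ring type_ring (range \<kappa> \<union> cluster_variables \<kappa> h 10 {..<4} init_seed) \<subseteq> GA"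
    by (intro ring.generate_ring_min_subring1[OF ring_type_ring] GA_subring) auto
  let ?G = "generate_ring type_ring (range \<kappa> \<union> cluster_variables \<kappa> h 10 {..<4} init_seed)"
  have "Pl I \<in> ?G" if I: "plucker_index I" for I
  proof -
    obtain x where x: "x \<in> {0..<22} - {13, 19}" "variable_index x = I"
      using plucker_variable[OF I] by blast
    then have "Pl I = V x" using is_minor_variable[OF x(1)] by (simp add: is_minor_def)
    then show ?thesis using V_cluster_variable[of x] x(1) by (intro generate_ring.incl) auto
  qed
  then have "range \<kappa> \<union> Pl ` Collect plucker_index \<subseteq> ?G"
    by (auto intro: generate_ring.incl)
  then show "GA \<subseteq> ?G"
    unfolding image_A
    by (intro ring.generate_ring_min_subring1[OF ring_type_ring] ring.generate_ring_is_subring[OF ring_type_ring]) auto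
qed

text \<open>A skew subfield with the scalars and the initial cluster contains all Laurent monomials,
  hence all minors, the Grassmannian and its fractions.\<close>

lemma generates_skew_field_init: "generates_skew_field \<kappa> 10 init_var"
  unfolding generates_skew_field_def
proof (intro allI impI, elim conjE)
  fix D :: "'f set"
  assume D: "subring D (type_ring :: 'f ring)" "\<forall>x\<in>D. inverse x \<in> D" "range \<kappa> \<subseteq> D" "init_var ` {..<10} \<subseteq> D"
  have closed: "x \<in> D \<Longrightarrow> y \<in> D \<Longrightarrow> x + y \<in> D" "x \<in> D \<Longrightarrow> y \<in> D \<Longrightarrow> x * y \<in> D" "x \<in> D \<Longrightarrow> - x \<in> D"
    "0 \<in> D" "1 \<in> D" for x y
    using subringE(2,3,5-7)[OF D(1)] by simp_all
  have prod: "(\<And>x. x \<in> set xs \<Longrightarrow> x \<in> D) \<Longrightarrow> prod_list xs \<in> D" for xs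
    by (induction xs) (auto intro: closed)
  have pow: "x \<in> D \<Longrightarrow> x powi m \<in> D" for x m
  proof -
    assume x: "x \<in> D"
    have "z ^ n \<in> D" if "z \<in> D" for z n using that by (induction n) (auto intro: closed)
    then show ?thesis using x D(2) by (simp add: power_int_def)
  qed
  have Mon: "Mon a \<in> D" for a
  proof -
    have "laurent_monomial 10 init_var (\<lambda>i. a ! i) \<in> D"
      unfolding laurent_monomial_def using D(4) by (intro prod) (auto intro!: pow)
    then show ?thesis
      using D(3) unfolding Mon_def Y.NM_def normalized_monomial_def by (intro closed(2)) auto
  qed
  have of_int: "(of_int c :: 'f) \<in> D" for c
  proof -
    have nat: "(of_nat n :: 'f) \<in> D" for n by (induction n) (auto intro: closed)
    show ?thesis
      using closed(1)[OF nat closed(3)[OF nat]] by (cases c rule: int_diff_cases) simp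
  qed
  have "lincomb F.torus_key ts \<in> D" for ts
  proof (induction ts)
    case (Cons t ts)
    obtain c u where t: "t = (c, u)" by (cases t)
    have "S.hp (hd u) \<in> D" using D(3) by (auto simp: S.hp_def)
    then show ?case using Cons Mon of_int by (auto simp: t F.torus_key_def intro!: closed(1,2))
  qed (simp add: closed)
  then have V: "V x \<in> D" for x by (simp add: V_def)
  have "Pl I \<in> D" if "plucker_index I" for I
  proof -
    obtain x where x: "x \<in> {0..<22} - {13, 19}" "variable_index x = I"
      using plucker_variable[OF \<open>plucker_index I\<close>] by blast
    then have "Pl I = V x" using is_minor_variable[OF x(1)] by (simp add: is_minor_def)
    then show ?thesis using V by simp
  qed
  then have GA: "GA \<subseteq> D"
    unfolding image_A using D(1,3) by (intro ring.generate_ring_min_subring1[OF ring_type_ring]) auto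
  show "D = UNIV"
  proof (intro equalityI subsetI)
    fix z :: 'f
    obtain p r where pr: "p \<in> lifts" "r \<in> lifts" "z = \<theta> p * inverse (\<theta> r)"
      by (rule fraction)
    then have "\<theta> p \<in> D" "\<theta> r \<in> D"
      using GA \<iota>_in_image_iff by blast+
    then show "z \<in> D" using pr(3) D(2) closed(2) by blast
  qed simp
qed

lemma init_seed_quantum: "quantum_seed \<kappa> h 10 {..<4} init_seed"
proof -
  have skew: "\<forall>i\<in>{..<4}. \<forall>j\<in>{..<4}. init_B i j = - init_B j i"
  proof (intro ballI)
    fix i j :: nat assume "i \<in> {..<4}" "j \<in> {..<4}"
    then have "int i \<in> set [0..3]" "int j \<in> set [0..3]" by auto
    then show "init_B i j = - init_B j i"
      using initial_compatibility_check(2) unfolding list_all_iff init_B_def by blast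
  qed
  have compatible: "\<forall>k\<in>{..<4}. \<forall>j<10. (\<Sum>i<10. init_B i k * init_L i j) = (if j = k then 2 else 0)"
  proof (intro ballI allI impI)
    fix k j :: nat assume kj: "k \<in> {..<4}" "j < 10"
    then have "int k \<in> set [0..3]" "int j \<in> set [0..9]" by auto
    then have "sum_list (map (\<lambda>i. exchange (hd clusters) i (int k) * nth_int (nth_int rep_form i) (int j)) [0..9]) =
        (if int j = int k then 2 else 0)"
      using initial_compatibility_check(1) unfolding list_all_iff by blast
    moreover have "[0..9] = map int [0..<10]" by (simp add: upto.simps upt_rec)
    ultimately have "(\<Sum>i\<leftarrow>[0..<10]. exchange (hd clusters) (int i) (int k) * nth_int (nth_int rep_form (int i)) (int j)) =
        (if j = k then 2 else 0)"
      by (simp only: map_map o_def of_nat_eq_iff)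
    then have "(\<Sum>i<10. exchange (hd clusters) (int i) (int k) * nth_int (nth_int rep_form (int i)) (int j)) =
        (if j = k then 2 else 0)"
      by (simp only: interv_sum_list_conv_sum_set_nat set_upt atLeast0LessThan)
    then show "(\<Sum>i<10. init_B i k * init_L i j) = (if j = k then 2 else 0)"
      using kj(2) by (simp add: init_B_def init_L_eq cong: sum.cong_simp)
  qed
  show ?thesis
    unfolding quantum_seed_def init_seed_def prod.case
  proof (intro conjI)
    show "\<forall>i<10. init_var i \<noteq> 0" using Y.y_nonzero by blast
    show "\<forall>i<10. \<forall>j<10. init_L i j = - init_L j i" by (intro allI impI) (rule Y.L_skew)
    show "\<forall>i<10. \<forall>j<10. init_var i * init_var j = \<kappa> ((h\<^sup>2) powi init_L i j) * init_var j * init_var i"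
      by (intro allI impI) (rule Y.y_commute)
    show "\<forall>k\<in>{..<4}. \<forall>j<10. j \<noteq> k \<longrightarrow> (\<Sum>i<10. init_B i k * init_L i j) = 0"
    proof (intro ballI allI impI)
      fix k j :: nat assume "k \<in> {..<4}" "j < 10" "j \<noteq> k"
      then show "(\<Sum>i<10. init_B i k * init_L i j) = 0" using bspec[OF compatible, of k] by presburger
    qed
    show "\<forall>k\<in>{..<4}. (\<Sum>i<10. init_B i k * init_L i k) > 0"
    proof
      fix k :: nat assume "k \<in> {..<4}"
      moreover from this have "k < 10" by simp
      ultimately have "(\<Sum>i<10. init_B i k * init_L i k) = 2" using bspec[OF compatible, of k] by presburger
      then show "(\<Sum>i<10. init_B i k * init_L i k) > 0" by linarith
    qed
    show "{..<4 :: nat} \<subseteq> {..<10}" by auto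
  qed (rule is_algebra_F generates_skew_field_init laurent_independent_init skew)+
qed

text \<open>The initial quiver consists of two oriented triangles that share the arrow from 3 to 0.
  Mutation at 0 cancels the arrows from 1 and 2 to 3 and leaves a star with centre 0.\<close>

lemma mutation_type_D4: "has_mutation_type {..<4} init_B {..<4 :: nat} (dynkin_D 4)"
proof -
  let ?B = "mutate_exchange 0 init_B"
  have "(\<lambda>C C'. \<exists>k\<in>{..<4}. C' = mutate_exchange k C)\<^sup>*\<^sup>* init_B ?B"
    by (intro r_into_rtranclp bexI[of _ 0]) auto
  moreover have "is_orientation_of {..<4} (quiver ?B) {..<4 :: nat} (dynkin_D 4)"
  proof -
    have D: "dynkin_D 4 = {{0, 1}, {1, 2}, {1, 3}}"
    proof -
      have "{i. Suc (Suc i) < 4} = {0, 1}" by auto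
      then have "dynkin_D 4 = (\<lambda>i. {i, Suc i}) ` {0, 1} \<union> {{4 - 3, 4 - 1}}"
        by (simp only: dynkin_D_def setcompr_eq_image)
      then show ?thesis by (simp add: One_nat_def[symmetric] insert_commute)
    qed
    have vertices: "{..<4 :: nat} = {0, 1, 2, 3}" by auto
    \<comment> \<open>The branch vertex is 1 in \<open>dynkin_D 4\<close> and 0 in the mutated
      quiver.\<close>
    let ?\<phi> = "transpose 0 (1 :: nat)"
    have "bij_betw ?\<phi> {..<4} {..<4}"
      by (intro bij_betw_byWitness[of _ ?\<phi>]) (auto simp: transpose_def)
    moreover have "\<forall>u\<in>{..<4}. \<forall>v\<in>{..<4}. quiver ?B (?\<phi> u) (?\<phi> v) + quiver ?B (?\<phi> v) (?\<phi> u) =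
        (if {u, v} \<in> dynkin_D 4 then 1 else 0)"
    proof (intro ballI)
      fix u v :: nat assume "u \<in> {..<4}" "v \<in> {..<4}"
      then have "u \<in> {0, 1, 2, 3}" "v \<in> {0, 1, 2, 3}" unfolding vertices .
      then show "quiver ?B (?\<phi> u) (?\<phi> v) + quiver ?B (?\<phi> v) (?\<phi> u) = (if {u, v} \<in> dynkin_D 4 then 1 else 0)"
        by (elim insertE emptyE; hypsubst; simp add: D transpose_def quiver_def mutate_exchange_def
            init_B_def exchange_def initial_cluster_eq doubleton_eq_iff)
    qed
    ultimately show ?thesis unfolding is_orientation_of_def by blast
  qed
  ultimately show ?thesis unfolding has_mutation_type_def by blast
qed

section \<open>Straightening of minors and finite generation of one-sided ideals\<close>

subsection \<open>The quantum Grassmannian is noetherian\<close>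

definition gen :: "nat \<Rightarrow> 'f" where
  "gen k = V (nth_int lex_variables (int k))"

lemma lex_variable:
  assumes "0 \<le> s" "s < 20"
  shows "nth_int lex_variables s \<in> {0..<22} - {13, 19}"
proof -
  have "s \<in> {0, 1, 2, 3, 4, 5, 6, 7, 8, 9, 10, 11, 12, 13, 14, 15, 16, 17, 18, 19}" using assms by simp presburger
  then show ?thesis by (elim insertE emptyE; simp add: lex_variables_def)
qed

lemma lower_pair_multiset:
  assumes "lower_pair i j s t" "0 \<le> j" "j < i"
  shows "{#nat s, nat t#} < {#nat i, nat j#}"
proof -
  have add: "{#a, b#} < {#a, c#}" if "b < c" for a b c :: nat
    using that by simp
  \<comment> \<open>In the multiset order a single larger letter outweighs any number of smaller
    ones.\<close>
  have both: "{#a, b#} < {#c, d#}" if "a < c" "b < c" for a b c d :: nat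
  proof -
    have "{#a, b#} < {#c#}"
      using that by simp
    moreover have "{#c#} < {#c, d#}" using le_multiset_right_total[of "{#c#}" d] by (simp add: add_mset_commute)
    ultimately show ?thesis by (rule less_trans)
  qed
  consider "0 \<le> s" "0 \<le> t" "s < i" "t < i" | "s = i" "0 \<le> t" "t < j" | "t = i" "0 \<le> s" "s < j"
    using assms(1) by auto
  then show ?thesis
  proof cases
    case 1
    then show ?thesis by (intro both) auto
  next
    case 2
    then show ?thesis by (auto intro: add)
  next
    case 3
    then show ?thesis using add[of "nat s" "nat j" "nat i"] by (simp add: add_mset_commute)
  qed
qed

lemma diff_eq_of_sum_eq_0:
  fixes a b c :: "'a::ab_group_add"
  assumes "a + (- b + - c) = 0"
  shows "a - b = c"
proof -
  have "a - b - c = 0"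
    using assms by (simp only: diff_conv_add_uminus add.assoc)
  then show ?thesis by (simp only: right_minus_eq)
qed

text \<open>The tabulated relation has the invertible scalar \<open>h powi e\<close>, and its
  correction terms are words of two letters with lower content.\<close>

lemma gen_straighten_less:
  assumes "j < i" "i < 20"
  shows "\<exists>c. c \<noteq> 0 \<and> gen i * gen j - \<kappa> c * (gen j * gen i) \<in> S.span_below gen 20 {#i, j#}"
proof -
  have "int i \<in> set [0..19]" "int j \<in> set [0..int i - 1]" using assms by auto
  then have "(int i, int j) \<in> set (map (\<lambda>(i, j, e, ts). (i, j)) straightening)"
    using straightening_complete unfolding list_all_iff by blast
  then obtain e ts where r: "(int i, int j, e, ts) \<in> set straightening" by auto
  then have check: "collect (straightening_relation (int i, int j, e, ts)) = []"
      "\<forall>(c, f, s, t)\<in>set ts. lower_pair (int i) (int j) s t"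
    using straightening_check unfolding list_all_iff by fastforce+
  let ?V = "\<lambda>s. V (nth_int lex_variables s)"
  have wf: "wf_keys 10 (laurent_keys (nth_int lex_variables s))" if "0 \<le> s" "s < 20" for s
    using lex_variable[OF that] by (intro laurent_keys_wf) auto
  have range: "0 \<le> s \<and> s < 20 \<and> 0 \<le> t \<and> t < 20" if "(c, f, s, t) \<in> set ts" for c f s t
    using check(2) that assms by fastforce
  have sum: "F.torus_eval (concat (map (\<lambda>(c, f, s, t). torus_shift (- c) f
        (torus_mult initial_form (laurent_keys (nth_int lex_variables s)) (laurent_keys (nth_int lex_variables t)))) us)) =
      - sum_list (map (\<lambda>(c, f, s, t). of_int c * S.hp f * (?V s * ?V t)) us)"
    if "set us \<subseteq> set ts" for us
    using that
  proof (induction us)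
    case (Cons u us)
    obtain c f s t where u: "u = (c, f, s, t)" by (cases u)
    have "0 \<le> s" "s < 20" "0 \<le> t" "t < 20" using range[of c f s t] Cons.prems u by auto
    then show ?case
      using Cons wf by (simp add: u F.torus_eval_shift F.torus_eval_mult wf_keys_torus_mult V_def)
  qed simp
  have "F.torus_eval (straightening_relation (int i, int j, e, ts)) = 0"
    using check(1) by (rule F_eval_collect)
  moreover have "gen i * gen j + (- (S.hp e * (gen j * gen i)) +
      - sum_list (map (\<lambda>(c, f, s, t). of_int c * S.hp f * (?V s * ?V t)) ts)) =
    F.torus_eval (straightening_relation (int i, int j, e, ts))"
    using wf[of "int i"] wf[of "int j"] assms
    by (simp add: straightening_relation_def F.torus_eval_shift F.torus_eval_mult wf_keys_torus_mult sum V_def gen_def)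
  ultimately have "gen i * gen j - S.hp e * (gen j * gen i) =
      sum_list (map (\<lambda>(c, f, s, t). of_int c * S.hp f * (?V s * ?V t)) ts)"
    by (intro diff_eq_of_sum_eq_0) (rule trans)
  also have "\<dots> \<in> S.span_below gen 20 {#i, j#}"
  proof -
    have "sum_list (map (\<lambda>(c, f, s, t). of_int c * S.hp f * (?V s * ?V t)) us) \<in> S.span_below gen 20 {#i, j#}"
      if "set us \<subseteq> set ts" for us
      using that
    proof (induction us)
      case Nil
      show ?case by (simp add: S.span_below.zero)
    next
      case (Cons u us)
      obtain c f s t where u: "u = (c, f, s, t)" by (cases u)
      have uts: "(c, f, s, t) \<in> set ts" using Cons.prems u by auto
      have st: "0 \<le> s" "s < 20" "0 \<le> t" "t < 20" using range[OF uts] by auto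
      have "lower_pair (int i) (int j) s t" using check(2) uts by blast
      then have "{#nat s, nat t#} < {#i, j#}"
        using lower_pair_multiset[of "int i" "int j" s t] assms by simp
      then have "\<kappa> (of_int c * h powi f) * S.word gen [nat s, nat t] \<in> S.span_below gen 20 {#i, j#}"
        using st by (intro S.span_below_word) auto
      moreover have "\<kappa> (of_int c * h powi f) * S.word gen [nat s, nat t] = of_int c * S.hp f * (?V s * ?V t)"
        using st by (simp add: gen_def S.scalar_mult S.hp_def S.scalar_of_int)
      ultimately have "of_int c * S.hp f * (?V s * ?V t) \<in> S.span_below gen 20 {#i, j#}" by simp
      then show ?case using Cons by (simp add: u S.span_below_add)
    qed
    then show ?thesis by blast
  qed
  finally show ?thesis
    unfolding S.hp_def by (intro exI[of _ "h powi e"]) simp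
qed

sublocale G: quasi_commuting_generators \<kappa> h gen 20
proof
  fix i j :: nat assume ij: "i < 20" "j < 20" "i \<noteq> j"
  show "\<exists>c. c \<noteq> 0 \<and> gen i * gen j - \<kappa> c * (gen j * gen i) \<in> S.span_below gen 20 {#i, j#}"
  proof (cases "j < i")
    case True
    then show ?thesis using gen_straighten_less ij by blast
  next
    case False
    then obtain c where c: "c \<noteq> 0" "gen j * gen i - \<kappa> c * (gen i * gen j) \<in> S.span_below gen 20 {#j, i#}"
      using gen_straighten_less[of i j] ij by auto
    \<comment> \<open>Solving for the opposite order means dividing by \<open>- c\<close>, which
      keeps lower terms low; the content of the pair is symmetric.\<close>
    have "\<kappa> (- inverse c) * (gen j * gen i - \<kappa> c * (gen i * gen j)) \<in> S.span_below gen 20 {#j, i#}"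
      using c(2) by (rule S.span_below_scalar)
    moreover have "\<kappa> (- inverse c) * (gen j * gen i - \<kappa> c * (gen i * gen j)) =
        gen i * gen j - \<kappa> (inverse c) * (gen j * gen i)"
      using S.scalar_inverse[OF c(1)]
      by (simp add: S.scalar_uminus right_diff_distrib) (simp add: mult.assoc[symmetric])
    ultimately show ?thesis
      using c(1) by (intro exI[of _ "inverse c"]) (simp add: add_mset_commute)
  qed
qed

lemma span_below_mult:
  assumes "x \<in> S.span_below gen 20 a" "z \<in> S.span_below gen 20 b"
  shows "x * z \<in> S.span_below gen 20 (a + b)"
  using assms(1)
proof (induction rule: S.span_below.induct)
  case (add xs x c)
  have "S.word gen xs * z \<in> S.span_below gen 20 (mset xs + b)"
    using assms(2) add.hyps(1) by (rule S.span_below_mult_left)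
  moreover have "mset xs + b \<le> a + b" using add.hyps(2) by simp
  ultimately have "S.word gen xs * z \<in> S.span_below gen 20 (a + b)"
    by (rule S.span_below_mono)
  then show ?case
    using add.IH by (simp add: distrib_right mult.assoc S.span_below_add S.span_below_scalar)
qed (simp add: S.span_below.zero)

lemma GA_span: "GA \<subseteq> (\<Union>a. S.span_below gen 20 a)"
proof
  fix x assume "x \<in> GA"
  then have "x \<in> generate_ring type_ring (range \<kappa> \<union> Pl ` Collect plucker_index)" by (simp only: image_A)
  then have "\<exists>a. x \<in> S.span_below gen 20 a"
  proof (induction rule: generate_ring.induct)
    case one
    \<comment> \<open>Bounds are strict, so constants are placed below \<open>{#0#}\<close> and,
      further down, a generator below \<open>{#k, k#}\<close>.\<close>
    have "\<kappa> 1 * S.word gen [] \<in> S.span_below gen 20 {#0#}" by (rule S.span_below_word) auto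
    then show ?case by auto
  next
    case (incl x)
    then show ?case
    proof
      assume "x \<in> range \<kappa>"
      then obtain c where "x = \<kappa> c * S.word gen []" by auto
      moreover have "\<kappa> c * S.word gen [] \<in> S.span_below gen 20 {#0#}" by (rule S.span_below_word) auto
      ultimately show ?thesis by blast
    next
      assume "x \<in> Pl ` Collect plucker_index"
      then obtain I where I: "plucker_index I" "x = Pl I" by blast
      obtain w where w: "w \<in> {0..<22} - {13, 19}" "variable_index w = I" using plucker_variable[OF I(1)] by blast
      then have x: "x = V w" using is_minor_variable[OF w(1)] I(2) by (simp add: is_minor_def)
      have "w \<in> {0, 1, 2, 3, 4, 5, 6, 7, 8, 9, 10, 11, 12, 14, 15, 16, 17, 18, 20, 21}"
        using w(1) by simp presburger
      then have "w \<in> set lex_variables" by (elim insertE emptyE; simp add: lex_variables_def)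
      then obtain k where k: "k < length lex_variables" "lex_variables ! k = w" by (auto simp: in_set_conv_nth)
      have "k < 20" using k(1) by (simp add: lex_variables_def)
      then have "\<kappa> 1 * S.word gen [k] \<in> S.span_below gen 20 {#k, k#}" by (intro S.span_below_word) auto
      moreover have "\<kappa> 1 * S.word gen [k] = x" using k by (simp add: gen_def nth_int_eq x)
      ultimately show ?thesis by blast
    qed
  next
    case (a_inv x)
    then obtain a where "x \<in> S.span_below gen 20 a" by blast
    then have "- x \<in> S.span_below gen 20 a" by (rule S.span_below_uminus)
    then show ?case by auto
  next
    case (eng_add x z)
    then obtain a b where ab: "x \<in> S.span_below gen 20 a" "z \<in> S.span_below gen 20 b" by blast
    have "x \<in> S.span_below gen 20 (max a b)" by (rule S.span_below_mono[OF ab(1)]) simp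
    moreover have "z \<in> S.span_below gen 20 (max a b)" by (rule S.span_below_mono[OF ab(2)]) simp
    ultimately have "x + z \<in> S.span_below gen 20 (max a b)" by (rule S.span_below_add)
    then show ?case by (auto | force)
  next
    case (eng_mult x z)
    then obtain a b where ab: "x \<in> S.span_below gen 20 a" "z \<in> S.span_below gen 20 b" by blast
    then have "x * z \<in> S.span_below gen 20 (a + b)" by (rule span_below_mult)
    then show ?case by (auto | force)
  qed
  then show "x \<in> (\<Union>a. S.span_below gen 20 a)" by blast
qed

lemma gen_GA: "i < 20 \<Longrightarrow> gen i \<in> GA"
  using lex_variable[of "int i"] by (auto simp: gen_def intro!: V_GA)

lemma ideal_submodule:
  assumes "additive_subgroup I A" and "\<And>i a. i < 20 \<Longrightarrow> a \<in> \<iota> ` I \<Longrightarrow> T i a \<in> \<iota> ` I"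
    and "\<And>c a. a \<in> \<iota> ` I \<Longrightarrow> \<kappa> c * a \<in> \<iota> ` I"
  shows "G.submodule T (\<iota> ` I)"
proof -
  interpret additive_subgroup I A by fact
  have IA: "I \<subseteq> carrier A" by (rule a_subset)
  have add: "\<iota> a + \<iota> b \<in> \<iota> ` I" if "a \<in> I" "b \<in> I" for a b
  proof -
    have "\<iota> a + \<iota> b = \<iota> (a \<oplus>\<^bsub>Q\<^esub> b)" using that IA by (intro \<iota>_hom(1)[symmetric]) auto
    then show ?thesis using a_closed[OF that] by auto
  qed
  have "0 = \<iota> \<zero>\<^bsub>Q\<^esub>" using \<theta>_0 by (simp add: \<theta>_def cls_0)
  then have "0 \<in> \<iota> ` I" using zero_closed by auto
  then show ?thesis
    using add assms(2,3) unfolding G.submodule_def by auto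
qed

text \<open>Ideals are carried to submodules of the skew field, and the injectivity of
  \<open>\<iota>\<close> brings inclusions of images back. Stated for any kind of ideal so that left
  and right are covered at once.\<close>

lemma noetherian_transfer:
  assumes closed: "\<And>I. idl I \<Longrightarrow> I \<subseteq> carrier A \<and> G.submodule T (\<iota> ` I)"
    and T: "\<And>i x a. i < 20 \<Longrightarrow> G.monic a x \<Longrightarrow> G.monic (add_mset i a) (T i x)" and "idl I"
  shows "\<exists>S. finite S \<and> S \<subseteq> I \<and> (\<forall>J. idl J \<and> S \<subseteq> J \<longrightarrow> I \<subseteq> J)"
proof -
  have I: "I \<subseteq> carrier A" "G.submodule T (\<iota> ` I)" using closed[OF \<open>idl I\<close>] by auto
  have span: "\<iota> ` I \<subseteq> (\<Union>a. S.span_below gen 20 a)" using I(1) GA_span by blast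
  have finitely_generated: "\<exists>S'. finite S' \<and> S' \<subseteq> \<iota> ` I \<and> (\<forall>J. G.submodule T J \<and> S' \<subseteq> J \<longrightarrow> \<iota> ` I \<subseteq> J)"
  proof (rule G.submodule_finitely_generated)
    show "G.monic (add_mset i a) (T i x)" if "i < 20" "G.monic a x" for i x a using that by (rule T)
  qed (rule I(2) span)+
  then obtain S' where S': "finite S'" "S' \<subseteq> \<iota> ` I"
    and least: "\<forall>J. G.submodule T J \<and> S' \<subseteq> J \<longrightarrow> \<iota> ` I \<subseteq> J"
    by (elim exE conjE)
  obtain S where S: "S \<subseteq> I" "finite S" "S' = \<iota> ` S"
    using finite_subset_image[OF S'(1,2)] by blast
  have "I \<subseteq> J" if J: "idl J" "S \<subseteq> J" for J
  proof
    fix a assume a: "a \<in> I"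
    have J': "J \<subseteq> carrier A" "G.submodule T (\<iota> ` J)" using closed[OF J(1)] by auto
    have "S' \<subseteq> \<iota> ` J" unfolding S(3) using J(2) by (rule image_mono)
    then have "\<iota> ` I \<subseteq> \<iota> ` J" using spec[OF least, of "\<iota> ` J"] J'(2) by simp
    then have "\<iota> a \<in> \<iota> ` J" using a by (rule subsetD[OF _ imageI])
    then obtain b where b: "b \<in> J" "\<iota> a = \<iota> b" by blast
    have "a = b" using b a I(1) J'(1) \<iota>_inj[of a b] by blast
    then show "a \<in> J" using b(1) by simp
  qed
  then show ?thesis using S by blast
qed

lemma GA_mult_image:
  assumes "x \<in> GA"
  shows "left_ideal I A \<Longrightarrow> a \<in> \<iota> ` I \<Longrightarrow> x * a \<in> \<iota> ` I"
    and "right_ideal I A \<Longrightarrow> a \<in> \<iota> ` I \<Longrightarrow> a * x \<in> \<iota> ` I"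
proof -
  obtain w where w: "w \<in> carrier A" "x = \<iota> w" using assms by blast
  show "x * a \<in> \<iota> ` I" if I': "left_ideal I A" "a \<in> \<iota> ` I"
  proof -
    obtain b where b: "b \<in> I" "a = \<iota> b" using I'(2) by blast
    have I: "I \<subseteq> carrier A" using I'(1) additive_subgroup.a_subset by (auto simp: left_ideal_def)
    have "w \<otimes>\<^bsub>Q\<^esub> b \<in> I" using I'(1) b w by (simp add: left_ideal_def)
    moreover have "x * a = \<iota> (w \<otimes>\<^bsub>Q\<^esub> b)" using b w I by (subst \<iota>_hom(2)) auto
    ultimately show ?thesis by blast
  qed
  show "a * x \<in> \<iota> ` I" if I': "right_ideal I A" "a \<in> \<iota> ` I"
  proof -
    obtain b where b: "b \<in> I" "a = \<iota> b" using I'(2) by blast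
    have I: "I \<subseteq> carrier A" using I'(1) additive_subgroup.a_subset by (auto simp: right_ideal_def)
    have "b \<otimes>\<^bsub>Q\<^esub> w \<in> I" using I'(1) b w by (simp add: right_ideal_def)
    moreover have "a * x = \<iota> (b \<otimes>\<^bsub>Q\<^esub> w)" using b w I by (subst \<iota>_hom(2)) auto
    ultimately show ?thesis by blast
  qed
qed

lemma left_noetherian_A: "left_noetherian A"
  unfolding left_noetherian_def
proof (intro allI impI)
  fix I assume "left_ideal I A"
  then show "\<exists>S. finite S \<and> S \<subseteq> I \<and> (\<forall>J. left_ideal J A \<and> S \<subseteq> J \<longrightarrow> I \<subseteq> J)"
  proof (rule noetherian_transfer[where T = "\<lambda>i x. gen i * x" and idl = "\<lambda>I. left_ideal I A", rotated 2])
    show "I \<subseteq> carrier A \<and> G.submodule (\<lambda>i x. gen i * x) (\<iota> ` I)" if I: "left_ideal I A" for I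
    proof
      have sub: "additive_subgroup I A" using I by (simp add: left_ideal_def)
      then show "I \<subseteq> carrier A" by (rule additive_subgroup.a_subset)
      show "G.submodule (\<lambda>i x. gen i * x) (\<iota> ` I)"
        by (rule ideal_submodule[OF sub GA_mult_image(1)[OF gen_GA I] GA_mult_image(1)[OF GA_closed(1) I]])
    qed
  qed (rule G.monic_mult_left)
qed

lemma right_noetherian_A: "right_noetherian A"
  unfolding right_noetherian_def
proof (intro allI impI)
  fix I assume "right_ideal I A"
  then show "\<exists>S. finite S \<and> S \<subseteq> I \<and> (\<forall>J. right_ideal J A \<and> S \<subseteq> J \<longrightarrow> I \<subseteq> J)"
  proof (rule noetherian_transfer[where T = "\<lambda>i x. x * gen i" and idl = "\<lambda>I. right_ideal I A", rotated 2])
    show "I \<subseteq> carrier A \<and> G.submodule (\<lambda>i x. x * gen i) (\<iota> ` I)" if I: "right_ideal I A" for I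
    proof
      have sub: "additive_subgroup I A" using I by (simp add: right_ideal_def)
      then show "I \<subseteq> carrier A" by (rule additive_subgroup.a_subset)
      \<comment> \<open>A right ideal admits scalars on the left because they are central.\<close>
      have scalar: "\<kappa> c * a \<in> \<iota> ` I" if "a \<in> \<iota> ` I" for c a
        using GA_mult_image(2)[OF GA_closed(1) I that] S.scalar_central by metis
      show "G.submodule (\<lambda>i x. x * gen i) (\<iota> ` I)"
        by (rule ideal_submodule[OF sub GA_mult_image(2)[OF gen_GA I] scalar])
    qed
  qed (rule G.monic_mult_right)
qed

lemma quantum_cluster_algebra:
  "quantum_cluster_algebra_of_type h A \<eta> \<iota> {..<4 :: nat} (dynkin_D 4)"
  unfolding quantum_cluster_algebra_of_type_def \<kappa>_def[symmetric]
  using is_algebra_A noncomm_domain_A left_noetherian_A right_noetherian_A fractions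
    init_seed_quantum[unfolded init_seed_def] generated_by_cluster_variables[unfolded init_seed_def] mutation_type_D4
  by blast

end

theorem mainTheorem3:
  fixes q q_half :: "'k::field"
    and \<iota> :: "'k qpoly set \<Rightarrow> 'f::division_ring"
  assumes "q \<noteq> 0"
    and "q_half ^ 2 = q"
    and "skew_field_of_fractions (quantum_grassmannian q 3 6) \<iota>"
  shows "quantum_cluster_algebra_of_type q_half (quantum_grassmannian q 3 6) (qmatrix_scalar q 3 6) \<iota>
           {..<4::nat} (dynkin_D 4)"
proof -
  interpret grassmannian_fractions q q_half \<iota>
    using assms by unfold_locales
  show ?thesis by (rule quantum_cluster_algebra)
qed

end
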